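(* The following decision problem is $\Pi_3^P$-complete: given two (finite, ground) ELPs $\Pi_1=(\mathcal{A},\mathcal{E},\mathcal{R}_1)$ and $\Pi_2=(\mathcal{A},\mathcal{E},\mathcal{R}_2)$, decide whether $\Pi_1$ and $\Pi_2$ are uniformly CWV-equivalent.
   Context: Logic programs, GL-reduct and answer sets $AS(\cdot)$ are as usual for disjunctive programs with nested default negation $\neg$ (rules $a_1\vee\dots\vee a_l\leftarrow a_{l+1},\dots,a_m,\neg\ell_1,\dots,\neg\ell_n$, $\ell_i$ atoms or negated atoms; answer set $M$: a model of the program such that no proper subset is a model of the GL-reduct w.r.t. $M$). An ELP is a triple $(\mathcal{A},\mathcal{E},\mathcal{R})$: $\mathcal{A}$ atoms, $\mathcal{E}$ a set of epistemic literals $\mathbf{not}\,\ell$ ($\ell$ a literal), $\mathcal{R}$ a finite set of rules $a_1\vee\cdots\vee a_k\leftarrow\ell_1,\dots,\ell_m,\xi_1,\dots,\xi_j,\neg\xi_{j+1},\dots,\neg\xi_n$ with $\xi_i\in\mathcal{E}$. For $D\subseteq\mathcal{A}$, $\Pi\cup D$ adds the facts $a\leftarrow$ ($a\in D$). For a guess $\Phi\subseteq\mathcal{E}$, the epistemic reduct $\Pi^\Phi$ replaces each $\mathbf{not}\,\ell\in\Phi$ by $\top$ and every remaining $\mathbf{not}$ by $\neg$. $\mathcal{I}$ is $\Phi$-compatible w.r.t. $\mathcal{E}$ iff $\mathcal{I}\neq\emptyset$, each $\mathbf{not}\,\ell\in\Phi$ has some $I\in\mathcal{I}$ with $I\not\models\ell$,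 and each $\mathbf{not}\,\ell\in\mathcal{E}\setminus\Phi$ has $I\models\ell$ for all $I\in\mathcal{I}$. A candidate world view (CWV) of $\Pi$ is $\mathcal{M}=AS(\Pi^\Phi)$ that is $\Phi$-compatible for some $\Phi\subseteq\mathcal{E}$. $\Pi_1,\Pi_2$ are uniformly CWV-equivalent iff for every $D\subseteq\mathcal{A}$, $\Pi_1\cup D$ and $\Pi_2\cup D$ have the same set of CWVs. *)

theory Defs
  imports Complex_Main "HOL-Computational_Algebra.Polynomial"
begin

section \<open>Logic programs with nested default negation\<close>

text \<open>Body elements are atoms, \<open>\<top>\<close>, and arbitrarily nested default negations of these: the
  epistemic reduct below produces \<open>\<not>\<top>\<close> and up to three nested negations.\<close>

datatype 'a nexp = NTop | NAtom 'a | NNeg "'a nexp"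

datatype 'a lp_rule = LPRule (lp_head: "'a list") (lp_body: "'a nexp list")

fun nsat :: "'a set \<Rightarrow> 'a nexp \<Rightarrow> bool" where
  "nsat M NTop \<longleftrightarrow> True"
| "nsat M (NAtom a) \<longleftrightarrow> a \<in> M"
| "nsat M (NNeg e) \<longleftrightarrow> \<not> nsat M e"

definition lp_model :: "'a set \<Rightarrow> 'a lp_rule set \<Rightarrow> bool" where
  "lp_model M P \<longleftrightarrow>
    (\<forall>r \<in> P. (\<forall>e \<in> set (lp_body r). nsat M e) \<longrightarrow> (\<exists>a \<in> set (lp_head r). a \<in> M))"

fun is_neg :: "'a nexp \<Rightarrow> bool" where
  "is_neg (NNeg e) = True"
| "is_neg _ = False"

definition gl_reduct :: "'a lp_rule set \<Rightarrow> 'a set \<Rightarrow> 'a lp_rule set" where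
  "gl_reduct P M =
    {LPRule (lp_head r) (filter (\<lambda>e. \<not> is_neg e) (lp_body r)) | r.
       r \<in> P \<and> (\<forall>e \<in> set (lp_body r). is_neg e \<longrightarrow> nsat M e)}"

definition answer_sets :: "'a set \<Rightarrow> 'a lp_rule set \<Rightarrow> 'a set set" where
  "answer_sets A P =
    {M. M \<subseteq> A \<and> lp_model M P \<and> (\<forall>N. N \<subset> M \<longrightarrow> \<not> lp_model N (gl_reduct P M))}"


section \<open>Epistemic logic programs\<close>

datatype 'a literal = Pos 'a | Neg 'a

datatype 'a elit = ENot "'a literal"

text \<open>\<open>ERule as ls xs ys\<close> is the rule whose head is the disjunction of \<open>as\<close> and whose body
  consists of the literals \<open>ls\<close>, the epistemic literals \<open>xs\<close> and the default negations of the
  epistemic literals \<open>ys\<close>. An empty head gives a constraint.\<close>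

datatype 'a elp_rule =
  ERule (e_head: "'a list") (e_lits: "'a literal list")
        (e_pos: "'a elit list") (e_neg: "'a elit list")

type_synonym 'a elp = "'a set \<times> 'a elit set \<times> 'a elp_rule set"

fun lit_atom :: "'a literal \<Rightarrow> 'a" where
  "lit_atom (Pos a) = a"
| "lit_atom (Neg a) = a"

fun elit_lit :: "'a elit \<Rightarrow> 'a literal" where
  "elit_lit (ENot l) = l"

fun is_elp :: "'a elp \<Rightarrow> bool" where
  "is_elp (A, E, R) \<longleftrightarrow>
    finite A \<and> finite R \<and>
    (\<forall>x \<in> E. lit_atom (elit_lit x) \<in> A) \<and>
    (\<forall>r \<in> R. set (e_head r) \<subseteq> A \<and> lit_atom ` set (e_lits r) \<subseteq> A \<and>
             set (e_pos r) \<subseteq> E \<and> set (e_neg r) \<subseteq> E)"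

fun add_facts :: "'a elp \<Rightarrow> 'a set \<Rightarrow> 'a elp" where
  "add_facts (A, E, R) D = (A, E, R \<union> (\<lambda>a. ERule [a] [] [] []) ` D)"

fun lit_nexp :: "'a literal \<Rightarrow> 'a nexp" where
  "lit_nexp (Pos a) = NAtom a"
| "lit_nexp (Neg a) = NNeg (NAtom a)"

definition elit_reduct :: "'a elit set \<Rightarrow> 'a elit \<Rightarrow> 'a nexp" where
  "elit_reduct \<Phi> x = (if x \<in> \<Phi> then NTop else NNeg (lit_nexp (elit_lit x)))"

definition rule_reduct :: "'a elit set \<Rightarrow> 'a elp_rule \<Rightarrow> 'a lp_rule" where
  "rule_reduct \<Phi> r =
    LPRule (e_head r)
      (map lit_nexp (e_lits r) @ map (elit_reduct \<Phi>) (e_pos r) @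
       map (\<lambda>x. NNeg (elit_reduct \<Phi> x)) (e_neg r))"

definition epistemic_reduct :: "'a elp_rule set \<Rightarrow> 'a elit set \<Rightarrow> 'a lp_rule set" where
  "epistemic_reduct R \<Phi> = rule_reduct \<Phi> ` R"

definition lit_sat :: "'a set \<Rightarrow> 'a literal \<Rightarrow> bool" where
  "lit_sat I l \<longleftrightarrow> nsat I (lit_nexp l)"

definition compatible :: "'a elit set \<Rightarrow> 'a elit set \<Rightarrow> 'a set set \<Rightarrow> bool" where
  "compatible E \<Phi> \<I> \<longleftrightarrow>
    \<I> \<noteq> {} \<and>
    (\<forall>l. ENot l \<in> \<Phi> \<longrightarrow> (\<exists>I \<in> \<I>. \<not> lit_sat I l)) \<and>
    (\<forall>l. ENot l \<in> E - \<Phi> \<longrightarrow> (\<forall>I \<in> \<I>. lit_sat I l))"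

fun cwvs :: "'a elp \<Rightarrow> 'a set set set" where
  "cwvs (A, E, R) =
    {\<M>. \<exists>\<Phi>. \<Phi> \<subseteq> E \<and> \<M> = answer_sets A (epistemic_reduct R \<Phi>) \<and> compatible E \<Phi> \<M>}"

definition uniformly_cwv_equivalent :: "'a elp \<Rightarrow> 'a elp \<Rightarrow> bool" where
  "uniformly_cwv_equivalent \<Pi>\<^sub>1 \<Pi>\<^sub>2 \<longleftrightarrow>
    (\<forall>D. D \<subseteq> fst \<Pi>\<^sub>1 \<longrightarrow> cwvs (add_facts \<Pi>\<^sub>1 D) = cwvs (add_facts \<Pi>\<^sub>2 D))"


section \<open>Turing machines and polynomial time\<close>

text \<open>Deterministic multi-tape machines with two-way infinite tapes. States are
  \<open>0, \<dots>, tm_states M - 1\<close>, tape symbols are \<open>0, \<dots>, tm_syms M - 1\<close>; symbol 0 is the blank,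
  symbols 1 and 2 represent the bits. State 0 is initial, state 1 is the halting state. The
  first tape carries the input, the last tape the output.\<close>

datatype move = MLeft | MStay | MRight

record tm =
  tm_tapes :: nat
  tm_syms :: nat
  tm_states :: nat
  tm_trans :: "nat \<Rightarrow> nat list \<Rightarrow> nat \<times> (nat \<times> move) list"

definition tm_wf :: "tm \<Rightarrow> bool" where
  "tm_wf M \<longleftrightarrow>
    1 \<le> tm_tapes M \<and> 3 \<le> tm_syms M \<and> 2 \<le> tm_states M \<and>
    (\<forall>q ss. q < tm_states M \<and> length ss = tm_tapes M \<and> (\<forall>s \<in> set ss. s < tm_syms M) \<longrightarrow>
       fst (tm_trans M q ss) < tm_states M \<and>
       length (snd (tm_trans M q ss)) = tm_tapes M \<and>
       (\<forall>(s, m) \<in> set (snd (tm_trans M q ss)). s < tm_syms M))"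

type_synonym tape = "(int \<Rightarrow> nat) \<times> int"
type_synonym tm_config = "nat \<times> tape list"

fun tape_read :: "tape \<Rightarrow> nat" where
  "tape_read (c, h) = c h"

fun move_offset :: "move \<Rightarrow> int" where
  "move_offset MLeft = -1"
| "move_offset MStay = 0"
| "move_offset MRight = 1"

fun tape_act :: "nat \<times> move \<Rightarrow> tape \<Rightarrow> tape" where
  "tape_act (s, m) (c, h) = (c(h := s), h + move_offset m)"

fun tm_step :: "tm \<Rightarrow> tm_config \<Rightarrow> tm_config" where
  "tm_step M (q, ts) =
    (if q = 1 then (q, ts)
     else (case tm_trans M q (map tape_read ts) of
             (q', acts) \<Rightarrow> (q', map2 tape_act acts ts)))"

definition bit_sym :: "bool \<Rightarrow> nat" where
  "bit_sym b = (if b then 2 else 1)"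

definition blank_tape :: tape where
  "blank_tape = (\<lambda>_. 0, 0)"

definition input_tape :: "bool list \<Rightarrow> tape" where
  "input_tape x =
    (\<lambda>i. if 0 \<le> i \<and> i < int (length x) then bit_sym (x ! nat i) else 0, 0)"

definition tm_init :: "tm \<Rightarrow> bool list \<Rightarrow> tm_config" where
  "tm_init M x = (0, input_tape x # replicate (tm_tapes M - 1) blank_tape)"

definition tape_output :: "tape \<Rightarrow> bool list \<Rightarrow> bool" where
  "tape_output t y \<longleftrightarrow>
    (\<forall>i < length y. fst t (int i) = bit_sym (y ! i)) \<and> fst t (int (length y)) = 0"

definition tm_computes_in_time ::
    "tm \<Rightarrow> (bool list \<Rightarrow> bool list) \<Rightarrow> (nat \<Rightarrow> nat) \<Rightarrow> bool" where
  "tm_computes_in_time M f T \<longleftrightarrow>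
    (\<forall>x. \<exists>t \<le> T (length x). \<exists>ts.
       (tm_step M ^^ t) (tm_init M x) = (1, ts) \<and> tape_output (last ts) (f x))"

definition poly_time_computable :: "(bool list \<Rightarrow> bool list) \<Rightarrow> bool" where
  "poly_time_computable f \<longleftrightarrow>
    (\<exists>M (p :: nat poly). tm_wf M \<and> tm_computes_in_time M f (poly p))"


section \<open>The polynomial hierarchy\<close>

type_synonym language = "bool list set"

definition class_P :: "language set" where
  "class_P = {L. poly_time_computable (\<lambda>x. [x \<in> L])}"

text \<open>Self-delimiting code of a list: every element is preceded by \<open>True\<close>, the end is marked
  by \<open>False\<close>.\<close>

definition enc_list :: "('a \<Rightarrow> bool list) \<Rightarrow> 'a list \<Rightarrow> bool list" where
  "enc_list e xs = concat (map (\<lambda>x. True # e x) xs) @ [False]"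

definition enc_word :: "bool list \<Rightarrow> bool list" where
  "enc_word = enc_list (\<lambda>b. [b])"

definition enc_pair :: "bool list \<Rightarrow> bool list \<Rightarrow> bool list" where
  "enc_pair x y = enc_word x @ y"

definition co_class :: "language set \<Rightarrow> language set" where
  "co_class C = {L. - L \<in> C}"

text \<open>The certificate definition of the hierarchy: \<open>\<Sigma>\<^sub>0\<^sup>P = P\<close>, and \<open>\<Sigma>\<^sub>k\<^sub>+\<^sub>1\<^sup>P\<close> arises from \<open>\<Pi>\<^sub>k\<^sup>P\<close> by
  an existential quantifier over words whose length is a polynomial in the input length.\<close>

fun Sigma_P :: "nat \<Rightarrow> language set" where
  "Sigma_P 0 = class_P"
| "Sigma_P (Suc k) =
    {L. \<exists>L' \<in> co_class (Sigma_P k). \<exists>q :: nat poly. \<forall>x.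
       x \<in> L \<longleftrightarrow> (\<exists>y. length y = poly q (length x) \<and> enc_pair x y \<in> L')}"

definition Pi_P :: "nat \<Rightarrow> language set" where
  "Pi_P k = co_class (Sigma_P k)"

definition poly_reducible :: "language \<Rightarrow> language \<Rightarrow> bool" where
  "poly_reducible L L' \<longleftrightarrow>
    (\<exists>f. poly_time_computable f \<and> (\<forall>x. x \<in> L \<longleftrightarrow> f x \<in> L'))"

definition complete_for :: "language set \<Rightarrow> language \<Rightarrow> bool" where
  "complete_for C L \<longleftrightarrow> L \<in> C \<and> (\<forall>L' \<in> C. poly_reducible L' L)"


section \<open>Uniform CWV-equivalence as a language\<close>

text \<open>Atom names in problem instances are arbitrary binary words; finite sets are presented as
  lists of their elements, in any order.\<close>

type_synonym atom = "bool list"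

fun enc_lit :: "atom literal \<Rightarrow> bool list" where
  "enc_lit (Pos a) = True # enc_word a"
| "enc_lit (Neg a) = False # enc_word a"

fun enc_elit :: "atom elit \<Rightarrow> bool list" where
  "enc_elit (ENot l) = enc_lit l"

fun enc_rule :: "atom elp_rule \<Rightarrow> bool list" where
  "enc_rule (ERule as ls xs ys) =
    enc_list enc_word as @ enc_list enc_lit ls @ enc_list enc_elit xs @ enc_list enc_elit ys"

definition enc_instance ::
    "atom list \<Rightarrow> atom elit list \<Rightarrow> atom elp_rule list \<Rightarrow> atom elp_rule list \<Rightarrow> bool list" where
  "enc_instance A E R\<^sub>1 R\<^sub>2 =
    enc_list enc_word A @ enc_list enc_elit E @ enc_list enc_rule R\<^sub>1 @ enc_list enc_rule R\<^sub>2"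

definition UNIFORM_CWV_EQUIVALENCE :: language where
  "UNIFORM_CWV_EQUIVALENCE =
    {enc_instance A E R\<^sub>1 R\<^sub>2 | A E R\<^sub>1 R\<^sub>2.
       is_elp (set A, set E, set R\<^sub>1) \<and> is_elp (set A, set E, set R\<^sub>2) \<and>
       uniformly_cwv_equivalent (set A, set E, set R\<^sub>1) (set A, set E, set R\<^sub>2)}"

text \<open>The encoding is unambiguous, so a word is in the language iff the unique instance it
  encodes is a positive one.\<close>

definition prefix_code :: "('a \<Rightarrow> bool list) \<Rightarrow> bool" where
  "prefix_code e \<longleftrightarrow> (\<forall>x y u v. e x @ u = e y @ v \<longrightarrow> x = y \<and> u = v)"

lemma prefix_codeD: "prefix_code e \<Longrightarrow> e x @ u = e y @ v \<longleftrightarrow> x = y \<and> u = v"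
  unfolding prefix_code_def by blast

lemma prefix_code_enc_list:
  assumes "prefix_code e"
  shows "prefix_code (enc_list e)"
proof -
  have "enc_list e xs @ u = enc_list e ys @ v \<Longrightarrow> xs = ys \<and> u = v" for xs ys u v
  proof (induction xs arbitrary: ys)
    case Nil
    then show ?case by (cases ys) (auto simp: enc_list_def)
  next
    case (Cons x xs)
    then obtain y ys' where "ys = y # ys'" by (cases ys) (auto simp: enc_list_def)
    with Cons show ?case by (auto simp: enc_list_def prefix_codeD[OF assms])
  qed
  then show ?thesis unfolding prefix_code_def by blast
qed

lemma prefix_code_enc_word: "prefix_code enc_word"
  unfolding enc_word_def by (rule prefix_code_enc_list) (simp add: prefix_code_def)

lemma prefix_code_enc_lit: "prefix_code enc_lit"
  unfolding prefix_code_def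
proof (intro allI impI)
  fix x y u v assume "enc_lit x @ u = enc_lit y @ v"
  then show "x = y \<and> u = v"
    by (cases x; cases y) (auto simp: prefix_codeD[OF prefix_code_enc_word])
qed

lemma prefix_code_enc_elit: "prefix_code enc_elit"
  unfolding prefix_code_def
proof (intro allI impI)
  fix x y u v assume "enc_elit x @ u = enc_elit y @ v"
  then show "x = y \<and> u = v"
    by (cases x; cases y) (auto simp: prefix_codeD[OF prefix_code_enc_lit])
qed

lemmas prefix_code_lists =
  prefix_codeD[OF prefix_code_enc_list[OF prefix_code_enc_word]]
  prefix_codeD[OF prefix_code_enc_list[OF prefix_code_enc_lit]]
  prefix_codeD[OF prefix_code_enc_list[OF prefix_code_enc_elit]]

lemma prefix_code_enc_rule: "prefix_code enc_rule"
  unfolding prefix_code_def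
proof (intro allI impI)
  fix x y u v assume "enc_rule x @ u = enc_rule y @ v"
  then show "x = y \<and> u = v"
    by (cases x; cases y) (auto simp: prefix_code_lists)
qed

lemma enc_instance_inject:
  "enc_instance A E R\<^sub>1 R\<^sub>2 = enc_instance A' E' R\<^sub>1' R\<^sub>2' \<longleftrightarrow>
    A = A' \<and> E = E' \<and> R\<^sub>1 = R\<^sub>1' \<and> R\<^sub>2 = R\<^sub>2'"
  using prefix_codeD[OF prefix_code_enc_list[OF prefix_code_enc_rule], of R\<^sub>2 "[]" R\<^sub>2' "[]"]
  by (auto simp: enc_instance_def prefix_code_lists
      prefix_codeD[OF prefix_code_enc_list[OF prefix_code_enc_rule]])

end

theory Submission
  imports Defs
begin

text \<open>Membership: a set of interpretations is compatible with at most one guess, so the candidate world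
  views of \<open>\<Pi>\<^sub>1 \<union> D\<close> and \<open>\<Pi>\<^sub>2 \<union> D\<close> differ iff for some \<open>\<Phi>\<close> the answer sets of the two epistemic
  reducts differ and one of the two collections is \<open>\<Phi>\<close>-compatible. Finitely many answer sets witness the
  existential part of this; checking that they are answer sets is universal, and checking the universal
  part of compatibility is a universal quantifier followed by an existential one.

  Hardness: let \<open>x \<in> L\<close> iff for all \<open>y\<^sub>1\<close> there is \<open>y\<^sub>2\<close> such that all \<open>y\<^sub>3\<close> are accepted by a polynomial-time
  machine. Its run is described by Horn rules deriving an atom \<open>w\<close> iff the machine accepts. Disjunctions
  guess \<open>y\<^sub>2\<close> and \<open>y\<^sub>3\<close>, and \<open>w\<close> saturates everything but \<open>y\<^sub>2\<close>, so that \<open>w\<close> belongs to some answer set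
  iff some \<open>y\<^sub>2\<close> works for all \<open>y\<^sub>3\<close>. The facts \<open>D\<close> supply \<open>y\<^sub>1\<close>. The second program additionally derives
  \<open>q\<close> from \<open>\<not> not \<not> w\<close>, which has an effect only if no answer set contains \<open>w\<close>. Sets \<open>D\<close> that interfere
  with the guess of \<open>y\<^sub>2\<close> are neutralised by the rules \<open>q \<leftarrow> \<not> not b\<close> for the guessed literals \<open>b\<close>,
  which fire in both programs; all other atoms in \<open>D\<close> only help to derive \<open>w\<close>.

  Polynomial time: programs over finitely many stacks compile step by step to multi-tape machines, and the
  functions they compute on coded data are closed under pairing, case distinction and bounded iteration.\<close>

section \<open>Stack programs and their compilation to Turing machines\<close>

text \<open>Compatibility drives both uses of \<open>q\<close>. If some answer set contains
  \<open>w\<close>, then \<open>not \<not>w\<close> must belong to \<Phi>, so the body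
  \<open>\<not> not \<not>w\<close> reduces to \<open>\<not>\<top>\<close> and the extra rule is
  dead. If \<open>D\<close> contains a choice literal \<open>b\<close>, then so does every answer
  set, \<open>not b\<close> is outside \<Phi>, and the reduct contains
  \<open>q \<leftarrow> \<not>\<not>b\<close>, which fires. Conversely, if every
  \<open>y\<^sub>2\<close> is rejected for some \<open>y\<^sub>1\<close>, then every
  \<open>y\<^sub>2\<close> yields an answer set without \<open>w\<close>; no choice literal is then
  constant, so the guess of all \<open>not b\<close> is compatible for the first program, while the
  second wants \<open>q\<close>. Default negation of input bits is confined to
  \<open>y\<^sub>1\<close>, whose bits \<open>D\<close> can only supply as positive facts. Bits of
  \<open>y\<^sub>3\<close> need an atom for the complement as well: saturation makes both atoms
  true, whereas a negated atom would be evaluated in the saturated set once and for all. The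
  hierarchy is defined by machines. A reduction must therefore start from an arbitrary machine, and
  the generator of instances must itself be shown to be a machine; this is what the stack language
  is for.\<close>

type_synonym store = "nat \<Rightarrow> bool list"

text \<open>\<open>Put\<close> overwrites the top cell of a stack. It only occurs as the second half of the execution
  of \<open>Push\<close> on a tape and has no store semantics.\<close>

datatype com =
    Skip
  | Push nat bool
  | Put nat bool
  | Pop nat
  | Seq com com
  | Case nat com com com
  | While nat com

fun pick :: "bool list \<Rightarrow> 'c \<Rightarrow> 'c \<Rightarrow> 'c \<Rightarrow> 'c" where
  "pick [] e f t = e"
| "pick (b # w) e f t = (if b then t else f)"

text \<open>The cost is the exact number of steps of the compiled machine. \<open>Push\<close> costs
  2 because moving to the new cell and writing it are separate steps.\<close>

inductive exec :: "com \<Rightarrow> store \<Rightarrow> nat \<Rightarrow> store \<Rightarrow> bool" where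
  exec_Skip: "exec Skip s 1 s"
| exec_Push: "exec (Push v b) s 2 (s(v := b # s v))"
| exec_Pop: "exec (Pop v) s 1 (s(v := tl (s v)))"
| exec_Seq: "exec c s t s' \<Longrightarrow> exec d s' u s'' \<Longrightarrow> exec (Seq c d) s (Suc (t + u)) s''"
| exec_Case: "exec (pick (s v) c d e) s t s' \<Longrightarrow> exec (Case v c d e) s (Suc t) s'"
| exec_While_stop: "s v = [] \<Longrightarrow> exec (While v c) s 1 s"
| exec_While_step: "s v \<noteq> [] \<Longrightarrow> exec c s t s' \<Longrightarrow> exec (While v c) s' u s'' \<Longrightarrow>
    exec (While v c) s (Suc (t + u)) s''"

lemma exec_length:
  "exec c s t s' \<Longrightarrow> length (s' v) \<le> length (s v) + t"
  by (induction rule: exec.induct) auto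

primrec com_vars :: "com \<Rightarrow> nat set" where
  "com_vars Skip = {}"
| "com_vars (Push v b) = {v}"
| "com_vars (Put v b) = {v}"
| "com_vars (Pop v) = {v}"
| "com_vars (Seq c d) = com_vars c \<union> com_vars d"
| "com_vars (Case v c d e) = insert v (com_vars c \<union> com_vars d \<union> com_vars e)"
| "com_vars (While v c) = insert v (com_vars c)"

lemma finite_com_vars: "finite (com_vars c)"
  by (induction c) auto

text \<open>The control states are continuations, that is, lists of commands still to be executed;
  \<open>None\<close> is the halting state. The empty continuation copies stack 0 to the output tape \<open>k\<close>.\<close>

definition stay :: "nat list \<Rightarrow> (nat \<times> move) list" where
  "stay ss = map (\<lambda>s. (s, MStay)) ss"

fun ctrl :: "nat \<Rightarrow> com list \<Rightarrow> nat list \<Rightarrow> com list option \<times> (nat \<times> move) list" where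
  "ctrl k [] ss =
    (if ss ! 0 = 0 then (None, stay ss)
     else (Some [], (stay ss)[0 := (0, MRight), k := (ss ! 0, MRight)]))"
| "ctrl k (Skip # K) ss = (Some K, stay ss)"
| "ctrl k (Push v b # K) ss = (Some (Put v b # K), (stay ss)[v := (ss ! v, MLeft)])"
| "ctrl k (Put v b # K) ss = (Some K, (stay ss)[v := (bit_sym b, MStay)])"
| "ctrl k (Pop v # K) ss = (Some K, if ss ! v = 0 then stay ss else (stay ss)[v := (0, MRight)])"
| "ctrl k (Seq c d # K) ss = (Some (c # d # K), stay ss)"
| "ctrl k (Case v c d e # K) ss =
    (Some ((if ss ! v = 0 then c else if ss ! v = 1 then d else e) # K), stay ss)"
| "ctrl k (While v c # K) ss = (Some (if ss ! v = 0 then K else c # While v c # K), stay ss)"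

fun astep :: "nat \<Rightarrow> com list option \<times> tape list \<Rightarrow> com list option \<times> tape list" where
  "astep k (None, ts) = (None, ts)"
| "astep k (Some L, ts) =
    (case ctrl k L (map tape_read ts) of (L', acts) \<Rightarrow> (L', map2 tape_act acts ts))"

text \<open>The continuations that can arise while \<open>c\<close> runs in front of
  \<open>K\<close>. A loop body runs in front of the loop itself, so iterating never lengthens the
  continuation; this keeps the set finite and the compiled machine finite-state.\<close>

primrec conts :: "com \<Rightarrow> com list \<Rightarrow> com list set" where
  "conts Skip K = {Skip # K}"
| "conts (Push v b) K = {Push v b # K, Put v b # K}"
| "conts (Put v b) K = {Put v b # K}"
| "conts (Pop v) K = {Pop v # K}"
| "conts (Seq c d) K = insert (Seq c d # K) (conts c (d # K) \<union> conts d K)"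
| "conts (Case v c d e) K = insert (Case v c d e # K) (conts c K \<union> conts d K \<union> conts e K)"
| "conts (While v c) K = insert (While v c # K) (conts c (While v c # K))"

lemma finite_conts: "finite (conts c K)"
  by (induction c arbitrary: K) auto

lemma conts_head: "c # K \<in> conts c K"
  by (cases c) auto

lemma ctrl_conts:
  "L \<in> conts c K \<Longrightarrow> fst (ctrl k L ss) \<in> Some ` (insert K (conts c K))"
proof (induction c arbitrary: K)
  case (Seq c d)
  then show ?case
    using Seq.IH(1)[of "d # K"] Seq.IH(2)[of K] conts_head[of d K] conts_head[of c "d # K"]
    by (auto simp: image_iff)
next
  case (Case v c d e)
  then show ?case
    using Case.IH[of K] conts_head[of c K] conts_head[of d K] conts_head[of e K]
    by (cases "ss ! v = 0"; cases "ss ! v = 1") (auto simp: image_iff)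
next
  case (While v c)
  then show ?case
    using While.IH[of "While v c # K"] conts_head[of c "While v c # K"]
    by (cases "ss ! v = 0") (auto simp: image_iff)
qed auto

lemma length_stay [simp]: "length (stay ss) = length ss"
  by (simp add: stay_def)

lemma ctrl_wf:
  assumes "length ss = Suc k" "\<forall>s \<in> set ss. s < m" "3 \<le> m"
  shows "length (snd (ctrl k L ss)) = Suc k"
    and "\<forall>(s, d) \<in> set (snd (ctrl k L ss)). s < m"
proof -
  have lt: "ss ! v < m" if "v < Suc k" for v using assms that by auto
  define ok where "ok xs \<longleftrightarrow> (\<forall>(s, d) \<in> set xs. s < m)" for xs :: "(nat \<times> move) list"
  have upd: "ok (xs[v := (a, d')])" if "ok xs" "v < length xs \<Longrightarrow> a < m" for xs v a d'
  proof (cases "v < length xs")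
    case True
    then show ?thesis using that set_update_subset_insert[of xs v "(a, d')"] by (auto simp: ok_def)
  next
    case False
    then show ?thesis using that by (simp add: list_update_beyond)
  qed
  have st: "ok (stay ss)" using assms by (auto simp: stay_def ok_def)
  show "length (snd (ctrl k L ss)) = Suc k"
    using assms by (cases "(k, L, ss)" rule: ctrl.cases) auto
  have "bit_sym b < m" for b using assms by (simp add: bit_sym_def)
  then have "ok (snd (ctrl k L ss))"
    using assms st lt by (cases "(k, L, ss)" rule: ctrl.cases) (auto intro!: upd)
  then show "\<forall>(s, d) \<in> set (snd (ctrl k L ss)). s < m" by (simp add: ok_def)
qed

text \<open>The head stands on the top of the stack, which extends to the right and is followed by
  blanks. Nothing is said about cells left of the head, so a push may find anything there.\<close>

definition stack_tape :: "tape \<Rightarrow> bool list \<Rightarrow> bool" where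
  "stack_tape tp w \<longleftrightarrow>
    (\<forall>i. fst tp (snd tp + int i) = (if i < length w then bit_sym (w ! i) else 0))"

lemma stack_tape_read:
  assumes "stack_tape tp w"
  shows "tape_read tp = pick w 0 1 2"
proof -
  have "fst tp (snd tp + int 0) = (if 0 < length w then bit_sym (w ! 0) else 0)"
    using assms unfolding stack_tape_def by blast
  then show ?thesis by (cases tp; cases w) (auto simp: bit_sym_def)
qed

lemma stack_tape_pop:
  assumes "stack_tape tp (b # w)"
  shows "stack_tape (tape_act (0, MRight) tp) w"
  unfolding stack_tape_def
proof
  fix i
  obtain c h where tp: "tp = (c, h)" by (cases tp)
  have "fst tp (snd tp + int (Suc i)) = (if Suc i < length (b # w) then bit_sym ((b # w) ! Suc i) else 0)"
    using assms unfolding stack_tape_def by blast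
  moreover have "h + (1 + int i) \<noteq> h" by simp
  ultimately show "fst (tape_act (0, MRight) tp) (snd (tape_act (0, MRight) tp) + int i) =
      (if i < length w then bit_sym (w ! i) else 0)"
    by (simp add: tp algebra_simps)
qed

lemma stack_tape_push:
  assumes "stack_tape tp w"
  shows "stack_tape (tape_act (bit_sym b, MStay) (tape_act (tape_read tp, MLeft) tp)) (b # w)"
  unfolding stack_tape_def
proof
  fix i
  obtain c h where tp: "tp = (c, h)" by (cases tp)
  let ?t = "tape_act (bit_sym b, MStay) (tape_act (tape_read tp, MLeft) tp)"
  show "fst ?t (snd ?t + int i) = (if i < length (b # w) then bit_sym ((b # w) ! i) else 0)"
  proof (cases i)
    case 0
    then show ?thesis by (simp add: tp)
  next
    case (Suc j)
    have "c (h + int j) = (if j < length w then bit_sym (w ! j) else 0)"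
      using assms by (simp add: stack_tape_def tp)
    then show ?thesis using Suc by (simp add: tp)
  qed
qed

lemma map2_stay:
  assumes "length ss = length ts" "ss = map tape_read ts"
  shows "map2 tape_act (stay ss) ts = ts"
proof (rule nth_equalityI)
  fix i assume i: "i < length (map2 tape_act (stay ss) ts)"
  obtain c h where "ts ! i = (c, h)" by (cases "ts ! i")
  then show "map2 tape_act (stay ss) ts ! i = ts ! i" using i assms by (simp add: stay_def)
qed (use assms in simp)

lemma map2_update:
  "length as = length ts \<Longrightarrow> map2 f (as[v := a]) ts = (map2 f as ts)[v := f a (ts ! v)]"
  by (cases "v < length ts") (auto intro!: nth_equalityI simp: nth_list_update list_update_beyond)

lemmas map2_tape = map2_stay map2_update

lemma funpow_add_eq: "(f ^^ m) x = y \<Longrightarrow> (f ^^ n) y = z \<Longrightarrow> (f ^^ (m + n)) x = z"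
  by (subst add.commute) (simp add: funpow_add)

lemma funpow_Suc_eq: "f x = y \<Longrightarrow> (f ^^ n) y = z \<Longrightarrow> (f ^^ Suc n) x = z"
  by (simp add: funpow_swap1)

text \<open>Stack \<open>v\<close> lives on tape \<open>v\<close>. As the program only mentions
  stacks below \<open>k\<close>, the output tape \<open>k\<close> is still blank when copying
  starts.\<close>

lemma exec_astep:
  assumes "exec c s t s'" "com_vars c \<subseteq> {..<k}" "length ts = Suc k"
    "\<forall>v<k. stack_tape (ts ! v) (s v)"
  shows "\<exists>ts'. (astep k ^^ t) (Some (c # K), ts) = (Some K, ts') \<and> length ts' = Suc k \<and>
    (\<forall>v<k. stack_tape (ts' ! v) (s' v)) \<and> ts' ! k = ts ! k"
  using assms
proof (induction arbitrary: K ts rule: exec.induct)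
  case (exec_Skip s)
  then show ?case by (auto simp: map2_tape)
next
  case (exec_Push v b s)
  then have v: "v < k" by simp
  let ?ts1 = "ts[v := tape_act (tape_read (ts ! v), MLeft) (ts ! v)]"
  let ?ts2 = "?ts1[v := tape_act (bit_sym b, MStay) (?ts1 ! v)]"
  have "astep k (Some (Push v b # K), ts) = (Some (Put v b # K), ?ts1)"
    using exec_Push.prems v by (simp add: map2_tape)
  moreover have "astep k (Some (Put v b # K), ?ts1) = (Some K, ?ts2)"
    using exec_Push.prems v by (simp add: map2_tape)
  ultimately have "(astep k ^^ 2) (Some (Push v b # K), ts) = (Some K, ?ts2)"
    by (simp add: numeral_2_eq_2)
  moreover have "stack_tape (?ts2 ! v) (b # s v)"
    using exec_Push.prems v by (simp add: stack_tape_push)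
  ultimately show ?case using exec_Push.prems v by (intro exI[of _ ?ts2]) auto
next
  case (exec_Pop v s)
  then have v: "v < k" by simp
  then have rd: "tape_read (ts ! v) = pick (s v) 0 1 2" using exec_Pop.prems stack_tape_read by blast
  show ?case
  proof (cases "s v")
    case Nil
    then show ?thesis using exec_Pop.prems v rd by (auto simp: map2_tape)
  next
    case (Cons b w)
    then have "stack_tape (tape_act (0, MRight) (ts ! v)) w"
      using exec_Pop.prems v by (metis stack_tape_pop)
    moreover have "astep k (Some (Pop v # K), ts) = (Some K, ts[v := tape_act (0, MRight) (ts ! v)])"
      using exec_Pop.prems v rd Cons by (simp add: map2_tape)
    ultimately show ?thesis using exec_Pop.prems v Cons by (auto simp: nth_list_update)
  qed
next
  case (exec_Seq c s t s' d u s'')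
  obtain ts1 where 1: "(astep k ^^ t) (Some (c # d # K), ts) = (Some (d # K), ts1)"
      "length ts1 = Suc k" "\<forall>v<k. stack_tape (ts1 ! v) (s' v)" "ts1 ! k = ts ! k"
    using exec_Seq.IH(1)[of ts "d # K"] exec_Seq.prems by auto
  obtain ts2 where 2: "(astep k ^^ u) (Some (d # K), ts1) = (Some K, ts2)"
      "length ts2 = Suc k" "\<forall>v<k. stack_tape (ts2 ! v) (s'' v)" "ts2 ! k = ts1 ! k"
    using exec_Seq.IH(2)[of ts1 K] exec_Seq.prems 1 by auto
  have "astep k (Some (Seq c d # K), ts) = (Some (c # d # K), ts)" by (simp add: map2_tape)
  from funpow_Suc_eq[of "astep k", OF this funpow_add_eq[OF 1(1) 2(1)]] 1 2 show ?case
    by auto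
next
  case (exec_Case s v c d e t s')
  then have v: "v < k" by simp
  then have rd: "tape_read (ts ! v) = pick (s v) 0 1 2" using exec_Case.prems stack_tape_read by blast
  have "com_vars (pick (s v) c d e) \<subseteq> {..<k}"
    using exec_Case.prems by (cases "s v") auto
  then obtain ts1 where 1: "(astep k ^^ t) (Some (pick (s v) c d e # K), ts) = (Some K, ts1)"
      "length ts1 = Suc k" "\<forall>v<k. stack_tape (ts1 ! v) (s' v)" "ts1 ! k = ts ! k"
    using exec_Case.IH[of ts K] exec_Case.prems by auto
  have "astep k (Some (Case v c d e # K), ts) = (Some (pick (s v) c d e # K), ts)"
    using exec_Case.prems v rd by (cases "s v") (auto simp: map2_tape)
  from funpow_Suc_eq[of "astep k", OF this 1(1)] 1 show ?case by auto
next
  case (exec_While_stop s v c)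
  then have v: "v < k" by simp
  then have "tape_read (ts ! v) = 0"
    using exec_While_stop stack_tape_read[of "ts ! v" "s v"] by (metis pick.simps(1))
  then show ?case using exec_While_stop v by (auto simp: map2_tape)
next
  case (exec_While_step s v c t s' u s'')
  then have v: "v < k" by simp
  have "tape_read (ts ! v) = pick (s v) 0 1 2" using exec_While_step.prems v stack_tape_read by blast
  then have rd: "tape_read (ts ! v) \<noteq> 0" using exec_While_step.hyps by (cases "s v") auto
  obtain ts1 where 1: "(astep k ^^ t) (Some (c # While v c # K), ts) = (Some (While v c # K), ts1)"
      "length ts1 = Suc k" "\<forall>v<k. stack_tape (ts1 ! v) (s' v)" "ts1 ! k = ts ! k"
    using exec_While_step.IH(1)[of ts "While v c # K"] exec_While_step.prems by auto
  obtain ts2 where 2: "(astep k ^^ u) (Some (While v c # K), ts1) = (Some K, ts2)"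
      "length ts2 = Suc k" "\<forall>v<k. stack_tape (ts2 ! v) (s'' v)" "ts2 ! k = ts1 ! k"
    using exec_While_step.IH(2)[of ts1 K] exec_While_step.prems 1 by auto
  have "astep k (Some (While v c # K), ts) = (Some (c # While v c # K), ts)"
    using exec_While_step.prems v rd by (simp add: map2_tape)
  from funpow_Suc_eq[of "astep k", OF this funpow_add_eq[OF 1(1) 2(1)]] 1 2 show ?case
    by auto
qed

text \<open>Allowing arbitrary contents \<open>f\<close> and an arbitrary head position
  \<open>i\<close> lets the induction absorb the part already copied.\<close>

lemma astep_output:
  assumes "length ts = Suc k" "0 < k" "stack_tape (ts ! 0) w" "ts ! k = (f, int i)"
  shows "\<exists>ts'. (astep k ^^ Suc (length w)) (Some [], ts) = (None, ts') \<and> length ts' = Suc k \<and>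
    fst (ts' ! k) = (\<lambda>j. if int i \<le> j \<and> j < int (i + length w)
      then bit_sym (w ! nat (j - int i)) else f j)"
  using assms
proof (induction w arbitrary: ts i f)
  case Nil
  then have "tape_read (ts ! 0) = 0" using stack_tape_read[of "ts ! 0" "[]"] by simp
  then show ?case using Nil by (auto simp: map2_tape fun_eq_iff)
next
  case (Cons b w)
  have rd: "tape_read (ts ! 0) = bit_sym b"
    using stack_tape_read[OF Cons.prems(3)] by (simp add: bit_sym_def)
  let ?ts1 = "ts[0 := tape_act (0, MRight) (ts ! 0), k := (f(int i := bit_sym b), int (Suc i))]"
  have step: "astep k (Some [], ts) = (Some [], ?ts1)"
    using Cons.prems rd by (simp add: map2_tape nth_list_update bit_sym_def add.commute)
  have "stack_tape (?ts1 ! 0) w" using Cons.prems stack_tape_pop by (simp add: nth_list_update)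
  moreover have "length ?ts1 = Suc k" "?ts1 ! k = (f(int i := bit_sym b), int (Suc i))"
    using Cons.prems by simp_all
  ultimately obtain ts' where ts': "(astep k ^^ Suc (length w)) (Some [], ?ts1) = (None, ts')"
      "length ts' = Suc k"
      "fst (ts' ! k) = (\<lambda>j. if int (Suc i) \<le> j \<and> j < int (Suc i + length w)
         then bit_sym (w ! nat (j - int (Suc i))) else (f(int i := bit_sym b)) j)"
    using Cons.IH[of ?ts1 "f(int i := bit_sym b)" "Suc i"] Cons.prems(2) by blast
  have "fst (ts' ! k) = (\<lambda>j. if int i \<le> j \<and> j < int (i + length (b # w))
      then bit_sym ((b # w) ! nat (j - int i)) else f j)"
    unfolding ts'(3) by (rule ext) (auto simp: nth_Cons' nat_diff_distrib' intro!: arg_cong[of _ _ "\<lambda>n. bit_sym (w ! n)"])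
  with funpow_Suc_eq[of "astep k", OF step ts'(1)] ts'(2) show ?case by auto
qed

text \<open>The machine model fixes the numbers 0 and 1 for the initial and the halting state, so a
  coding of the control states has to respect them.\<close>

lemma ex_state_coding:
  assumes "finite S" "a \<in> S" "b \<in> S" "a \<noteq> b"
  shows "\<exists>(code :: 'a \<Rightarrow> nat) N. inj_on code S \<and> code a = 0 \<and> code b = 1 \<and> code ` S \<subseteq> {..<N} \<and> 2 \<le> N"
proof -
  obtain g :: "'a \<Rightarrow> nat" where g: "inj_on g S"
    using finite_imp_inj_to_nat_seg[OF assms(1)] by blast
  define code where "code = (\<lambda>x. if x = a then 0 else if x = b then 1 else g x + 2)"
  have "inj_on code S"
    using g by (auto simp: inj_on_def code_def)
  moreover have "code ` S \<subseteq> {..<Suc (Max (code ` S))}"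
    using assms(1) by (auto simp: less_Suc_eq_le)
  moreover have "code b \<le> Max (code ` S)" using assms by (intro Max_ge) auto
  ultimately show ?thesis using assms(4)
    by (intro exI[of _ code] exI[of _ "Suc (Max (code ` S))"]) (auto simp: code_def)
qed

text \<open>Used for inputs and for outputs: a program has to leave all auxiliary stacks empty. This
  is what makes programs composable and callable on shifted stacks.\<close>

definition ini :: "bool list \<Rightarrow> store" where
  "ini x = (\<lambda>_. [])(0 := x)"

lemma exec_imp_tm:
  assumes "\<And>x. \<exists>t \<le> T (length x). exec c (ini x) t (ini (f x))"
  shows "\<exists>M. tm_wf M \<and> tm_computes_in_time M f (\<lambda>n. 2 * T n + n + 1)"
proof -
  define k where "k = Suc (Max (insert 0 (com_vars c)))"
  have k: "0 < k" "com_vars c \<subseteq> {..<k}"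
    by (auto simp: k_def less_Suc_eq_le finite_com_vars)
  define S where "S = insert None (Some ` insert [] (conts c []))"
  have "finite S" by (simp add: S_def finite_conts)
  moreover have "Some [c] \<in> S" "None \<in> S" using conts_head[of c "[]"] by (auto simp: S_def)
  ultimately obtain code :: "com list option \<Rightarrow> nat" and N where code: "inj_on code S"
      "code (Some [c]) = 0" "code None = 1" "code ` S \<subseteq> {..<N}" "2 \<le> N"
    using ex_state_coding[of S "Some [c]" None] by auto
  have closed: "fst (ctrl k L ss) \<in> S" if "Some L \<in> S" for L ss
    using that ctrl_conts[of L c "[]" k ss] by (auto simp: S_def split: if_splits)
  \<comment> \<open>Well-formedness concerns all numbers below \<open>N\<close>. Those that code no
    control state are decoded as the halting state.\<close>
  define dec where "dec q = (if q \<in> code ` S then inv_into S code q else None)" for q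
  have dec: "dec (code L) = L" if "L \<in> S" for L
    using that code(1) by (simp add: dec_def)
  have dec_S: "dec q \<in> S" for q
    using \<open>None \<in> S\<close> by (simp add: dec_def inv_into_into)
  define M where "M = \<lparr>tm_tapes = Suc k, tm_syms = 3, tm_states = N,
    tm_trans = (\<lambda>q ss. case dec q of None \<Rightarrow> (1, stay ss)
      | Some L \<Rightarrow> (code (fst (ctrl k L ss)), snd (ctrl k L ss)))\<rparr>"
  have "tm_wf M"
    unfolding tm_wf_def
  proof (intro conjI allI impI)
    fix q ss assume *: "q < tm_states M \<and> length ss = tm_tapes M \<and> (\<forall>s\<in>set ss. s < tm_syms M)"
    show "fst (tm_trans M q ss) < tm_states M"
    proof (cases "dec q")
      case None
      then show ?thesis using code by (simp add: M_def)
    next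
      case (Some L)
      then have "fst (ctrl k L ss) \<in> S" using dec_S[of q] closed by metis
      then show ?thesis using Some code(4) by (auto simp: M_def)
    qed
    show "length (snd (tm_trans M q ss)) = tm_tapes M"
      using * ctrl_wf(1)[of ss k 3] by (auto simp: M_def split: option.split)
    show "\<forall>(s, m)\<in>set (snd (tm_trans M q ss)). s < tm_syms M"
    proof (cases "dec q")
      case None
      then show ?thesis using * by (auto simp: M_def stay_def)
    next
      case (Some L)
      then show ?thesis using * ctrl_wf(2)[of ss k 3 L] by (simp add: M_def)
    qed
  qed (use code in \<open>auto simp: M_def\<close>)
  have step: "tm_step M (code L, ts) = map_prod code id (astep k (L, ts)) \<and> fst (astep k (L, ts)) \<in> S"
    if "L \<in> S" for L ts
  proof (cases L)
    case None
    then show ?thesis using that by (simp add: code)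
  next
    case (Some L')
    then have "code L \<noteq> 1" using that code \<open>None \<in> S\<close> by (metis inj_onD option.distinct(1))
    then show ?thesis using Some that dec[OF that] closed[of L']
      by (simp add: M_def split: prod.split) (metis fst_conv)
  qed
  have run: "(tm_step M ^^ t) (code L, ts) = map_prod code id ((astep k ^^ t) (L, ts)) \<and>
      fst ((astep k ^^ t) (L, ts)) \<in> S" if "L \<in> S" for t L ts
  proof (induction t)
    case (Suc t)
    obtain L1 ts1 where "(astep k ^^ t) (L, ts) = (L1, ts1)" by fastforce
    then show ?case using Suc step[of L1 ts1] by (simp add: id_def del: tm_step.simps)
  qed (use that in simp)
  have "tm_computes_in_time M f (\<lambda>n. 2 * T n + n + 1)"
    unfolding tm_computes_in_time_def
  proof
    fix x
    obtain t where t: "t \<le> T (length x)" "exec c (ini x) t (ini (f x))" using assms by blast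
    define ts0 where "ts0 = input_tape x # replicate k blank_tape"
    have "stack_tape (input_tape x) x" by (auto simp: stack_tape_def input_tape_def)
    moreover have "stack_tape blank_tape []" by (auto simp: stack_tape_def blank_tape_def)
    ultimately have "\<forall>v<k. stack_tape (ts0 ! v) (ini x v)"
      using k by (auto simp: ts0_def ini_def nth_Cons')
    then obtain ts1 where ts1: "(astep k ^^ t) (Some [c], ts0) = (Some [], ts1)" "length ts1 = Suc k"
        "\<forall>v<k. stack_tape (ts1 ! v) (ini (f x) v)" "ts1 ! k = ts0 ! k"
      using exec_astep[OF t(2) k(2), of ts0 "[]"] by (auto simp: ts0_def)
    have "ts1 ! k = (\<lambda>_. 0, int 0)" using ts1(4) k by (simp add: ts0_def nth_Cons' blank_tape_def)
    moreover have "stack_tape (ts1 ! 0) (f x)" using ts1(3) k by (auto simp: ini_def)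
    ultimately obtain ts2 where ts2: "(astep k ^^ Suc (length (f x))) (Some [], ts1) = (None, ts2)"
        "length ts2 = Suc k"
        "fst (ts2 ! k) = (\<lambda>j. if int 0 \<le> j \<and> j < int (0 + length (f x))
          then bit_sym (f x ! nat (j - int 0)) else 0)"
      using astep_output[OF ts1(2) k(1)] by blast
    have "(astep k ^^ (t + Suc (length (f x)))) (Some [c], ts0) = (None, ts2)"
      by (rule funpow_add_eq[OF ts1(1) ts2(1)])
    then have "(tm_step M ^^ (t + Suc (length (f x)))) (tm_init M x) = (1, ts2)"
      using run[OF \<open>Some [c] \<in> S\<close>, of "t + Suc (length (f x))" ts0] code
      by (simp add: tm_init_def M_def ts0_def del: funpow.simps)
    moreover have "last ts2 = ts2 ! k" using ts2(2) last_conv_nth[of ts2] by force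
    then have "tape_output (last ts2) (f x)"
      using ts2(3) by (simp add: tape_output_def)
    \<comment> \<open>The simulation is followed by \<open>Suc (length (f x))\<close> copying steps,
      and the output is at most as long as the input plus the running time.\<close>
    moreover have "t + Suc (length (f x)) \<le> 2 * T (length x) + length x + 1"
      using t(1) exec_length[OF t(2), of 0] by (simp add: ini_def)
    ultimately show "\<exists>t\<le>2 * T (length x) + length x + 1. \<exists>ts.
        (tm_step M ^^ t) (tm_init M x) = (1, ts) \<and> tape_output (last ts) (f x)"
      by blast
  qed
  with \<open>tm_wf M\<close> show ?thesis by blast
qed


section \<open>Polynomially bounded functions\<close>

text \<open>Domination by a polynomial instead of equality with one: running times can stay plain
  terms in \<open>n\<close>, and \<open>pb_intros\<close> disposes of them.\<close>

definition pb :: "(nat \<Rightarrow> nat) \<Rightarrow> bool" where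
  "pb g \<longleftrightarrow> (\<exists>p :: nat poly. \<forall>n. g n \<le> poly p n)"

lemma poly_nat_mono: "m \<le> n \<Longrightarrow> poly (p :: nat poly) m \<le> poly p n"
  by (induction p) (auto intro!: add_mono mult_mono)

lemma pb_poly: "pb (poly p)"
  by (auto simp: pb_def)

lemma pb_const: "pb (\<lambda>_. c)"
  unfolding pb_def by (intro exI[of _ "[:c:]"]) simp

lemma pb_id: "pb (\<lambda>n. n)"
  unfolding pb_def by (intro exI[of _ "[:0, 1:]"]) simp

lemma pb_add: "pb f \<Longrightarrow> pb g \<Longrightarrow> pb (\<lambda>n. f n + g n)"
  unfolding pb_def by (metis add_mono poly_add)

lemma pb_mult: "pb f \<Longrightarrow> pb g \<Longrightarrow> pb (\<lambda>n. f n * g n)"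
  unfolding pb_def by (metis mult_le_mono poly_mult)

lemma pb_Suc: "pb f \<Longrightarrow> pb (\<lambda>n. Suc (f n))"
  using pb_add[of f "\<lambda>_. 1"] by (simp add: pb_const)

lemma pb_poly_comp:
  assumes "pb g"
  shows "pb (\<lambda>n. poly p (g n))"
proof -
  obtain q where "\<And>n. g n \<le> poly q n" using assms by (auto simp: pb_def)
  then have "poly p (g n) \<le> poly (pcompose p q) n" for n
    by (simp add: poly_pcompose poly_nat_mono)
  then show ?thesis by (auto simp: pb_def)
qed

lemmas pb_intros = pb_poly_comp pb_poly pb_mult pb_add pb_Suc pb_const pb_id


section \<open>Macros of the stack language\<close>

definition runs :: "com \<Rightarrow> store \<Rightarrow> nat \<Rightarrow> store \<Rightarrow> bool" where
  "runs c s T s' \<longleftrightarrow> (\<exists>t \<le> T. exec c s t s')"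

lemma runs_conv: "runs c s T s' \<Longrightarrow> s' = s'' \<Longrightarrow> T \<le> T' \<Longrightarrow> runs c s T' s''"
  unfolding runs_def using order_trans by blast

lemma runs_Skip: "runs Skip s 1 s"
  unfolding runs_def using exec_Skip by blast

lemma runs_Push: "runs (Push v b) s 2 (s(v := b # s v))"
  unfolding runs_def using exec_Push by blast

lemma runs_Pop: "runs (Pop v) s 1 (s(v := tl (s v)))"
  unfolding runs_def using exec_Pop by blast

lemma runs_Seq: "runs c s T s' \<Longrightarrow> runs d s' U s'' \<Longrightarrow> runs (Seq c d) s (Suc (T + U)) s''"
  unfolding runs_def by (meson Suc_le_mono add_mono exec_Seq)

lemma runs_Case: "runs (pick (s v) c d e) s T s' \<Longrightarrow> runs (Case v c d e) s (Suc T) s'"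
  unfolding runs_def using exec_Case by (meson Suc_le_mono)

lemma runs_While_stop: "s v = [] \<Longrightarrow> runs (While v c) s 1 s"
  unfolding runs_def using exec_While_stop by blast

lemma runs_While_step:
  "s v \<noteq> [] \<Longrightarrow> runs c s T s' \<Longrightarrow> runs (While v c) s' U s'' \<Longrightarrow>
    runs (While v c) s (Suc (T + U)) s''"
  unfolding runs_def by (meson Suc_le_mono add_mono exec_While_step)

lemma runs_length: "runs c s T s' \<Longrightarrow> length (s' v) \<le> length (s v) + T"
  unfolding runs_def using exec_length by (meson add_le_mono le_refl order_trans)

text \<open>A substitute for procedure calls: the callee is renamed to work on the stacks from
  \<open>b\<close> on, while the caller keeps its data on the stacks below.\<close>

primrec shift :: "nat \<Rightarrow> com \<Rightarrow> com" where
  "shift b Skip = Skip"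
| "shift b (Push v x) = Push (v + b) x"
| "shift b (Put v x) = Put (v + b) x"
| "shift b (Pop v) = Pop (v + b)"
| "shift b (Seq c d) = Seq (shift b c) (shift b d)"
| "shift b (Case v c d e) = Case (v + b) (shift b c) (shift b d) (shift b e)"
| "shift b (While v c) = While (v + b) (shift b c)"

lemma exec_shift:
  "exec c s t s' \<Longrightarrow>
    exec (shift b c) (\<lambda>i. if i < b then r i else s (i - b)) t (\<lambda>i. if i < b then r i else s' (i - b))"
proof (induction rule: exec.induct)
  case (exec_Push v x s)
  have "(\<lambda>i. if i < b then r i else (s(v := x # s v)) (i - b)) =
      (\<lambda>i. if i < b then r i else s (i - b))(v + b := x # s v)" by (auto simp: fun_eq_iff)
  then show ?case using exec.exec_Push[of "v + b" x "\<lambda>i. if i < b then r i else s (i - b)"] by simp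
next
  case (exec_Pop v s)
  have "(\<lambda>i. if i < b then r i else (s(v := tl (s v))) (i - b)) =
      (\<lambda>i. if i < b then r i else s (i - b))(v + b := tl (s v))" by (auto simp: fun_eq_iff)
  then show ?case using exec.exec_Pop[of "v + b" "\<lambda>i. if i < b then r i else s (i - b)"] by simp
next
  case (exec_Case s v c d e t s')
  then show ?case by (cases "s v") (auto intro!: exec.exec_Case split: if_splits)
next
  case (exec_While_step s v c t s' u s'')
  then show ?case by (auto intro!: exec.exec_While_step)
qed (auto intro: exec.intros simp del: One_nat_def)

lemma runs_call:
  assumes "runs c (ini x) T (ini y)" "s b = x" "\<And>i. b < i \<Longrightarrow> s i = []"
  shows "runs (shift b c) s T (s(b := y))"
proof -
  have e: "(\<lambda>i. if i < b then s i else ini z (i - b)) = s(b := z)" for z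
    using assms(3) by (auto simp: ini_def fun_eq_iff not_less le_less)
  have "s(b := x) = s" using assms(2) by auto
  then show ?thesis
    using assms(1) exec_shift[of c "ini x" _ "ini y" b s] by (auto simp: runs_def e)
qed

text \<open>The second assumption says that the effect \<open>g\<close> neither reads nor changes
  the stack \<open>u\<close> being consumed, so the final emptying of \<open>u\<close> can be moved
  past the fold.\<close>

lemma runs_drain:
  assumes "\<And>s b w. s u = b # w \<Longrightarrow> runs c s k ((g b s)(u := w))"
    and "\<And>s b w. g b (s(u := w)) = (g b s)(u := w)"
  shows "runs (While u c) s (Suc k * length (s u) + 1) ((fold g (s u) s)(u := []))"
proof -
  have "\<forall>s. s u = w \<longrightarrow> runs (While u c) s (Suc k * length w + 1) ((fold g w s)(u := []))" for w
  proof (induction w)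
    case Nil
    then show ?case using runs_While_stop[of _ u c] by (auto simp: fun_upd_idem)
  next
    case (Cons b w)
    show ?case
    proof (intro allI impI)
      fix s assume s: "s u = b # w"
      have f: "(fold g w (s(u := v)))(u := []) = (fold g w s)(u := [])" for v and s :: store
        by (induction w arbitrary: s) (simp_all add: assms(2))
      have "runs (While u c) ((g b s)(u := w)) (Suc k * length w + 1)
          ((fold g w ((g b s)(u := w)))(u := []))"
        by (rule Cons.IH[rule_format]) simp
      from runs_While_step[where s = s, OF _ assms(1)[of s b w, OF s] this] s f
      show "runs (While u c) s (Suc k * length (b # w) + 1) ((fold g (b # w) s)(u := []))"
        by (auto elim!: runs_conv)
    qed
  qed
  then show ?thesis by blast
qed

definition each :: "nat \<Rightarrow> (bool \<Rightarrow> com) \<Rightarrow> com" where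
  "each u c = While u (Case u Skip (Seq (Pop u) (c False)) (Seq (Pop u) (c True)))"

lemma runs_each:
  assumes "\<And>s b. runs (c b) s k (g b s)" "\<And>s b w. g b (s(u := w)) = (g b s)(u := w)"
  shows "runs (each u c) s ((k + 4) * length (s u) + 1) ((fold g (s u) s)(u := []))"
proof -
  have *: "runs (Case u Skip (Seq (Pop u) (c False)) (Seq (Pop u) (c True))) s (k + 3) ((g b s)(u := w))"
    if "s u = b # w" for s b w
  proof (rule runs_conv)
    have "runs (Seq (Pop u) (c b)) s (Suc (1 + k)) (g b (s(u := w)))"
      using runs_Seq[OF runs_Pop[of u s] assms(1)] that by simp
    then show "runs (Case u Skip (Seq (Pop u) (c False)) (Seq (Pop u) (c True))) s
        (Suc (Suc (1 + k))) (g b (s(u := w)))"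
      using that by (intro runs_Case) (cases b, auto)
  qed (simp_all add: assms(2))
  show ?thesis
    unfolding each_def by (rule runs_conv[OF runs_drain[where g = g, OF *]]) (simp_all add: assms(2))
qed

definition mv :: "nat \<Rightarrow> nat \<Rightarrow> com" where
  "mv u v = each u (\<lambda>b. Push v b)"

lemma runs_mv:
  assumes "u \<noteq> v"
  shows "runs (mv u v) s (6 * length (s u) + 1) (s(u := [], v := rev (s u) @ s v))"
proof -
  have *: "fold (\<lambda>b s. s(v := b # s v)) w s = s(v := rev w @ s v)" for w s
    by (induction w arbitrary: s) auto
  show ?thesis unfolding mv_def using assms
    by (intro runs_conv[OF runs_each[where g = "\<lambda>b s. s(v := b # s v)" and k = 2]])
      (auto simp: runs_Push fun_eq_iff *)
qed

definition mv2 :: "nat \<Rightarrow> nat \<Rightarrow> nat \<Rightarrow> com" where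
  "mv2 u v w = each u (\<lambda>b. Seq (Push v b) (Push w b))"

lemma runs_mv2:
  assumes "u \<noteq> v" "u \<noteq> w" "v \<noteq> w"
  shows "runs (mv2 u v w) s (9 * length (s u) + 1)
    (s(u := [], v := rev (s u) @ s v, w := rev (s u) @ s w))"
proof -
  let ?g = "\<lambda>b s. s(v := b # s v, w := b # s w)"
  have *: "fold ?g x s = s(v := rev x @ s v, w := rev x @ s w)" for x s
    by (induction x arbitrary: s) (auto simp: assms fun_upd_twist)
  have "runs (Seq (Push v b) (Push w b)) s 5 (?g b s)" for b s
    using assms by (intro runs_conv[OF runs_Seq[OF runs_Push runs_Push]]) auto
  then show ?thesis unfolding mv2_def using assms
    by (intro runs_conv[OF runs_each[where g = ?g and k = 5]]) (auto simp: fun_eq_iff *)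
qed

definition clr :: "nat \<Rightarrow> com" where
  "clr u = each u (\<lambda>_. Skip)"

lemma runs_clr: "runs (clr u) s (5 * length (s u) + 1) (s(u := []))"
proof -
  have "fold (\<lambda>b s. s) w s = s" for w :: "bool list" and s :: store by (induction w) auto
  then show ?thesis unfolding clr_def
    by (intro runs_conv[OF runs_each[where g = "\<lambda>b s. s" and k = 1]]) (auto simp: runs_Skip[unfolded One_nat_def])
qed

definition copy01 :: com where
  "copy01 = Seq (mv 0 2) (mv2 2 0 1)"

lemma runs_copy01:
  assumes "s 1 = []" "s 2 = []"
  shows "runs copy01 s (15 * length (s 0) + 3) (s(1 := s 0))"
  unfolding copy01_def
  by (rule runs_conv, rule runs_Seq, rule runs_mv, simp, rule runs_mv2) (use assms in \<open>auto simp: fun_eq_iff\<close>)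

text \<open>A single \<open>mv\<close> reverses the word; the detour through \<open>w\<close>
  restores its order.\<close>

definition relocate :: "nat \<Rightarrow> nat \<Rightarrow> nat \<Rightarrow> com" where
  "relocate u v w = Seq (mv u w) (mv w v)"

lemma runs_relocate:
  assumes "u \<noteq> v" "u \<noteq> w" "v \<noteq> w" "s v = []" "s w = []"
  shows "runs (relocate u v w) s (12 * length (s u) + 3) (s(u := [], v := s u))"
  unfolding relocate_def
  by (rule runs_conv, rule runs_Seq, rule runs_mv, fact, rule runs_mv)
    (use assms in \<open>auto simp: fun_eq_iff\<close>)

lemma enc_word_simps [simp]:
  "enc_word [] = [False]" "enc_word (b # w) = True # b # enc_word w"
  by (simp_all add: enc_word_def enc_list_def)

lemma length_enc_word [simp]: "length (enc_word w) = 2 * length w + 1"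
  by (induction w) auto

definition encw :: "nat \<Rightarrow> nat \<Rightarrow> com" where
  "encw u v = Seq (Push v False) (each u (\<lambda>b. Seq (Push v b) (Push v True)))"

lemma runs_encw:
  assumes "u \<noteq> v"
  shows "runs (encw u v) s (9 * length (s u) + 4) (s(u := [], v := enc_word (rev (s u)) @ s v))"
proof -
  let ?g = "\<lambda>b s. s(v := True # b # s v)"
  have fold_g: "fold ?g w (s(v := enc_word x @ y)) = s(v := enc_word (rev w @ x) @ y)" for w s x y
  proof (induction w arbitrary: x)
    case (Cons b w)
    have "?g b (s(v := enc_word x @ y)) = s(v := enc_word (b # x) @ y)" by (simp add: fun_eq_iff)
    then have "fold ?g (b # w) (s(v := enc_word x @ y)) = fold ?g w (s(v := enc_word (b # x) @ y))"
      by (simp only: fold_simps o_apply)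
    then show ?case by (simp only: Cons.IH) simp
  qed simp
  have "runs (Seq (Push v b) (Push v True)) s 5 (?g b s)" for b s
    by (intro runs_conv[OF runs_Seq[OF runs_Push runs_Push]]) auto
  then have e: "runs (each u (\<lambda>b. Seq (Push v b) (Push v True))) s (9 * length (s u) + 1)
      ((fold ?g (s u) s)(u := []))" for s
    using assms by (intro runs_conv[OF runs_each[where g = ?g and k = 5]]) (auto simp: fun_upd_twist)
  show ?thesis unfolding encw_def
    by (rule runs_conv, rule runs_Seq, rule runs_Push, rule e)
      (use assms fold_g[of "s u" s "[]" "s v"] in \<open>auto simp: fun_upd_twist\<close>)
qed

text \<open>The loop is controlled by a flag stack \<open>f\<close>, since it must stop at the end
  marker and not at the end of \<open>u\<close>. The branch for an empty \<open>u\<close> makes the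
  same program compute \<open>tl\<close> on the empty list.\<close>

definition decw :: "nat \<Rightarrow> nat \<Rightarrow> nat \<Rightarrow> com" where
  "decw u v f = Seq (Push f True) (While f
    (Case u (Pop f) (Seq (Pop u) (Pop f))
      (Seq (Pop u) (Case u Skip (Seq (Pop u) (Push v False)) (Seq (Pop u) (Push v True))))))"

lemma runs_decw_Nil:
  assumes "u \<noteq> f" "s u = []" "s f = []"
  shows "runs (decw u v f) s 10 s"
proof -
  have "runs (decw u v f) s (Suc (2 + Suc (2 + 1))) (s(f := []))"
    unfolding decw_def
    apply (rule runs_Seq, rule runs_Push)
    apply (rule runs_While_step, simp)
     apply (rule runs_conv, rule runs_Case)
       apply (simp add: assms, rule runs_Pop)
      apply (rule refl, simp)
    apply (rule runs_conv, rule runs_While_stop)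
    by (use assms in \<open>auto simp: fun_eq_iff\<close>)
  then show ?thesis using assms by (auto elim!: runs_conv)
qed

lemma runs_decw:
  assumes "u \<noteq> v" "u \<noteq> f" "v \<noteq> f" "s u = enc_word x @ y" "s f = []"
  shows "runs (decw u v f) s (10 * length x + 10) (s(u := y, v := rev x @ s v))"
proof -
  let ?b = "Case u (Pop f) (Seq (Pop u) (Pop f))
      (Seq (Pop u) (Case u Skip (Seq (Pop u) (Push v False)) (Seq (Pop u) (Push v True))))"
  have "s u = enc_word x @ y \<Longrightarrow> s f = [True] \<Longrightarrow>
      runs (While f ?b) s (10 * length x + 7) (s(u := y, v := rev x @ s v, f := []))" for s
  proof (induction x arbitrary: s)
    case Nil
    have "runs ?b s 5 (s(u := y, f := []))"
      by (rule runs_conv, rule runs_Case, simp add: Nil, rule runs_Seq, rule runs_Pop, rule runs_Pop)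
        (use Nil assms in \<open>auto simp: fun_eq_iff\<close>)
    moreover have "runs (While f ?b) (s(u := y, f := [])) 1 (s(u := y, f := []))"
      by (rule runs_While_stop) simp
    ultimately have "runs (While f ?b) s (Suc (5 + 1)) (s(u := y, f := []))"
      by (rule runs_While_step[rotated]) (simp add: Nil)
    then show ?case by (rule runs_conv) (use assms in \<open>auto simp: fun_eq_iff\<close>)
  next
    case (Cons b x)
    have b: "runs ?b s 8 (s(u := enc_word x @ y, v := b # s v))"
    proof (rule runs_conv, rule runs_Case)
      let ?s1 = "s(u := tl (s u))"
      have "runs (Seq (Pop u) (Push v b)) ?s1 (Suc (1 + 2)) (?s1(u := tl (?s1 u), v := b # ?s1 v))"
        using runs_Seq[OF runs_Pop[of u ?s1] runs_Push[of v b]] assms by simp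
      then have "runs (Case u Skip (Seq (Pop u) (Push v False)) (Seq (Pop u) (Push v True))) ?s1
          (Suc (Suc (1 + 2))) (?s1(u := tl (?s1 u), v := b # ?s1 v))"
        using Cons.prems by (intro runs_Case) (cases b, auto)
      from runs_Seq[OF runs_Pop this] Cons.prems
      show "runs (pick (s u) (Pop f) (Seq (Pop u) (Pop f))
          (Seq (Pop u) (Case u Skip (Seq (Pop u) (Push v False)) (Seq (Pop u) (Push v True))))) s
          (Suc (1 + Suc (Suc (1 + 2)))) (?s1(u := tl (?s1 u), v := b # ?s1 v))" by simp
    qed (use Cons.prems assms in \<open>auto simp: fun_eq_iff\<close>)
    have "runs (While f ?b) (s(u := enc_word x @ y, v := b # s v)) (10 * length x + 7)
        (s(u := y, v := rev (b # x) @ s v, f := []))"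
      by (rule runs_conv, rule Cons.IH) (use Cons.prems assms in \<open>auto simp: fun_eq_iff\<close>)
    from runs_While_step[OF _ b this] Cons.prems show ?case by (auto elim!: runs_conv)
  qed
  from this[of "s(f := [True])"]
  have *: "runs (While f ?b) (s(f := True # s f)) (10 * length x + 7) (s(u := y, v := rev x @ s v))"
    using assms by (auto elim!: runs_conv simp: fun_eq_iff)
  show ?thesis unfolding decw_def
    by (rule runs_conv, rule runs_Seq, rule runs_Push, rule *) auto
qed

definition mkpair :: com where
  "mkpair = Seq (relocate 2 0 3) (Seq (mv 1 3) (encw 3 0))"

lemma runs_mkpair:
  assumes "s 0 = []" "s 1 = x" "s 2 = y" "\<And>i. 2 < i \<Longrightarrow> s i = []"
  shows "runs mkpair s (15 * length x + 12 * length y + 10) (ini (enc_pair x y))"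
  unfolding mkpair_def
  by (rule runs_conv, rule runs_Seq, rule runs_relocate; (rule runs_Seq, rule runs_mv)?; (rule runs_encw)?)
    (use assms in \<open>auto simp: fun_eq_iff ini_def enc_pair_def not_less le_less numeral_eq_Suc less_Suc_eq\<close>)

primrec pushes :: "nat \<Rightarrow> bool list \<Rightarrow> com" where
  "pushes v [] = Skip"
| "pushes v (b # w) = Seq (pushes v w) (Push v b)"

lemma runs_pushes: "runs (pushes v w) s (3 * length w + 1) (s(v := w @ s v))"
proof (induction w)
  case Nil
  then show ?case using runs_Skip by (simp add: fun_upd_idem)
next
  case (Cons b w)
  show ?case unfolding pushes.simps by (rule runs_conv[OF runs_Seq[OF Cons.IH runs_Push]]) auto
qed


section \<open>Polynomial-time functions on structured data\<close>

class pdata =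
  fixes penc :: "'a \<Rightarrow> bool list"

instantiation bool :: pdata
begin
definition "penc (b :: bool) = [b]"
instance ..
end

instantiation prod :: (pdata, pdata) pdata
begin
definition "penc p = enc_pair (penc (fst p)) (penc (snd p))"
instance ..
end

text \<open>Only the element is made self-delimiting, the tail is kept as it is, so the size of the
  code is linear in the sizes of the elements. Codes of nonempty lists are nonempty, so emptiness
  can be tested on one cell.\<close>

instantiation list :: (pdata) pdata
begin
primrec penc_list :: "'a list \<Rightarrow> bool list" where
  "penc_list [] = []"
| "penc_list (x # xs) = enc_pair (penc x) (penc_list xs)"
instance ..
end

definition sz :: "'a :: pdata \<Rightarrow> nat" where
  "sz a = length (penc a)"

lemma sz_bool [simp]: "sz (b :: bool) = 1"
  by (simp add: sz_def penc_bool_def)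

lemma sz_Pair [simp]: "sz (a, b) = 2 * sz a + sz b + 1"
  by (simp add: sz_def penc_prod_def enc_pair_def)

lemma sz_Nil [simp]: "sz [] = 0"
  by (simp add: sz_def)

lemma sz_Cons [simp]: "sz (x # xs) = 2 * sz x + sz xs + 1"
  by (simp add: sz_def enc_pair_def)

lemma sz_append [simp]: "sz (xs @ ys) = sz xs + sz ys"
  by (induction xs) auto

lemma sz_rev [simp]: "sz (rev xs) = sz xs"
  by (induction xs) auto

lemma length_le_sz: "length xs \<le> sz xs"
  by (induction xs) auto

lemma sz_word: "sz (w :: bool list) = 3 * length w"
  by (induction w) auto

lemma sz_mem: "x \<in> set xs \<Longrightarrow> sz x \<le> sz xs"
  by (induction xs) auto

definition PT :: "('a :: pdata \<Rightarrow> 'b :: pdata) \<Rightarrow> bool" where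
  "PT f \<longleftrightarrow> (\<exists>c (p :: nat poly). \<forall>a. runs c (ini (penc a)) (poly p (sz a)) (ini (penc (f a))))"

lemma PT_I:
  assumes "pb T" "\<And>a. runs c (ini (penc a)) (T (sz a)) (ini (penc (f a)))"
  shows "PT f"
proof -
  obtain p where "\<And>n. T n \<le> poly p n" using assms(1) by (auto simp: pb_def)
  then have "runs c (ini (penc a)) (poly p (sz a)) (ini (penc (f a)))" for a
    using assms(2) runs_conv by blast
  then show ?thesis unfolding PT_def by blast
qed

lemma PT_E:
  assumes "PT f"
  obtains c p where "\<And>a. runs c (ini (penc a)) (poly p (sz a)) (ini (penc (f a)))"
  using assms unfolding PT_def by blast

lemma PT_size:
  assumes "PT f"
  obtains p where "\<And>a. sz (f a) \<le> poly p (sz a)"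
proof -
  obtain c p where "\<And>a. runs c (ini (penc a)) (poly p (sz a)) (ini (penc (f a)))"
    using PT_E[OF assms] by metis
  from runs_length[OF this, where v = 0] have "sz (f a) \<le> poly ([:0, 1:] + p) (sz a)" for a
    by (simp add: ini_def sz_def)
  then show ?thesis using that by blast
qed

lemma PT_id: "PT (\<lambda>x. x)"
  by (rule PT_I[OF pb_const, of Skip 1]) (rule runs_Skip)

lemma PT_comp:
  assumes "PT f" "PT g"
  shows "PT (\<lambda>x. f (g x))"
proof -
  obtain c p where c: "\<And>a. runs c (ini (penc a)) (poly p (sz a)) (ini (penc (f a)))"
    using PT_E[OF assms(1)] by metis
  obtain d q where d: "\<And>a. runs d (ini (penc a)) (poly q (sz a)) (ini (penc (g a)))"
    using PT_E[OF assms(2)] by metis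
  obtain r where r: "\<And>a. sz (g a) \<le> poly r (sz a)" using PT_size[OF assms(2)] by metis
  show ?thesis
  proof (rule PT_I)
    show "pb (\<lambda>n. Suc (poly q n + poly p (poly r n)))" by (intro pb_intros)
    fix a
    show "runs (Seq d c) (ini (penc a)) (Suc (poly q (sz a) + poly p (poly r (sz a)))) (ini (penc (f (g a))))"
      by (rule runs_conv[OF runs_Seq[OF d c]]) (simp_all add: poly_nat_mono r)
  qed
qed

lemma PT_const: "PT (\<lambda>_. k)"
proof (rule PT_I)
  show "pb (\<lambda>n. Suc (5 * n + 1 + (3 * sz k + 1)))" by (intro pb_intros)
  fix a :: 'a
  show "runs (Seq (clr 0) (pushes 0 (penc k))) (ini (penc a)) (Suc (5 * sz a + 1 + (3 * sz k + 1))) (ini (penc k))"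
    by (rule runs_conv[OF runs_Seq[OF runs_clr runs_pushes]]) (auto simp: ini_def sz_def)
qed

text \<open>Pairs and nonempty lists have the same code, so one program serves both constructors.\<close>

lemma PT_code_pair:
  fixes f :: "'a :: pdata \<Rightarrow> 'b :: pdata" and g :: "'a \<Rightarrow> 'c :: pdata" and h :: "'a \<Rightarrow> 'd :: pdata"
  assumes "PT f" "PT g" "\<And>a. penc (h a) = enc_pair (penc (f a)) (penc (g a))"
  shows "PT h"
proof -
  obtain c p where c: "\<And>a. runs c (ini (penc a)) (poly p (sz a)) (ini (penc (f a)))"
    using PT_E[OF assms(1)] by metis
  obtain d q where d: "\<And>a. runs d (ini (penc a)) (poly q (sz a)) (ini (penc (g a)))"
    using PT_E[OF assms(2)] by metis
  obtain r where r: "\<And>a. sz (f a) \<le> poly r (sz a)" using PT_size[OF assms(1)] by metis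
  obtain r' where r': "\<And>a. sz (g a) \<le> poly r' (sz a)" using PT_size[OF assms(2)] by metis
  let ?c = "Seq copy01 (Seq (shift 1 c) (Seq (relocate 0 2 3) (Seq (shift 2 d) mkpair)))"
  show ?thesis
  proof (rule PT_I)
    show "pb (\<lambda>n. 30 * n + poly p n + poly q n + 15 * poly r n + 12 * poly r' n + 100)"
      by (intro pb_intros)
    fix a :: 'a
    let ?s1 = "(ini (penc a))(1 := penc a)"
    let ?s2 = "(ini (penc a))(1 := penc (f a))"
    let ?s3 = "(\<lambda>_. [])(1 := penc (f a), 2 := penc a)"
    let ?s4 = "(\<lambda>_. [])(1 := penc (f a), 2 := penc (g a))"
    have 1: "runs copy01 (ini (penc a)) (15 * sz a + 3) ?s1"
      by (rule runs_conv[OF runs_copy01]) (auto simp: ini_def sz_def)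
    have 2: "runs (shift 1 c) ?s1 (poly p (sz a)) ?s2"
      by (rule runs_conv[OF runs_call[OF c[of a]]]) (auto simp: ini_def)
    have 3: "runs (relocate 0 2 3) ?s2 (12 * sz a + 3) ?s3"
      by (rule runs_conv[OF runs_relocate]) (auto simp: ini_def fun_eq_iff sz_def)
    have 4: "runs (shift 2 d) ?s3 (poly q (sz a)) ?s4"
      by (rule runs_conv[OF runs_call[OF d[of a]]]) (auto simp: fun_eq_iff)
    have 5: "runs mkpair ?s4 (15 * poly r (sz a) + 12 * poly r' (sz a) + 10) (ini (penc (h a)))"
      using r[of a] r'[of a]
      by (intro runs_conv[OF runs_mkpair]) (auto simp: assms(3) fun_eq_iff sz_def)
    show "runs ?c (ini (penc a))
        (30 * sz a + poly p (sz a) + poly q (sz a) + 15 * poly r (sz a) + 12 * poly r' (sz a) + 100)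
        (ini (penc (h a)))"
      by (rule runs_conv[OF runs_Seq[OF 1 runs_Seq[OF 2 runs_Seq[OF 3 runs_Seq[OF 4 5]]]]]) auto
  qed
qed

lemma PT_Pair: "PT f \<Longrightarrow> PT g \<Longrightarrow> PT (\<lambda>x. (f x, g x))"
  by (erule PT_code_pair) (auto simp: penc_prod_def)

lemma PT_Cons: "PT f \<Longrightarrow> PT g \<Longrightarrow> PT (\<lambda>x. f x # g x)"
  by (erule PT_code_pair) auto

definition first_prog :: com where
  "first_prog = Seq (decw 0 1 2) (Seq (clr 0) (mv 1 0))"

definition second_prog :: com where
  "second_prog = Seq (decw 0 1 2) (clr 1)"

lemma runs_first: "runs first_prog (ini (enc_pair x y)) (16 * length x + 5 * length y + 20) (ini x)"
  unfolding first_prog_def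
  by (rule runs_conv, rule runs_Seq, rule runs_decw[where x = x and y = y];
      (rule runs_Seq, rule runs_clr, rule runs_mv)?) (auto simp: ini_def enc_pair_def fun_eq_iff)

lemma runs_second: "runs second_prog (ini (enc_pair x y)) (15 * length x + 20) (ini y)"
  unfolding second_prog_def
  by (rule runs_conv, rule runs_Seq, rule runs_decw[where x = x and y = y]; (rule runs_clr)?)
    (auto simp: ini_def enc_pair_def fun_eq_iff)

lemma runs_second_Nil: "runs second_prog (ini []) 20 (ini [])"
  unfolding second_prog_def
  by (rule runs_conv, rule runs_Seq, rule runs_decw_Nil; (rule runs_clr)?) (auto simp: ini_def fun_eq_iff)

lemma PT_fst': "PT fst"
proof (rule PT_I)
  show "pb (\<lambda>n. 16 * n + 20)" by (intro pb_intros)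
  fix p :: "'a \<times> 'b"
  show "runs first_prog (ini (penc p)) (16 * sz p + 20) (ini (penc (fst p)))"
    by (cases p, simp add: penc_prod_def)
      (rule runs_conv[OF runs_first], auto simp: sz_def[symmetric])
qed

lemma PT_snd': "PT snd"
proof (rule PT_I)
  show "pb (\<lambda>n. 16 * n + 20)" by (intro pb_intros)
  fix p :: "'a \<times> 'b"
  show "runs second_prog (ini (penc p)) (16 * sz p + 20) (ini (penc (snd p)))"
    by (cases p, simp add: penc_prod_def)
      (rule runs_conv[OF runs_second], auto simp: sz_def[symmetric])
qed

lemma PT_tl': "PT tl"
proof (rule PT_I)
  show "pb (\<lambda>n. 16 * n + 20)" by (intro pb_intros)
  fix xs :: "'a list"
  show "runs second_prog (ini (penc xs)) (16 * sz xs + 20) (ini (penc (tl xs)))"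
  proof (cases xs)
    case Nil
    then show ?thesis using runs_second_Nil by simp
  next
    case (Cons y ys)
    then show ?thesis using runs_second[of "penc y" "penc ys"]
      by (auto elim!: runs_conv simp: sz_def[symmetric])
  qed
qed

lemma PT_hd': "PT (hd :: 'a :: pdata list \<Rightarrow> 'a)"
proof (rule PT_I)
  \<comment> \<open>\<open>hd []\<close> is unspecified but fixed, so its code can be
    hard-wired.\<close>
  let ?d = "hd [] :: 'a"
  let ?c = "Case 0 (pushes 0 (penc ?d)) first_prog first_prog"
  show "pb (\<lambda>n. 16 * n + 3 * sz ?d + 21)" by (intro pb_intros)
  fix xs :: "'a list"
  show "runs ?c (ini (penc xs)) (16 * sz xs + 3 * sz ?d + 21) (ini (penc (hd xs)))"
  proof (cases xs)
    case Nil
    have "runs (pushes 0 (penc ?d)) (ini []) (3 * sz ?d + 1) (ini (penc ?d))"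
      by (rule runs_conv[OF runs_pushes]) (auto simp: ini_def sz_def)
    then have "runs ?c (ini []) (Suc (3 * sz ?d + 1)) (ini (penc ?d))"
      by (intro runs_Case) (simp add: ini_def)
    then show ?thesis using Nil by (auto elim!: runs_conv)
  next
    case (Cons y ys)
    have "pick (ini (penc xs) 0) a first_prog first_prog = first_prog" for a
      by (cases "penc y") (auto simp: ini_def Cons enc_pair_def)
    then have "runs ?c (ini (penc xs)) (Suc (16 * sz y + 5 * sz ys + 20)) (ini (penc y))"
      using runs_first[of "penc y" "penc ys"] Cons by (intro runs_Case) (simp add: sz_def)
    then show ?thesis using Cons by (auto elim!: runs_conv)
  qed
qed

lemmas PT_fst = PT_comp[OF PT_fst']
lemmas PT_snd = PT_comp[OF PT_snd']
lemmas PT_hd = PT_comp[OF PT_hd']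
lemmas PT_tl = PT_comp[OF PT_tl']

lemma PT_null': "PT (\<lambda>xs :: 'a :: pdata list. xs = [])"
proof (rule PT_I)
  let ?c = "Case 0 (Push 0 True) (Seq (clr 0) (Push 0 False)) (Seq (clr 0) (Push 0 False))"
  show "pb (\<lambda>n. 5 * n + 10)" by (intro pb_intros)
  fix xs :: "'a list"
  show "runs ?c (ini (penc xs)) (5 * sz xs + 10) (ini (penc (xs = [])))"
  proof (cases xs)
    case Nil
    have "runs ?c (ini []) (Suc 2) (ini [True])"
      by (rule runs_Case) (rule runs_conv, (simp add: ini_def, rule runs_Push), auto simp: ini_def)
    then show ?thesis using Nil by (auto elim!: runs_conv simp: penc_bool_def)
  next
    case (Cons y ys)
    have "pick (ini (penc xs) 0) a (Seq (clr 0) (Push 0 False)) (Seq (clr 0) (Push 0 False)) =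
        Seq (clr 0) (Push 0 False)" for a
      by (cases "penc y") (auto simp: ini_def Cons enc_pair_def)
    moreover have "runs (Seq (clr 0) (Push 0 False)) (ini (penc xs)) (5 * sz xs + 9) (ini [False])"
      by (rule runs_conv[OF runs_Seq[OF runs_clr runs_Push]]) (auto simp: ini_def sz_def)
    ultimately have "runs ?c (ini (penc xs)) (Suc (5 * sz xs + 9)) (ini [False])"
      by (intro runs_Case) simp
    then show ?thesis using Cons by (auto elim!: runs_conv simp: penc_bool_def)
  qed
qed

lemmas PT_null = PT_comp[OF PT_null']

lemma PT_if:
  fixes b :: "'a :: pdata \<Rightarrow> bool"
  assumes "PT b" "PT f" "PT g"
  shows "PT (\<lambda>x. if b x then f x else g x)"
proof -
  obtain e r where e: "\<And>a. runs e (ini (penc a)) (poly r (sz a)) (ini (penc (b a)))"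
    using PT_E[OF assms(1)] by metis
  obtain c p where c: "\<And>a. runs c (ini (penc a)) (poly p (sz a)) (ini (penc (f a)))"
    using PT_E[OF assms(2)] by metis
  obtain d q where d: "\<And>a. runs d (ini (penc a)) (poly q (sz a)) (ini (penc (g a)))"
    using PT_E[OF assms(3)] by metis
  let ?c = "Case 1 Skip (Seq (Pop 1) d) (Seq (Pop 1) c)"
  show ?thesis
  proof (rule PT_I)
    show "pb (\<lambda>n. 15 * n + poly r n + poly p n + poly q n + 10)" by (intro pb_intros)
    fix a :: 'a
    let ?s1 = "(ini (penc a))(1 := penc a)"
    let ?s2 = "(ini (penc a))(1 := [b a])"
    have 1: "runs copy01 (ini (penc a)) (15 * sz a + 3) ?s1"
      by (rule runs_conv[OF runs_copy01]) (auto simp: ini_def sz_def)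
    have 2: "runs (shift 1 e) ?s1 (poly r (sz a)) ?s2"
      by (rule runs_conv[OF runs_call[OF e[of a]]]) (auto simp: ini_def penc_bool_def)
    have pop: "runs (Pop 1) ?s2 1 (ini (penc a))"
      by (rule runs_conv[OF runs_Pop]) (auto simp: ini_def fun_eq_iff)
    have "runs (pick (?s2 1) Skip (Seq (Pop 1) d) (Seq (Pop 1) c)) ?s2
        (2 + poly p (sz a) + poly q (sz a)) (ini (penc (if b a then f a else g a)))"
      using runs_Seq[OF pop c[of a]] runs_Seq[OF pop d[of a]] by (auto elim!: runs_conv)
    from runs_Seq[OF 1 runs_Seq[OF 2 runs_Case[where s = ?s2, OF this]]]
    show "runs (Seq copy01 (Seq (shift 1 e) ?c)) (ini (penc a))
        (15 * sz a + poly r (sz a) + poly p (sz a) + poly q (sz a) + 10)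
        (ini (penc (if b a then f a else g a)))"
      by (rule runs_conv) auto
  qed
qed

text \<open>Bounded iteration: the counter is the code of \<open>l x\<close>, of which one bit is consumed per round.\<close>

lemma PT_iter:
  fixes step :: "'s :: pdata \<Rightarrow> 's" and l :: "'x :: pdata \<Rightarrow> 'l :: pdata"
  assumes "PT step" "PT l" "PT s0" "pb B"
    and bound: "\<And>x n. n \<le> sz (l x) \<Longrightarrow> sz ((step ^^ n) (s0 x)) \<le> B (sz x)"
  shows "PT (\<lambda>x. (step ^^ sz (l x)) (s0 x))"
proof -
  obtain c p where c: "\<And>a. runs c (ini (penc a)) (poly p (sz a)) (ini (penc (step a)))"
    using PT_E[OF assms(1)] by metis
  obtain d q where d: "\<And>a. runs d (ini (penc a)) (poly q (sz a)) (ini (penc (l a, s0 a)))"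
    using PT_E[OF PT_Pair[OF assms(2,3)]] by metis
  obtain r where r: "\<And>a. sz (l a) \<le> poly r (sz a)" using PT_size[OF assms(2)] by metis
  obtain B' where B': "\<And>n. B n \<le> poly B' n" using \<open>pb B\<close> by (auto simp: pb_def)
  let ?loop = "While 1 (Seq (Pop 1) (shift 2 c))"
  let ?c = "Seq d (Seq (decw 0 1 2) (Seq (relocate 0 2 3) (Seq ?loop (relocate 2 0 3))))"
  show ?thesis
  proof (rule PT_I)
    show "pb (\<lambda>n. poly q n + 10 * poly r n + 24 * poly B' n + (poly p (poly B' n) + 3) * poly r n + 100)"
      by (intro pb_intros)
    fix a :: 'x
    let ?n = "sz (l a)" and ?N = "poly B' (sz a)"
    let ?st = "\<lambda>w y. (\<lambda>_. [])(1 := w, 2 := penc (y :: 's))"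
    \<comment> \<open>A polynomial-time step might square the size of the state in each round. The
      bound on all intermediate states is what keeps the total time polynomial.\<close>
    have bd: "sz ((step ^^ i) (s0 a)) \<le> ?N" if "i \<le> ?n" for i
      using bound[OF that] B' order_trans by blast
    have bd0: "sz (s0 a) \<le> ?N" using bd[of 0] by simp
    have 2: "runs (decw 0 1 2) (ini (penc (l a, s0 a))) (10 * ?n + 10)
        ((\<lambda>_. [])(0 := penc (s0 a), 1 := rev (penc (l a))))"
      by (rule runs_conv[OF runs_decw[where x = "penc (l a)" and y = "penc (s0 a)"]])
        (auto simp: ini_def penc_prod_def enc_pair_def fun_eq_iff sz_def)
    have 3: "runs (relocate 0 2 3) ((\<lambda>_. [])(0 := penc (s0 a), 1 := rev (penc (l a)))) (12 * ?N + 3)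
        (?st (rev (penc (l a))) (s0 a))"
      using bd0 by (intro runs_conv[OF runs_relocate]) (auto simp: fun_eq_iff sz_def)
    have "length w + i = ?n \<Longrightarrow> runs ?loop (?st w ((step ^^ i) (s0 a)))
        ((poly p ?N + 3) * length w + 1) (?st [] ((step ^^ ?n) (s0 a)))" for w i
    proof (induction w arbitrary: i)
      case Nil
      then show ?case by (auto intro!: runs_While_stop[unfolded One_nat_def])
    next
      case (Cons b w)
      let ?y = "(step ^^ i) (s0 a)"
      have "sz ?y \<le> ?N" using bd Cons.prems by simp
      then have body: "runs (Seq (Pop 1) (shift 2 c)) (?st (b # w) ?y) (Suc (1 + poly p ?N))
          (?st w ((step ^^ Suc i) (s0 a)))"
        by (intro runs_Seq[OF runs_Pop runs_conv[OF runs_call[OF c]]])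
          (auto simp: fun_eq_iff poly_nat_mono)
      have "runs ?loop (?st w ((step ^^ Suc i) (s0 a))) ((poly p ?N + 3) * length w + 1)
          (?st [] ((step ^^ ?n) (s0 a)))"
        by (rule Cons.IH) (use Cons.prems in simp)
      from runs_While_step[OF _ body this] show ?case by (rule runs_conv) auto
    qed
    from this[of "rev (penc (l a))" 0]
    have 4: "runs ?loop (?st (rev (penc (l a))) (s0 a)) ((poly p ?N + 3) * ?n + 1)
        (?st [] ((step ^^ ?n) (s0 a)))"
      by (simp add: sz_def)
    have 5: "runs (relocate 2 0 3) (?st [] ((step ^^ ?n) (s0 a))) (12 * ?N + 3)
        (ini (penc ((step ^^ ?n) (s0 a))))"
      using bd[of ?n] by (intro runs_conv[OF runs_relocate]) (auto simp: fun_eq_iff sz_def ini_def)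
    have "10 * ?n + (poly p ?N + 3) * ?n \<le> 10 * poly r (sz a) + (poly p ?N + 3) * poly r (sz a)"
      using r by (intro add_mono mult_le_mono2)
    then show "runs ?c (ini (penc a)) (poly q (sz a) + 10 * poly r (sz a) + 24 * ?N
        + (poly p ?N + 3) * poly r (sz a) + 100) (ini (penc ((step ^^ ?n) (s0 a))))"
      by (intro runs_conv[OF runs_Seq[OF d runs_Seq[OF 2 runs_Seq[OF 3 runs_Seq[OF 4 5]]]]]) simp_all
  qed
qed

text \<open>Machine inputs and outputs are raw words, whereas \<open>penc\<close> spends three bits on each bit.\<close>

lemma PT_imp_poly_time:
  fixes f :: "bool list \<Rightarrow> bool list"
  assumes "PT f"
  shows "poly_time_computable f"
proof -
  obtain c p where c: "\<And>a. runs c (ini (penc a)) (poly p (sz a)) (ini (penc (f a)))"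
    using PT_E[OF assms] by metis
  obtain r where r: "\<And>a. sz (f a) \<le> poly r (sz a)" using PT_size[OF assms] by metis
  \<comment> \<open>The code of a bit \<open>b\<close> inside a list is
    \<open>True, b, False\<close>.\<close>
  let ?g = "\<lambda>b s. s(0 := True # b # False # s 0)"
  let ?in = "each 1 (\<lambda>b. Seq (Push 0 False) (Seq (Push 0 b) (Push 0 True)))"
  let ?b = "Seq (Pop 0) (Seq (Case 0 Skip (Push 1 False) (Push 1 True)) (Seq (Pop 0) (Pop 0)))"
  let ?c = "Seq (mv 0 1) (Seq ?in (Seq c (Seq (While 0 ?b) (mv 1 0))))"
  define T where "T n = 18 * n + poly p (3 * n) + 16 * poly r (3 * n) + 100" for n
  have run: "runs ?c (ini x) (T (length x)) (ini (f x))" for x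
  proof -
    have 1: "runs (mv 0 1) (ini x) (6 * length x + 1) ((\<lambda>_. [])(1 := rev x))"
      by (rule runs_conv[OF runs_mv]) (auto simp: ini_def fun_eq_iff)
    have g: "fold ?g (rev x) s = s(0 := penc x @ s 0)" for s
      by (induction x arbitrary: s) (auto simp: enc_pair_def penc_bool_def)
    have "runs (Seq (Push 0 False) (Seq (Push 0 b) (Push 0 True))) s 8 (?g b s)" for b s
      by (rule runs_conv[OF runs_Seq[OF runs_Push runs_Seq[OF runs_Push runs_Push]]]) auto
    then have 2: "runs ?in ((\<lambda>_. [])(1 := rev x)) (12 * length x + 1) (ini (penc x))"
      by (intro runs_conv[OF runs_each[where g = ?g and k = 8]]) (auto simp: g ini_def fun_eq_iff)
    have 4: "runs (While 0 ?b) ((\<lambda>_. [])(0 := penc y, 1 := w)) (10 * length y + 1)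
        ((\<lambda>_. [])(1 := rev y @ w))" for y :: "bool list" and w
    proof (induction y arbitrary: w)
      case Nil
      show ?case by (rule runs_conv[OF runs_While_stop]) auto
    next
      case (Cons b y)
      let ?s = "(\<lambda>_. [])(0 := penc (b # y), 1 := w) :: store"
      let ?s1 = "?s(0 := tl (?s 0))"
      have "runs (Case 0 Skip (Push 1 False) (Push 1 True)) ?s1 (Suc 2) (?s1(1 := b # w))"
      proof (rule runs_Case)
        show "runs (pick (?s1 0) Skip (Push 1 False) (Push 1 True)) ?s1 2 (?s1(1 := b # w))"
          by (rule runs_conv[where s' = "?s1(1 := b # ?s1 1)" and T = 2])
            (use runs_Push[of 1 b ?s1] in \<open>auto simp: enc_pair_def penc_bool_def\<close>)
      qed
      from runs_Seq[OF runs_Pop runs_Seq[OF this runs_Seq[OF runs_Pop runs_Pop]]]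
      have "runs ?b ?s 9 ((\<lambda>_. [])(0 := penc y, 1 := b # w))"
        by (rule runs_conv) (auto simp: enc_pair_def penc_bool_def fun_eq_iff)
      from runs_While_step[OF _ this Cons.IH] show ?case
        by (rule runs_conv) (auto simp: enc_pair_def penc_bool_def)
    qed
    have 5: "runs (mv 1 0) ((\<lambda>_. [])(1 := rev (f x) @ [])) (6 * length (f x) + 1) (ini (f x))"
      by (rule runs_conv[OF runs_mv]) (auto simp: ini_def fun_eq_iff)
    have "(\<lambda>_. [])(0 := penc (f x), 1 := []) = ini (penc (f x))" by (auto simp: ini_def)
    with 4[of "f x" "[]"]
    have "runs (While 0 ?b) (ini (penc (f x))) (10 * length (f x) + 1) ((\<lambda>_. [])(1 := rev (f x) @ []))"
      by simp
    from runs_Seq[OF 1 runs_Seq[OF 2 runs_Seq[OF c runs_Seq[OF this 5]]]]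
    show ?thesis
      by (rule runs_conv) (use r[of x] in \<open>auto simp: T_def sz_word\<close>)
  qed
  have "\<exists>t \<le> T (length x). exec ?c (ini x) t (ini (f x))" for x
    using run[of x] by (simp add: runs_def)
  from exec_imp_tm[OF this] obtain M where M: "tm_wf M"
      "tm_computes_in_time M f (\<lambda>n. 2 * T n + n + 1)" by blast
  have "pb (\<lambda>n. 2 * T n + n + 1)" unfolding T_def by (intro pb_intros)
  then obtain P where "\<And>n. 2 * T n + n + 1 \<le> poly P n" by (auto simp: pb_def)
  then have "tm_computes_in_time M f (poly P)"
    using M(2) unfolding tm_computes_in_time_def by (meson order_trans)
  with M(1) show ?thesis unfolding poly_time_computable_def by blast
qed


subsection \<open>Lists and booleans\<close>

text \<open>The underlying iteration makes \<open>sz (l x)\<close> rounds, at least as many as the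
  list has elements; surplus rounds find the list exhausted and change nothing. The state carries
  \<open>x\<close> along because \<open>f\<close> depends on it.\<close>

lemma PT_fold:
  fixes f :: "'x :: pdata \<Rightarrow> 'a :: pdata \<Rightarrow> 's :: pdata \<Rightarrow> 's"
  assumes f: "PT (\<lambda>p. f (fst p) (fst (snd p)) (snd (snd p)))" and l: "PT l" and s0: "PT s0"
    and "pb B" and bound: "\<And>x xs ys. l x = xs @ ys \<Longrightarrow> sz (fold (f x) xs (s0 x)) \<le> B (sz x)"
  shows "PT (\<lambda>x. fold (f x) (l x) (s0 x))"
proof -
  define step :: "'x \<times> 'a list \<times> 's \<Rightarrow> 'x \<times> 'a list \<times> 's" where
    "step p = (if fst (snd p) = [] then p
       else (fst p, tl (fst (snd p)), f (fst p) (hd (fst (snd p))) (snd (snd p))))" for p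
  have iter: "(step ^^ n) (x, xs, s) = (x, drop n xs, fold (f x) (take n xs) s)" for n x xs s
  proof (induction n arbitrary: xs s)
    case (Suc n)
    have "(step ^^ Suc n) (x, xs, s) = (step ^^ n) (step (x, xs, s))"
      by (simp add: funpow_swap1)
    moreover have "step (x, [], s) = (x, [], s)" "step (x, a # as, s) = (x, as, f x a s)" for a as
      by (simp_all add: step_def)
    ultimately show ?case using Suc by (cases xs) simp_all
  qed simp
  have "PT (\<lambda>p. f (fst p) (hd (fst (snd p))) (snd (snd p)) :: 's)"
    using PT_comp[OF f, of "\<lambda>p :: 'x \<times> 'a list \<times> 's. (fst p, hd (fst (snd p)), snd (snd p))"]
    by (simp add: PT_Pair PT_fst PT_snd PT_hd PT_id)
  then have step: "PT step"
    unfolding step_def[abs_def] by (intro PT_if PT_null PT_Pair PT_tl PT_fst PT_snd PT_id)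
  obtain r where r: "\<And>a. sz (l a) \<le> poly r (sz a)" using PT_size[OF l] by metis
  have "PT (\<lambda>x. (step ^^ sz (l x)) (x, l x, s0 x))"
  proof (rule PT_iter[OF step l])
    show "PT (\<lambda>x. (x, l x, s0 x))" by (intro PT_Pair PT_id l s0)
    show "pb (\<lambda>n. 2 * n + 2 * poly r n + B n + 2)" by (intro pb_intros \<open>pb B\<close>)
    fix x n
    have "sz (drop n (l x)) \<le> sz (l x)"
      by (metis append_take_drop_id le_add2 sz_append)
    moreover have "sz (fold (f x) (take n (l x)) (s0 x)) \<le> B (sz x)"
      by (rule bound[of _ _ "drop n (l x)"]) simp
    ultimately show "sz ((step ^^ n) (x, l x, s0 x)) \<le> 2 * sz x + 2 * poly r (sz x) + B (sz x) + 2"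
      using r[of x] by (simp add: iter)
  qed
  then have "PT (\<lambda>x. snd (snd ((step ^^ sz (l x)) (x, l x, s0 x))))" by (intro PT_snd)
  then show ?thesis by (simp add: iter length_le_sz)
qed

lemma PT_rev: "PT l \<Longrightarrow> PT (\<lambda>x. rev (l x))"
proof -
  assume l: "PT l"
  obtain r where r: "\<And>a. sz (l a) \<le> poly r (sz a)" using PT_size[OF l] by metis
  have "PT (\<lambda>x. fold (#) (l x) [])"
  proof (rule PT_fold[OF _ l PT_const pb_poly])
    show "sz (fold (#) xs []) \<le> poly r (sz x)" if "l x = xs @ ys" for x xs ys
      using r[of x] that by (simp add: fold_Cons_rev)
  qed (intro PT_Cons PT_fst PT_snd PT_id)
  then show ?thesis by (simp add: fold_Cons_rev)
qed

lemma PT_append: "PT l \<Longrightarrow> PT l' \<Longrightarrow> PT (\<lambda>x. l x @ l' x)"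
proof -
  assume l: "PT l" and l': "PT l'"
  obtain r where r: "\<And>a. sz (l a) \<le> poly r (sz a)" using PT_size[OF l] by metis
  obtain r' where r': "\<And>a. sz (l' a) \<le> poly r' (sz a)" using PT_size[OF l'] by metis
  have "PT (\<lambda>x. fold (#) (rev (l x)) (l' x))"
  proof (rule PT_fold[OF _ PT_rev[OF l] l'])
    show "pb (\<lambda>n. poly r n + poly r' n)" by (intro pb_intros)
    fix x xs ys assume "rev (l x) = xs @ ys"
    then have "sz xs \<le> sz (l x)" by (metis le_add1 sz_append sz_rev)
    then show "sz (fold (#) xs (l' x)) \<le> poly r (sz x) + poly r' (sz x)"
      using r[of x] r'[of x] by (simp add: fold_Cons_rev)
  qed (intro PT_Cons PT_fst PT_snd PT_id)
  then show ?thesis by (simp add: fold_Cons_rev)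
qed

lemma sz_list_bound: "(\<And>a. a \<in> set xs \<Longrightarrow> sz a \<le> m) \<Longrightarrow> sz xs \<le> length xs * (2 * m + 1)"
proof (induction xs)
  case (Cons a xs)
  have "sz xs \<le> length xs * (2 * m + 1)" using Cons by simp
  moreover have "sz a \<le> m" using Cons.prems by simp
  ultimately show ?case by simp
qed simp

lemma PT_concat_map:
  fixes f :: "'x :: pdata \<Rightarrow> 'a :: pdata \<Rightarrow> 'b :: pdata list"
  assumes f: "PT (\<lambda>p. f (fst p) (snd p))" and l: "PT l"
  shows "PT (\<lambda>x. concat (map (f x) (l x)))"
proof -
  obtain r where r: "\<And>a. sz (l a) \<le> poly r (sz a)" using PT_size[OF l] by metis
  obtain q where q: "\<And>p. sz (f (fst p) (snd p)) \<le> poly q (sz p)" using PT_size[OF f] by metis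
  have fold: "fold (\<lambda>a s. s @ f x a) xs s = s @ concat (map (f x) xs)" for x xs s
    by (induction xs arbitrary: s) auto
  have "PT (\<lambda>x. fold (\<lambda>a s. s @ f x a) (l x) [])"
  proof (rule PT_fold[OF _ l PT_const])
    show "PT (\<lambda>p :: 'x \<times> 'a \<times> 'b list. snd (snd p) @ f (fst p) (fst (snd p)))"
      using PT_comp[OF f, of "\<lambda>p :: 'x \<times> 'a \<times> 'b list. (fst p, fst (snd p))"]
      by (simp add: PT_append PT_Pair PT_fst PT_snd PT_id)
    show "pb (\<lambda>n. poly r n * poly q (2 * n + poly r n + 1))" by (intro pb_intros)
    fix x xs ys assume *: "l x = xs @ ys"
    let ?m = "poly q (2 * sz x + poly r (sz x) + 1)"
    have "sz (f x a) \<le> ?m" if "a \<in> set xs" for a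
    proof -
      have "sz a \<le> poly r (sz x)" using sz_mem[of a "l x"] * that r[of x] by auto
      then show ?thesis using q[of "(x, a)"] poly_nat_mono[of "sz (x, a)" "2 * sz x + poly r (sz x) + 1" q]
        by simp
    qed
    then have "sz (concat (map (f x) xs)) \<le> length xs * ?m"
      by (induction xs) (auto intro!: add_mono)
    also have "length xs \<le> poly r (sz x)"
      using length_le_sz[of "l x"] r[of x] * by simp
    finally show "sz (fold (\<lambda>a s. s @ f x a) xs []) \<le> poly r (sz x) * ?m"
      by (simp add: fold)
  qed
  then show ?thesis by (simp add: fold)
qed

lemma PT_map:
  assumes "PT (\<lambda>p. f (fst p) (snd p))" "PT l"
  shows "PT (\<lambda>x. map (f x) (l x))"
  using PT_concat_map[OF PT_Cons[OF assms(1) PT_const[of "[]"]] assms(2)] by simp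

lemma PT_filter:
  assumes "PT (\<lambda>p. P (fst p) (snd p))" "PT l"
  shows "PT (\<lambda>x. filter (P x) (l x))"
proof -
  have "PT (\<lambda>x. concat (map (\<lambda>a. if P x a then [a] else []) (l x)))"
    by (rule PT_concat_map[OF _ assms(2)]) (intro PT_if assms(1) PT_Cons PT_snd PT_id PT_const)
  moreover have "concat (map (\<lambda>a. if P x a then [a] else []) xs) = filter (P x) xs" for x xs
    by (induction xs) auto
  ultimately show ?thesis by simp
qed

lemma PT_not: "PT P \<Longrightarrow> PT (\<lambda>x. \<not> P x)"
proof -
  assume "PT P"
  then have "PT (\<lambda>x. if P x then False else True)" by (intro PT_if PT_const)
  moreover have "(\<lambda>x. if P x then False else True) = (\<lambda>x. \<not> P x)" by auto
  ultimately show ?thesis by simp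
qed

lemma PT_conj: "PT P \<Longrightarrow> PT Q \<Longrightarrow> PT (\<lambda>x. P x \<and> Q x)"
proof -
  assume "PT P" "PT Q"
  then have "PT (\<lambda>x. if P x then Q x else False)" by (intro PT_if PT_const)
  moreover have "(\<lambda>x. if P x then Q x else False) = (\<lambda>x. P x \<and> Q x)" by auto
  ultimately show ?thesis by simp
qed

lemma PT_disj: "PT P \<Longrightarrow> PT Q \<Longrightarrow> PT (\<lambda>x. P x \<or> Q x)"
  using PT_not[OF PT_conj[OF PT_not[of P] PT_not[of Q]]] by simp

lemma PT_imp: "PT P \<Longrightarrow> PT Q \<Longrightarrow> PT (\<lambda>x. P x \<longrightarrow> Q x)"
  unfolding imp_conv_disj by (intro PT_disj PT_not)

lemma PT_bex:
  assumes "PT (\<lambda>p. P (fst p) (snd p))" "PT l"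
  shows "PT (\<lambda>x. \<exists>a \<in> set (l x). P x a)"
  using PT_not[OF PT_null[OF PT_filter[OF assms]]] by (simp add: filter_empty_conv)

lemma PT_ball:
  assumes "PT (\<lambda>p. P (fst p) (snd p))" "PT l"
  shows "PT (\<lambda>x. \<forall>a \<in> set (l x). P x a)"
  using PT_null[OF PT_filter[OF PT_not[OF assms(1)] assms(2)]] by (simp add: filter_empty_conv)

lemma PT_eq_bool: "PT f \<Longrightarrow> PT g \<Longrightarrow> PT (\<lambda>x. f x = (g x :: bool))"
proof -
  assume "PT f" "PT g"
  then have "PT (\<lambda>x. if f x then g x else \<not> g x)" by (intro PT_if PT_not)
  moreover have "(\<lambda>x. if f x then g x else \<not> g x) = (\<lambda>x. f x = g x)" by auto
  ultimately show ?thesis by simp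
qed

lemma PT_eq_prod:
  fixes f g :: "'x :: pdata \<Rightarrow> 'a :: pdata \<times> 'b :: pdata"
  assumes "\<And>f g :: 'x \<Rightarrow> 'a. PT f \<Longrightarrow> PT g \<Longrightarrow> PT (\<lambda>x. f x = g x)"
    "\<And>f g :: 'x \<Rightarrow> 'b. PT f \<Longrightarrow> PT g \<Longrightarrow> PT (\<lambda>x. f x = g x)" "PT f" "PT g"
  shows "PT (\<lambda>x. f x = g x)"
  unfolding prod_eq_iff by (intro PT_conj assms PT_fst PT_snd)

lemma PT_eq_list:
  fixes f g :: "'x :: pdata \<Rightarrow> 'a :: pdata list"
  assumes eq: "PT (\<lambda>p :: 'a \<times> 'a. fst p = snd p)" and f: "PT f" and g: "PT g"
  shows "PT (\<lambda>x. f x = g x)"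
proof -
  define step :: "'a \<Rightarrow> bool \<times> 'a list \<Rightarrow> bool \<times> 'a list" where
    "step a s = (if snd s = [] then (False, []) else (fst s \<and> hd (snd s) = a, tl (snd s)))" for a s
  have res: "fst (fold step xs s) \<and> snd (fold step xs s) = [] \<longleftrightarrow> fst s \<and> xs = snd s" for xs s
  proof (induction xs arbitrary: s)
    case (Cons a xs)
    then show ?case by (cases "snd s") (auto simp: step_def)
  qed auto
  have suf: "sz (fold step xs s) \<le> sz s" for xs s
  proof (induction xs arbitrary: s)
    case (Cons a xs)
    have "sz (step a s) \<le> sz s"
      by (cases s; cases "snd s") (auto simp: step_def)
    then show ?case using Cons[of "step a s"] by simp
  qed simp
  obtain r where r: "\<And>a. sz (g a) \<le> poly r (sz a)" using PT_size[OF g] by metis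
  have "PT (\<lambda>x. fold step (f x) (True, g x))"
  proof (rule PT_fold[OF _ f])
    have "PT (\<lambda>p :: 'x \<times> 'a \<times> bool \<times> 'a list. hd (snd (snd (snd p))) = fst (snd p))"
      using PT_comp[OF eq, of "\<lambda>p :: 'x \<times> 'a \<times> bool \<times> 'a list. (hd (snd (snd (snd p))), fst (snd p))"]
      by (simp add: PT_Pair PT_hd PT_fst PT_snd PT_id)
    then show "PT (\<lambda>p :: 'x \<times> 'a \<times> bool \<times> 'a list. step (fst (snd p)) (snd (snd p)))"
      unfolding step_def by (intro PT_if PT_null PT_Pair PT_conj PT_tl PT_const PT_fst PT_snd PT_id)
    show "PT (\<lambda>x. (True, g x))" by (intro PT_Pair PT_const g)
    show "pb (\<lambda>n. poly r n + 3)" by (intro pb_intros)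
    show "sz (fold step xs (True, g x)) \<le> poly r (sz x) + 3" for x xs
      using suf[of xs "(True, g x)"] r[of x] by simp
  qed
  then have "PT (\<lambda>x. fst (fold step (f x) (True, g x)) \<and> snd (fold step (f x) (True, g x)) = [])"
    by (intro PT_conj PT_null PT_fst PT_snd)
  then show ?thesis by (simp add: res)
qed

lemma PT_eq_word: "PT f \<Longrightarrow> PT g \<Longrightarrow> PT (\<lambda>x. f x = (g x :: bool list))"
  by (rule PT_eq_list) (intro PT_eq_bool PT_fst PT_snd PT_id)

lemma PT_eq_lit: "PT f \<Longrightarrow> PT g \<Longrightarrow> PT (\<lambda>x. f x = (g x :: bool \<times> bool list))"
  by (rule PT_eq_prod) (auto intro: PT_eq_bool PT_eq_word)

lemma PT_mem_word: "PT a \<Longrightarrow> PT l \<Longrightarrow> PT (\<lambda>x. a x \<in> set (l x :: bool list list))"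
proof -
  assume a: "PT a" and l: "PT l"
  have "PT (\<lambda>x. \<exists>b \<in> set (l x). b = a x)"
    by (rule PT_bex[OF _ l]) (intro PT_eq_word PT_snd PT_id PT_comp[OF a] PT_fst)
  then show ?thesis by (simp add: Bex_def)
qed

lemma PT_mem_lit: "PT a \<Longrightarrow> PT l \<Longrightarrow> PT (\<lambda>x. a x \<in> set (l x :: (bool \<times> bool list) list))"
proof -
  assume a: "PT a" and l: "PT l"
  have "PT (\<lambda>x. \<exists>b \<in> set (l x). b = a x)"
    by (rule PT_bex[OF _ l]) (intro PT_eq_lit PT_snd PT_id PT_comp[OF a] PT_fst)
  then show ?thesis by (simp add: Bex_def)
qed

lemmas PT_intros = PT_id PT_const PT_fst PT_snd PT_Pair PT_Cons PT_hd PT_tl PT_null PT_if PT_append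
  PT_rev PT_concat_map PT_map PT_filter PT_not PT_conj PT_disj PT_imp PT_bex PT_ball PT_eq_word
  PT_eq_lit PT_mem_word PT_mem_lit PT_eq_bool


subsection \<open>Unary arithmetic\<close>

abbreviation un :: "nat \<Rightarrow> bool list" where
  "un n \<equiv> replicate n True"

text \<open>Horner's scheme in unary: multiplying by the length of \<open>l x\<close> means writing
  one copy for each of its elements.\<close>

lemma PT_un_poly:
  assumes "PT l"
  shows "PT (\<lambda>x. un (poly p (length (l x))))"
proof (induction p)
  case 0
  show ?case using PT_const[of "[] :: bool list"] by simp
next
  case (pCons a p)
  have "concat (map (\<lambda>_. un m) xs) = un (length xs * m)" for m and xs :: "'b list"
    by (induction xs) (auto simp: replicate_add)
  then have "un (poly (pCons a p) (length (l x))) =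
      un a @ concat (map (\<lambda>_. un (poly p (length (l x)))) (l x))" for x
    by (simp add: replicate_add)
  then show ?case
    by (simp only:) (intro PT_append PT_const PT_concat_map assms PT_comp[OF pCons.IH] PT_fst PT_id)
qed

definition idx :: "bool list \<Rightarrow> bool list list" where
  "idx w = map un [0..<length w]"

lemma PT_idx: "PT l \<Longrightarrow> PT (\<lambda>x. idx (l x))"
proof -
  assume l: "PT l"
  obtain r where r: "\<And>a. sz (l a) \<le> poly r (sz a)" using PT_size[OF l] by metis
  define step :: "bool \<Rightarrow> bool list \<times> bool list list \<Rightarrow> bool list \<times> bool list list" where
    "step b s = (True # fst s, fst s # snd s)" for b s
  have fold: "fold step w ([], []) = (un (length w), rev (idx w))" for w
    by (induction w rule: rev_induct) (simp_all add: step_def idx_def)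
  have "PT (\<lambda>x. fold step (l x) ([], []))"
  proof (rule PT_fold[OF _ l PT_const])
    show "PT (\<lambda>p :: 'a \<times> bool \<times> bool list \<times> bool list list. step (fst (snd p)) (snd (snd p)))"
      unfolding step_def by (intro PT_Pair PT_Cons PT_const PT_fst PT_snd PT_id)
    show "pb (\<lambda>n. 6 * poly r n + poly r n * (2 * (3 * poly r n) + 1) + 1)" by (intro pb_intros)
    fix x xs ys assume *: "l x = xs @ ys"
    have len: "length xs \<le> poly r (sz x)" using length_le_sz[of "l x"] r[of x] * by simp
    have "sz (idx xs) \<le> length (idx xs) * (2 * (3 * poly r (sz x)) + 1)"
      by (rule sz_list_bound) (use len in \<open>auto simp: idx_def sz_word\<close>)
    also have "\<dots> \<le> poly r (sz x) * (2 * (3 * poly r (sz x)) + 1)"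
      using len by (intro mult_le_mono1) (simp add: idx_def)
    finally show "sz (fold step xs ([], [])) \<le>
        6 * poly r (sz x) + poly r (sz x) * (2 * (3 * poly r (sz x)) + 1) + 1"
      using len by (simp add: fold sz_word)
  qed
  then have "PT (\<lambda>x. rev (snd (fold step (l x) ([], []))))" by (intro PT_rev PT_snd)
  then show ?thesis by (simp add: fold)
qed


subsection \<open>Encoders and parsers\<close>

lemma PT_enc_list:
  assumes "PT (\<lambda>a. e a)" "PT l"
  shows "PT (\<lambda>x. enc_list e (l x))"
  unfolding enc_list_def
  by (intro PT_append PT_concat_map PT_Cons PT_const PT_comp[OF assms(1)] PT_snd PT_id assms(2))

lemma PT_enc_word: "PT l \<Longrightarrow> PT (\<lambda>x. enc_word (l x))"
  unfolding enc_word_def by (intro PT_enc_list PT_Cons PT_const PT_id)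

text \<open>A parser returns the list of possible results, each with the unread rest of the input.\<close>

type_synonym 'a parser = "bool list \<Rightarrow> ('a \<times> bool list) list"

text \<open>An equivalence, so the parser finds every decomposition and no false one. Bounded
  quantifiers over its result list can then replace decoding, and malformed words are treated as the
  quantifier dictates.\<close>

definition parses :: "'a parser \<Rightarrow> ('a \<Rightarrow> bool list) \<Rightarrow> bool" where
  "parses p e \<longleftrightarrow> (\<forall>w x u. (x, u) \<in> set (p w) \<longleftrightarrow> w = e x @ u)"

definition p_bit :: "bool parser" where
  "p_bit w = (if w = [] then [] else [(hd w, tl w)])"

lemma PT_p_bit: "PT p_bit"
  unfolding p_bit_def[abs_def] by (intro PT_intros)

lemma parses_bit: "parses p_bit (\<lambda>b. [b])"
  by (auto simp: parses_def p_bit_def neq_Nil_conv)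

definition p_seq :: "'a parser \<Rightarrow> 'b parser \<Rightarrow> ('a \<times> 'b) parser" where
  "p_seq p q w = concat (map (\<lambda>r. map (\<lambda>r'. ((fst r, fst r'), snd r')) (q (snd r))) (p w))"

lemma PT_p_seq:
  assumes "PT p" "PT q"
  shows "PT (p_seq p q)"
  unfolding p_seq_def[abs_def]
  by (intro PT_concat_map PT_map PT_Pair PT_fst PT_snd PT_id PT_comp[OF assms(2)] assms(1))

lemma parses_seq:
  "parses p e \<Longrightarrow> parses q e' \<Longrightarrow> parses (p_seq p q) (\<lambda>x. e (fst x) @ e' (snd x))"
proof -
  assume p: "parses p e" and q: "parses q e'"
  show ?thesis unfolding parses_def
  proof (intro allI)
    fix w x u
    have "(x, u) \<in> set (p_seq p q w) \<longleftrightarrow> (\<exists>v. (fst x, v) \<in> set (p w) \<and> (snd x, u) \<in> set (q v))"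
      by (cases x) (force simp: p_seq_def)
    also have "\<dots> \<longleftrightarrow> w = (e (fst x) @ e' (snd x)) @ u"
      using p q by (simp add: parses_def)
    finally show "(x, u) \<in> set (p_seq p q w) \<longleftrightarrow> w = (e (fst x) @ e' (snd x)) @ u" .
  qed
qed

context
  fixes p :: "'a parser"
begin

text \<open>The state is a list with at most one triple: the elements read so far in reverse order,
  the unread rest, and whether the end marker has been seen. The empty list stands for
  failure.\<close>

definition p_step :: "('a list \<times> bool list \<times> bool) list \<Rightarrow> ('a list \<times> bool list \<times> bool) list" where
  "p_step s =
    (if s = [] then []
     else if snd (snd (hd s)) then s
     else if fst (snd (hd s)) = [] then []
     else if \<not> hd (fst (snd (hd s))) then [(fst (hd s), tl (fst (snd (hd s))), True)]
     else if p (tl (fst (snd (hd s)))) = [] then []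
     else [(fst (hd (p (tl (fst (snd (hd s)))))) # fst (hd s), snd (hd (p (tl (fst (snd (hd s)))))), False)])"

end

lemma p_step_simps:
  "p_step p [] = []"
  "p_step p [(acc, rest, True)] = [(acc, rest, True)]"
  "p_step p [(acc, [], False)] = []"
  "p_step p [(acc, False # r, False)] = [(acc, r, True)]"
  "p r = [] \<Longrightarrow> p_step p [(acc, True # r, False)] = []"
  "p r = (a, u) # ys \<Longrightarrow> p_step p [(acc, True # r, False)] = [(a # acc, u, False)]"
  by (simp_all add: p_step_def)

definition p_list :: "'a parser \<Rightarrow> 'a list parser" where
  "p_list p w =
    concat (map (\<lambda>s. if snd (snd s) then [(rev (fst s), fst (snd s))] else [])
      ((p_step p ^^ sz w) [([], w, False)]))"

text \<open>The last conjunct serves the running time: each element is a result of \<open>p\<close>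
  on a word no longer than \<open>w\<close>, so its size is bounded by the polynomial belonging to
  \<open>p\<close>.\<close>

lemma p_step_inv:
  assumes "parses p e"
  shows "(p_step p ^^ n) [([], w, False)] = [] \<or>
    (\<exists>acc rest d. (p_step p ^^ n) [([], w, False)] = [(acc, rest, d)] \<and> length acc \<le> n \<and>
       w = concat (map (\<lambda>x. True # e x) (rev acc)) @ (if d then [False] else []) @ rest \<and>
       (\<forall>a \<in> set acc. \<exists>w' u. length w' \<le> length w \<and> (a, u) \<in> set (p w')))"
proof -
  define N where "N = length w"
  define I where "I n acc rest d \<longleftrightarrow> length acc \<le> n \<and>
    w = concat (map (\<lambda>x. True # e x) (rev acc)) @ (if d then [False] else []) @ rest \<and>
    (\<forall>a \<in> set acc. \<exists>w' u. length w' \<le> N \<and> (a, u) \<in> set (p w'))" for n acc rest d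
  have "(p_step p ^^ n) [([], w, False)] = [] \<or>
    (\<exists>acc rest d. (p_step p ^^ n) [([], w, False)] = [(acc, rest, d)] \<and> I n acc rest d)"
  proof (induction n)
    case 0
    have "I 0 [] w False" by (simp add: I_def)
    then show ?case by auto
  next
    case (Suc n)
    show ?case
    proof (cases "(p_step p ^^ n) [([], w, False)] = []")
      case True
      then show ?thesis by (simp add: p_step_simps)
    next
      case False
      then obtain acc rest d where st: "(p_step p ^^ n) [([], w, False)] = [(acc, rest, d)]"
        and I: "I n acc rest d" using Suc by blast
      have st': "(p_step p ^^ Suc n) [([], w, False)] = p_step p [(acc, rest, d)]" using st by simp
      consider (fin) "d" | (fail) "\<not> d" "rest = []" | (stop) r where "\<not> d" "rest = False # r"
        | (none) r where "\<not> d" "rest = True # r" "p r = []"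
        | (some) r a u ys where "\<not> d" "rest = True # r" "p r = (a, u) # ys"
        by (cases rest; cases "hd rest"; cases "p (tl rest)") auto
      then show ?thesis
      proof cases
        case fin
        have "I (Suc n) acc rest d" using I by (auto simp: I_def)
        moreover have "p_step p [(acc, rest, d)] = [(acc, rest, d)]" using fin by (simp add: p_step_simps)
        ultimately show ?thesis unfolding st' by blast
      next
        case stop
        have "I (Suc n) acc r True" using I stop by (auto simp: I_def)
        moreover have "p_step p [(acc, rest, d)] = [(acc, r, True)]" using stop by (simp add: p_step_simps)
        ultimately show ?thesis unfolding st' by blast
      next
        case some
        then have au: "(a, u) \<in> set (p r)" by simp
        then have r: "r = e a @ u" using assms by (auto simp: parses_def)
        have "length r \<le> N" using I some by (simp add: I_def N_def)
        then have "\<exists>w' u. length w' \<le> N \<and> (a, u) \<in> set (p w')" using au by blast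
        moreover have "w = concat (map (\<lambda>x. True # e x) (rev (a # acc))) @ u"
          using I some r by (simp add: I_def)
        ultimately have "I (Suc n) (a # acc) u False" using I by (simp add: I_def)
        moreover have "p_step p [(acc, rest, d)] = [(a # acc, u, False)]" using some by (simp add: p_step_simps)
        ultimately show ?thesis unfolding st' by blast
      next
        case fail
        then show ?thesis unfolding st' by (simp add: p_step_simps)
      next
        case none
        then show ?thesis unfolding st' by (simp add: p_step_simps)
      qed
    qed
  qed
  then show ?thesis by (simp only: I_def N_def)
qed

text \<open>\<open>p_step\<close> follows only the head of the result list of \<open>p\<close>. For
  a prefix code all results on a given word coincide, so nothing is lost.\<close>

lemma parses_list:
  assumes p: "parses p e" and e: "prefix_code e"
  shows "parses (p_list p) (enc_list e)"
proof -
  have stay: "(p_step p ^^ n) [(a, u, True)] = [(a, u, True)]" for n a u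
    by (induction n) (simp_all add: p_step_simps)
  have run: "(p_step p ^^ Suc (length xs)) [(acc, enc_list e xs @ u, False)] = [(rev xs @ acc, u, True)]"
    for xs acc u
  proof (induction xs arbitrary: acc)
    case Nil
    then show ?case by (simp add: p_step_simps enc_list_def)
  next
    case (Cons x xs)
    let ?r = "e x @ enc_list e xs @ u"
    have "(x, enc_list e xs @ u) \<in> set (p ?r)" using p by (auto simp: parses_def)
    moreover have "hd (p ?r) \<in> set (p ?r)" using calculation by (intro hd_in_set) auto
    then have "?r = e (fst (hd (p ?r))) @ snd (hd (p ?r))"
      using p unfolding parses_def by (metis prod.collapse)
    then have "fst (hd (p ?r)) = x \<and> snd (hd (p ?r)) = enc_list e xs @ u"
      using prefix_codeD[OF e] by metis
    ultimately have "p_step p [(acc, enc_list e (x # xs) @ u, False)] = [(x # acc, enc_list e xs @ u, False)]"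
      by (auto simp: p_step_def enc_list_def)
    from funpow_Suc_eq[where f = "p_step p", OF this Cons.IH] show ?case by simp
  qed
  show ?thesis
    unfolding parses_def
  proof (intro allI iffI)
    fix w xs u assume "(xs, u) \<in> set (p_list p w)"
    then show "w = enc_list e xs @ u"
      using p_step_inv[OF p, of "sz w" w] by (auto simp: p_list_def enc_list_def split: if_splits)
  next
    fix w xs u assume w: "w = enc_list e xs @ u"
    have "Suc (length xs) \<le> length (enc_list e xs)"
      by (induction xs) (auto simp: enc_list_def)
    then have "Suc (length xs) \<le> sz w" by (simp add: sz_word w)
    then obtain m where m: "sz w = Suc (length xs) + m" using le_Suc_ex by blast
    have "(p_step p ^^ sz w) [([], w, False)] = [(rev xs, u, True)]"
      unfolding m by (rule funpow_add_eq[OF _ stay]) (use run[of xs "[]" u] in \<open>simp add: w\<close>)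
    then show "(xs, u) \<in> set (p_list p w)" by (simp add: p_list_def)
  qed
qed

lemma PT_p_list:
  assumes pt: "PT p" and p: "parses p e"
  shows "PT (p_list p)"
proof -
  obtain q where q: "\<And>w. sz (p w) \<le> poly q (sz w)" using PT_size[OF pt] by metis
  have step: "PT (p_step p)"
    unfolding p_step_def[abs_def] by (intro PT_intros PT_comp[OF pt])
  have "PT (\<lambda>w. (p_step p ^^ sz w) [([], w, False)])"
  proof (rule PT_iter[OF step PT_id])
    show "PT (\<lambda>w. [([] :: 'a list, w, False)])" by (intro PT_intros)
    show "pb (\<lambda>n. 4 * (n * (2 * poly q n + 1)) + 4 * n + 20)" by (intro pb_intros)
    fix w :: "bool list" and n assume n: "n \<le> sz w"
    from p_step_inv[OF p, of n w]
    show "sz ((p_step p ^^ n) [([], w, False)]) \<le> 4 * (sz w * (2 * poly q (sz w) + 1)) + 4 * sz w + 20"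
    proof (elim disjE exE conjE)
      fix acc rest d
      assume st: "(p_step p ^^ n) [([], w, False)] = [(acc, rest, d)]" and len: "length acc \<le> n"
        and w: "w = concat (map (\<lambda>x. True # e x) (rev acc)) @ (if d then [False] else []) @ rest"
        and el: "\<forall>a \<in> set acc. \<exists>w' u. length w' \<le> length w \<and> (a, u) \<in> set (p w')"
      have "sz acc \<le> length acc * (2 * poly q (sz w) + 1)"
      proof (rule sz_list_bound)
        fix a assume "a \<in> set acc"
        then obtain w' u where w': "length w' \<le> length w" "(a, u) \<in> set (p w')" using el by blast
        have "sz a \<le> sz (a, u)" by simp
        also have "\<dots> \<le> sz (p w')" using w'(2) by (rule sz_mem)
        also have "\<dots> \<le> poly q (sz w')" by (rule q)
        also have "\<dots> \<le> poly q (sz w)" by (rule poly_nat_mono) (simp add: sz_word w')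
        finally show "sz a \<le> poly q (sz w)" .
      qed
      also have "\<dots> \<le> sz w * (2 * poly q (sz w) + 1)" using len n by (intro mult_le_mono1) simp
      finally have "sz acc \<le> sz w * (2 * poly q (sz w) + 1)" .
      moreover have "sz rest \<le> sz w" unfolding w by simp
      ultimately show ?thesis unfolding st by simp
    qed simp
  qed
  then show ?thesis unfolding p_list_def[abs_def]
    by (intro PT_concat_map PT_if PT_Cons PT_Pair PT_rev PT_const PT_fst PT_snd PT_id)
qed


section \<open>Membership\<close>

subsection \<open>A criterion for membership in the third level\<close>

lemma parses_word: "parses (p_list p_bit) enc_word"
  unfolding enc_word_def by (rule parses_list[OF parses_bit]) (simp add: prefix_code_def)

lemma PT_p_word: "PT (p_list p_bit)"
  by (rule PT_p_list[OF PT_p_bit parses_bit])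

lemma enc_pair_inject: "enc_pair x y = enc_pair x' y' \<longleftrightarrow> x = x' \<and> y = y'"
  by (simp add: enc_pair_def prefix_codeD[OF prefix_code_enc_word])

lemma class_P_I:
  assumes "PT P" "\<And>x. x \<in> L \<longleftrightarrow> P x"
  shows "L \<in> class_P"
proof -
  have "PT (\<lambda>x. [P x])" by (intro PT_Cons PT_const assms(1))
  then show ?thesis using assms(2) by (simp add: class_P_def PT_imp_poly_time)
qed

text \<open>Stated for the complement, because it is the difference of world views that starts with
  an existential quantifier. A parser takes the nested pairs of the hierarchy apart, so that
  \<open>V\<close> sees the four words separately; one polynomial \<open>B\<close> serves all
  levels.\<close>

lemma Pi_P_3_I:
  fixes V :: "bool list \<times> bool list \<times> bool list \<times> bool list \<Rightarrow> bool" and B :: "nat poly"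
  assumes V: "PT V"
    and L: "\<And>x. x \<notin> L \<longleftrightarrow> (\<exists>y1. length y1 = poly B (length x) \<and>
      (\<forall>y2. length y2 = poly B (length (enc_pair x y1)) \<longrightarrow>
        (\<exists>y3. length y3 = poly B (length (enc_pair (enc_pair x y1) y2)) \<and> V (x, y1, y2, y3))))"
  shows "L \<in> Pi_P 3"
proof -
  define W where "W z \<longleftrightarrow> (\<exists>r1 \<in> set (p_list p_bit z). \<exists>r2 \<in> set (p_list p_bit (fst r1)).
    \<exists>r3 \<in> set (p_list p_bit (fst r2)). V (fst r3, snd r3, snd r2, snd r1))" for z
  have word: "r \<in> set (p_list p_bit w) \<longleftrightarrow> w = enc_pair (fst r) (snd r)" for r w
    using parses_word by (cases r) (simp add: parses_def enc_pair_def)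
  have W: "W (enc_pair (enc_pair (enc_pair x y1) y2) y3) \<longleftrightarrow> V (x, y1, y2, y3)" for x y1 y2 y3
    unfolding W_def Bex_def split_paired_Ex word by (simp add: enc_pair_inject)
  have "PT W" unfolding W_def[abs_def]
    by (intro PT_bex PT_comp[OF V] PT_comp[OF PT_p_word] PT_p_word PT_Pair PT_fst PT_snd PT_id)
  then have P: "{z. W z} \<in> class_P" by (rule class_P_I) simp
  define L2 where "L2 = {u. \<exists>y3. length y3 = poly B (length u) \<and> W (enc_pair u y3)}"
  define L1 where "L1 = {v. \<forall>y2. length y2 = poly B (length v) \<longrightarrow> enc_pair v y2 \<in> L2}"
  have "L2 \<in> Sigma_P 1"
    unfolding One_nat_def Sigma_P.simps
    by (rule CollectI, rule bexI[of _ "{z. W z}"], rule exI[of _ B])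
      (use P in \<open>auto simp: L2_def co_class_def intro!: class_P_I[OF PT_not[OF \<open>PT W\<close>]]\<close>)
  then have "- L1 \<in> Sigma_P 2"
    unfolding numeral_2_eq_2 Sigma_P.simps(2)[of "Suc 0"]
    by (intro CollectI bexI[of _ "- L2"] exI[of _ B]) (auto simp: L1_def co_class_def)
  then have "- L \<in> Sigma_P 3"
    unfolding numeral_3_eq_3 Sigma_P.simps(2)[of "Suc (Suc 0)"]
    by (intro CollectI bexI[of _ L1] exI[of _ B])
      (simp_all add: L L1_def L2_def co_class_def W numeral_2_eq_2)
  then show ?thesis by (simp add: Pi_P_def co_class_def)
qed


subsection \<open>Differing world views have short witnesses\<close>

text \<open>Avoids forming the reduct: negated body elements are decided by \<open>I\<close>, and
  the rest of the rule is evaluated in \<open>N\<close>.\<close>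

lemma lp_model_gl_reduct:
  "lp_model N (gl_reduct P I) \<longleftrightarrow>
    (\<forall>r \<in> P. (\<forall>e \<in> set (lp_body r). if is_neg e then nsat I e else nsat N e) \<longrightarrow>
       (\<exists>a \<in> set (lp_head r). a \<in> N))"
  unfolding lp_model_def gl_reduct_def by (force split: if_splits)

lemma lp_model_gl_reduct_self: "lp_model M (gl_reduct P M) \<longleftrightarrow> lp_model M P"
  unfolding lp_model_gl_reduct by (simp add: lp_model_def)

lemma answer_sets_iff:
  "M \<in> answer_sets A P \<longleftrightarrow>
    M \<subseteq> A \<and> lp_model M (gl_reduct P M) \<and> (\<forall>N. N \<subset> M \<longrightarrow> \<not> lp_model N (gl_reduct P M))"
  by (simp add: answer_sets_def lp_model_gl_reduct_self)

text \<open>The guess can be read off from the interpretations: it consists of the members of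
  \<open>E\<close> whose literal fails in at least one of them.\<close>

lemma compatible_unique:
  assumes "compatible E \<Phi> \<I>" "compatible E \<Psi> \<I>" "\<Phi> \<subseteq> E" "\<Psi> \<subseteq> E"
  shows "\<Phi> = \<Psi>"
proof -
  have "\<Phi> = {x \<in> E. \<exists>I \<in> \<I>. \<not> lit_sat I (elit_lit x)}" if "compatible E \<Phi> \<I>" "\<Phi> \<subseteq> E" for \<Phi>
  proof (intro set_eqI iffI)
    fix x assume "x \<in> \<Phi>"
    then show "x \<in> {x \<in> E. \<exists>I \<in> \<I>. \<not> lit_sat I (elit_lit x)}"
      using that by (cases x) (auto simp: compatible_def)
  next
    fix x assume "x \<in> {x \<in> E. \<exists>I \<in> \<I>. \<not> lit_sat I (elit_lit x)}"
    then show "x \<in> \<Phi>" using that by (cases x) (auto simp: compatible_def)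
  qed
  from this[OF assms(1,3)] this[OF assms(2,4)] show ?thesis by simp
qed

text \<open>By uniqueness of the guess, a world view obtained under \<Phi> from one program can come
  from the other only under the same \<Phi>. The two sets of world views can thus be compared guess
  by guess.\<close>

lemma cwvs_neq_iff:
  "cwvs (A, E, R) \<noteq> cwvs (A, E, R') \<longleftrightarrow>
    (\<exists>\<Phi> \<subseteq> E. (compatible E \<Phi> (answer_sets A (epistemic_reduct R \<Phi>)) \<or>
                compatible E \<Phi> (answer_sets A (epistemic_reduct R' \<Phi>))) \<and>
       answer_sets A (epistemic_reduct R \<Phi>) \<noteq> answer_sets A (epistemic_reduct R' \<Phi>))"
  (is "?l \<longleftrightarrow> ?r")
proof
  assume l: ?l
  show ?r
  proof (rule ccontr)
    assume "\<not> ?r"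
    then have "answer_sets A (epistemic_reduct R \<Phi>) = answer_sets A (epistemic_reduct R' \<Phi>)"
      if "\<Phi> \<subseteq> E" "compatible E \<Phi> (answer_sets A (epistemic_reduct R \<Phi>)) \<or>
                compatible E \<Phi> (answer_sets A (epistemic_reduct R' \<Phi>))" for \<Phi>
      using that by blast
    then have "M \<in> cwvs (A, E, R) \<longleftrightarrow> M \<in> cwvs (A, E, R')" for M
      unfolding cwvs.simps mem_Collect_eq by metis
    then show False using l by blast
  qed
next
  assume ?r
  then obtain \<Phi> where \<Phi>: "\<Phi> \<subseteq> E" "answer_sets A (epistemic_reduct R \<Phi>) \<noteq> answer_sets A (epistemic_reduct R' \<Phi>)"
    and c: "compatible E \<Phi> (answer_sets A (epistemic_reduct R \<Phi>)) \<or>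
      compatible E \<Phi> (answer_sets A (epistemic_reduct R' \<Phi>))" by blast
  have *: "M \<notin> cwvs (A, E, R2)" if "compatible E \<Phi> M" "M \<noteq> answer_sets A (epistemic_reduct R2 \<Phi>)" for M R2
    unfolding cwvs.simps mem_Collect_eq using that \<Phi>(1) compatible_unique by metis
  have **: "answer_sets A (epistemic_reduct R2 \<Phi>) \<in> cwvs (A, E, R2)"
    if "compatible E \<Phi> (answer_sets A (epistemic_reduct R2 \<Phi>))" for R2
    using that \<Phi>(1) by auto
  from c show ?l using *[of _ R] *[of _ R'] ** \<Phi>(2) by metis
qed

section \<open>Problem instances as data of polynomial-time functions\<close>

type_synonym wd = "bool list"
type_synonym lit = "bool \<times> wd"
type_synonym rl = "wd list \<times> lit list \<times> lit list \<times> lit list"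
type_synonym inst = "wd list \<times> lit list \<times> rl list \<times> rl list"

text \<open>Syntax is mirrored by products and lists, for which the closure properties of
  \<open>PT\<close> are available. One type \<open>lit\<close> represents both literals and
  epistemic literals, since \<open>ENot\<close> carries no further information.\<close>

definition lit_of :: "lit \<Rightarrow> wd literal" where
  "lit_of l = (if fst l then Pos (snd l) else Neg (snd l))"

definition elit_of :: "lit \<Rightarrow> wd elit" where
  "elit_of l = ENot (lit_of l)"

definition rule_of :: "rl \<Rightarrow> wd elp_rule" where
  "rule_of r = ERule (fst r) (map lit_of (fst (snd r))) (map elit_of (fst (snd (snd r))))
     (map elit_of (snd (snd (snd r))))"

lemma lit_of_inject [simp]: "lit_of l = lit_of l' \<longleftrightarrow> l = l'"
  by (auto simp: lit_of_def prod_eq_iff)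

lemma elit_of_inject [simp]: "elit_of l = elit_of l' \<longleftrightarrow> l = l'"
  by (simp add: elit_of_def)

lemma inj_lit_of: "inj lit_of" and inj_elit_of: "inj elit_of"
  by (auto intro: injI)

lemma surj_lit_of: "\<exists>l. x = lit_of l"
proof (cases x)
  case (Pos a)
  then show ?thesis by (intro exI[of _ "(True, a)"]) (simp add: lit_of_def)
next
  case (Neg a)
  then show ?thesis by (intro exI[of _ "(False, a)"]) (simp add: lit_of_def)
qed

lemma surj_elit_of: "\<exists>l. x = elit_of l"
  using surj_lit_of by (cases x) (auto simp: elit_of_def)

lemma surj_map: "(\<And>y. \<exists>x. y = f x) \<Longrightarrow> \<exists>xs. ys = map f xs"
  by (metis ex_map_conv)

lemma surj_rule_of: "\<exists>r. x = rule_of r"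
proof (cases x)
  case (ERule as ls xs ys)
  moreover obtain ls' xs' ys' where "ls = map lit_of ls'" "xs = map elit_of xs'" "ys = map elit_of ys'"
    using surj_map[of lit_of] surj_map[of elit_of] surj_lit_of surj_elit_of by metis
  ultimately show ?thesis by (intro exI[of _ "(as, ls', xs', ys')"]) (simp add: rule_of_def)
qed

lemma rule_of_inject [simp]: "rule_of r = rule_of r' \<longleftrightarrow> r = r'"
  by (auto simp: rule_of_def prod_eq_iff inj_map_eq_map[OF inj_lit_of] inj_map_eq_map[OF inj_elit_of])

definition e_lit :: "lit \<Rightarrow> bool list" where
  "e_lit l = [fst l] @ enc_word (snd l)"

lemma e_lit: "e_lit = (\<lambda>l. enc_lit (lit_of l))" "e_lit = (\<lambda>l. enc_elit (elit_of l))"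
  by (auto simp: e_lit_def lit_of_def elit_of_def fun_eq_iff)

definition e_rule :: "rl \<Rightarrow> bool list" where
  "e_rule r = enc_list enc_word (fst r) @ enc_list e_lit (fst (snd r)) @
     enc_list e_lit (fst (snd (snd r))) @ enc_list e_lit (snd (snd (snd r)))"

lemma enc_list_map: "enc_list e (map f xs) = enc_list (\<lambda>x. e (f x)) xs"
  by (simp add: enc_list_def comp_def)

lemma e_rule: "e_rule = (\<lambda>r. enc_rule (rule_of r))"
  by (simp add: fun_eq_iff e_rule_def rule_of_def enc_list_map e_lit[symmetric])

definition e_inst :: "inst \<Rightarrow> bool list" where
  "e_inst i = enc_list enc_word (fst i) @ enc_list e_lit (fst (snd i)) @
     enc_list e_rule (fst (snd (snd i))) @ enc_list e_rule (snd (snd (snd i)))"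

lemma e_inst:
  "e_inst (A, E, R1, R2) = enc_instance A (map elit_of E) (map rule_of R1) (map rule_of R2)"
  by (simp add: e_inst_def enc_instance_def enc_list_map e_rule e_lit(2))

lemma prefix_code_comp:
  assumes "prefix_code e" "inj f"
  shows "prefix_code (\<lambda>x. e (f x))"
  using assms unfolding prefix_code_def by (metis injD)

lemma prefix_code_e_lit: "prefix_code e_lit"
  unfolding e_lit(1) by (rule prefix_code_comp[OF prefix_code_enc_lit inj_lit_of])

lemma prefix_code_e_rule: "prefix_code e_rule"
  unfolding e_rule by (rule prefix_code_comp[OF prefix_code_enc_rule]) (auto intro: injI)

definition p_lit :: "lit parser" where
  "p_lit = p_seq p_bit (p_list p_bit)"

definition p_rule :: "rl parser" where
  "p_rule = p_seq (p_list (p_list p_bit)) (p_seq (p_list p_lit) (p_seq (p_list p_lit) (p_list p_lit)))"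

definition p_inst :: "inst parser" where
  "p_inst = p_seq (p_list (p_list p_bit)) (p_seq (p_list p_lit) (p_seq (p_list p_rule) (p_list p_rule)))"

lemma parses_lit: "parses p_lit e_lit"
  using parses_seq[OF parses_bit parses_word] by (simp add: p_lit_def e_lit_def[abs_def])

lemmas parses_words = parses_list[OF parses_word prefix_code_enc_word]
lemmas parses_lits = parses_list[OF parses_lit prefix_code_e_lit]

lemma parses_rule: "parses p_rule e_rule"
  using parses_seq[OF parses_words parses_seq[OF parses_lits parses_seq[OF parses_lits parses_lits]]]
  by (simp add: p_rule_def e_rule_def[abs_def])

lemmas parses_rules = parses_list[OF parses_rule prefix_code_e_rule]

lemma parses_inst: "parses p_inst e_inst"
  using parses_seq[OF parses_words parses_seq[OF parses_lits parses_seq[OF parses_rules parses_rules]]]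
  by (simp add: p_inst_def e_inst_def[abs_def])

lemmas PT_p_words = PT_p_list[OF PT_p_word parses_word]

lemma PT_p_lit: "PT p_lit"
  unfolding p_lit_def by (rule PT_p_seq[OF PT_p_bit PT_p_word])

lemmas PT_p_lits = PT_p_list[OF PT_p_lit parses_lit]

lemma PT_p_rule: "PT p_rule"
  unfolding p_rule_def by (intro PT_p_seq PT_p_words PT_p_lits)

lemma PT_p_inst: "PT p_inst"
  unfolding p_inst_def
  by (intro PT_p_seq PT_p_words PT_p_lits PT_p_list[OF PT_p_rule parses_rule])

lemma UNIFORM_iff:
  "x \<in> UNIFORM_CWV_EQUIVALENCE \<longleftrightarrow>
    (\<exists>A E R1 R2. x = e_inst (A, E, R1, R2) \<and>
       is_elp (set A, elit_of ` set E, rule_of ` set R1) \<and> is_elp (set A, elit_of ` set E, rule_of ` set R2) \<and>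
       uniformly_cwv_equivalent (set A, elit_of ` set E, rule_of ` set R1) (set A, elit_of ` set E, rule_of ` set R2))"
  (is "?l \<longleftrightarrow> ?r")
proof
  assume ?l
  then obtain A E R1 R2 where "x = enc_instance A E R1 R2"
    "is_elp (set A, set E, set R1)" "is_elp (set A, set E, set R2)"
    "uniformly_cwv_equivalent (set A, set E, set R1) (set A, set E, set R2)"
    unfolding UNIFORM_CWV_EQUIVALENCE_def by blast
  moreover obtain E' R1' R2' where "E = map elit_of E'" "R1 = map rule_of R1'" "R2 = map rule_of R2'"
    using surj_map[of elit_of] surj_map[of rule_of] surj_elit_of surj_rule_of by metis
  ultimately show ?r by (intro exI[of _ A] exI[of _ E'] exI[of _ R1'] exI[of _ R2']) (simp add: e_inst)
next
  assume ?r
  then show ?l unfolding UNIFORM_CWV_EQUIVALENCE_def e_inst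
    by (metis (mono_tags, lifting) CollectI list.set_map)
qed

text \<open>The criterion \<open>lp_model_gl_reduct\<close> spelled out for the epistemic reduct.
  What an epistemic literal reduces to is \<open>\<top>\<close> or starts with a negation, so it
  never depends on \<open>N\<close>; only positive objective literals do. The equation
  \<open>(snd l \<in> set I) = fst l\<close> says that \<open>l\<close> holds in
  \<open>I\<close>.\<close>

definition rule_ok :: "wd list \<Rightarrow> wd list \<Rightarrow> lit list \<Rightarrow> rl \<Rightarrow> bool" where
  "rule_ok N I \<Phi> r \<longleftrightarrow>
    (\<forall>l \<in> set (fst (snd r)). if fst l then snd l \<in> set N else snd l \<notin> set I) \<and>
    (\<forall>l \<in> set (fst (snd (snd r))). l \<in> set \<Phi> \<or> \<not> (snd l \<in> set I) = fst l) \<and>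
    (\<forall>l \<in> set (snd (snd (snd r))). l \<notin> set \<Phi> \<and> (snd l \<in> set I) = fst l) \<longrightarrow>
    (\<exists>a \<in> set (fst r). a \<in> set N)"

definition model_ok :: "rl list \<Rightarrow> wd list \<Rightarrow> lit list \<Rightarrow> wd list \<Rightarrow> wd list \<Rightarrow> bool" where
  "model_ok R D \<Phi> N I \<longleftrightarrow> (\<forall>r \<in> set R. rule_ok N I \<Phi> r) \<and> (\<forall>d \<in> set D. d \<in> set N)"

definition facts :: "'a set \<Rightarrow> 'a elp_rule set" where
  "facts D = (\<lambda>a. ERule [a] [] [] []) ` D"

lemma add_facts_eq: "add_facts (A, E, R) D = (A, E, R \<union> facts D)"
  by (simp add: facts_def)

lemma lit_sat_of: "lit_sat I (lit_of l) \<longleftrightarrow> (snd l \<in> I) = fst l"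
  by (auto simp: lit_sat_def lit_of_def)

lemma model_ok:
  "model_ok R D \<Phi> N I \<longleftrightarrow>
    lp_model (set N) (gl_reduct (epistemic_reduct (rule_of ` set R \<union> facts (set D)) (elit_of ` set \<Phi>)) (set I))"
proof -
  have lits: "(if is_neg (lit_nexp (lit_of l)) then nsat (set I) (lit_nexp (lit_of l)) else nsat (set N) (lit_nexp (lit_of l)))
      \<longleftrightarrow> (if fst l then snd l \<in> set N else snd l \<notin> set I)" for l
    by (auto simp: lit_of_def)
  have pos: "(if is_neg (elit_reduct (elit_of ` set \<Phi>) (elit_of l)) then nsat (set I) (elit_reduct (elit_of ` set \<Phi>) (elit_of l))
      else nsat (set N) (elit_reduct (elit_of ` set \<Phi>) (elit_of l))) \<longleftrightarrow> l \<in> set \<Phi> \<or> \<not> (snd l \<in> set I) = fst l" for l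
    by (auto simp: elit_reduct_def image_iff) (auto simp: elit_of_def lit_of_def split: if_splits)
  have neg: "nsat (set I) (NNeg (elit_reduct (elit_of ` set \<Phi>) (elit_of l))) \<longleftrightarrow>
      l \<notin> set \<Phi> \<and> (snd l \<in> set I) = fst l" for l
    by (auto simp: elit_reduct_def image_iff) (auto simp: elit_of_def lit_of_def split: if_splits)
  let ?\<Phi> = "elit_of ` set \<Phi>"
  have "((\<forall>e \<in> set (lp_body (rule_reduct ?\<Phi> (rule_of r))). if is_neg e then nsat (set I) e else nsat (set N) e)
      \<longrightarrow> (\<exists>a \<in> set (lp_head (rule_reduct ?\<Phi> (rule_of r))). a \<in> set N)) \<longleftrightarrow> rule_ok N I \<Phi> r" for r
    using neg by (simp add: rule_ok_def rule_reduct_def rule_of_def ball_Un lits pos)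
  moreover have "((\<forall>e \<in> set (lp_body (rule_reduct ?\<Phi> (ERule [d] [] [] []))). if is_neg e then nsat (set I) e else nsat (set N) e)
      \<longrightarrow> (\<exists>a \<in> set (lp_head (rule_reduct ?\<Phi> (ERule [d] [] [] []))). a \<in> set N)) \<longleftrightarrow> d \<in> set N" for d
    by (simp add: rule_reduct_def)
  ultimately show ?thesis
    unfolding lp_model_gl_reduct epistemic_reduct_def model_ok_def facts_def image_Un ball_Un
      image_image ball_simps
    by (simp only:)
qed


section \<open>Checking a witness of non-equivalence\<close>

definition sub :: "wd list \<Rightarrow> wd list \<Rightarrow> bool" where
  "sub X Y \<longleftrightarrow> (\<forall>a \<in> set X. a \<in> set Y)"

lemma sub_iff: "sub X Y \<longleftrightarrow> set X \<subseteq> set Y"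
  by (auto simp: sub_def)

definition candidate :: "wd list \<Rightarrow> rl list \<Rightarrow> wd list \<Rightarrow> lit list \<Rightarrow> wd list \<Rightarrow> bool" where
  "candidate A R D \<Phi> I \<longleftrightarrow> sub I A \<and> model_ok R D \<Phi> I I"

definition refutes :: "rl list \<Rightarrow> wd list \<Rightarrow> lit list \<Rightarrow> wd list \<Rightarrow> wd list \<Rightarrow> bool" where
  "refutes R D \<Phi> N I \<longleftrightarrow> sub N I \<and> \<not> sub I N \<and> model_ok R D \<Phi> N I"

text \<open>\<open>AS\<^sub>R\<close> is compatible with \<open>\<Phi>\<close>, where the finite list \<open>Is\<close> of answer sets witnesses the
  existential part, and \<open>J\<close> separates \<open>AS\<^sub>R\<^sub>a\<close> from \<open>AS\<^sub>R\<^sub>b\<close>. The sets \<open>N'\<close> and \<open>I\<close> are to be read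
  universally, the set \<open>N''\<close> existentially.\<close>

definition check :: "wd list \<Rightarrow> lit list \<Rightarrow> rl list \<Rightarrow> rl list \<Rightarrow> rl list \<Rightarrow> wd list \<Rightarrow> lit list \<Rightarrow>
    wd list list \<Rightarrow> wd list \<Rightarrow> wd list \<Rightarrow> wd list \<Rightarrow> wd list \<Rightarrow> wd list \<Rightarrow> bool" where
  "check A E R Ra Rb D \<Phi> Is J N N' I N'' \<longleftrightarrow>
    sub D A \<and> (\<forall>l \<in> set \<Phi>. l \<in> set E) \<and> \<not> Is = [] \<and>
    (\<forall>K \<in> set Is. candidate A R D \<Phi> K) \<and>
    (\<forall>l \<in> set \<Phi>. \<exists>K \<in> set Is. \<not> (snd l \<in> set K) = fst l) \<and>
    candidate A Ra D \<Phi> J \<and> (\<not> model_ok Rb D \<Phi> J J \<or> refutes Rb D \<Phi> N J) \<and>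
    (\<forall>K \<in> set Is. \<not> refutes R D \<Phi> N' K) \<and> \<not> refutes Ra D \<Phi> N' J \<and>
    (candidate A R D \<Phi> I \<longrightarrow>
       (\<forall>l \<in> set E. l \<in> set \<Phi> \<or> (snd l \<in> set I) = fst l) \<or> refutes R D \<Phi> N'' I)"

lemma PT_rule_ok:
  assumes "PT n" "PT i" "PT \<phi>" "PT r"
  shows "PT (\<lambda>x. rule_ok (n x) (i x) (\<phi> x) (r x))"
  unfolding rule_ok_def by (intro PT_intros assms PT_comp[OF assms(1)] PT_comp[OF assms(2)] PT_comp[OF assms(3)])

lemma PT_model_ok:
  assumes "PT R" "PT d" "PT \<phi>" "PT n" "PT i"
  shows "PT (\<lambda>x. model_ok (R x) (d x) (\<phi> x) (n x) (i x))"
  unfolding model_ok_def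
  by (intro PT_intros PT_rule_ok assms PT_comp[OF assms(3)] PT_comp[OF assms(4)] PT_comp[OF assms(5)])

lemma PT_sub:
  assumes "PT X" "PT Y"
  shows "PT (\<lambda>x. sub (X x) (Y x))"
  unfolding sub_def by (intro PT_intros assms PT_comp[OF assms(2)])

lemma PT_candidate:
  assumes "PT A" "PT R" "PT d" "PT \<phi>" "PT i"
  shows "PT (\<lambda>x. candidate (A x) (R x) (d x) (\<phi> x) (i x))"
  unfolding candidate_def by (intro PT_conj PT_sub PT_model_ok assms)

lemma PT_refutes:
  assumes "PT R" "PT d" "PT \<phi>" "PT n" "PT i"
  shows "PT (\<lambda>x. refutes (R x) (d x) (\<phi> x) (n x) (i x))"
  unfolding refutes_def by (intro PT_conj PT_not PT_sub PT_model_ok assms)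

lemma PT_check:
  assumes "PT A" "PT E" "PT R" "PT Ra" "PT Rb" "PT D" "PT \<Phi>" "PT Is" "PT J" "PT N" "PT N'" "PT I" "PT N''"
  shows "PT (\<lambda>x. check (A x) (E x) (R x) (Ra x) (Rb x) (D x) (\<Phi> x) (Is x) (J x) (N x) (N' x) (I x) (N'' x))"
  unfolding check_def
  by (intro PT_intros PT_sub PT_candidate PT_refutes PT_model_ok assms assms[THEN PT_comp])

lemma in_answer_sets_iff:
  "set I \<in> answer_sets (set A) (epistemic_reduct (rule_of ` set R \<union> facts (set D)) (elit_of ` set \<Phi>)) \<longleftrightarrow>
    candidate A R D \<Phi> I \<and> (\<forall>N. \<not> refutes R D \<Phi> N I)"
proof -
  have "(\<forall>N. N \<subset> set I \<longrightarrow> \<not> P N) \<longleftrightarrow> (\<forall>L. set L \<subset> set I \<longrightarrow> \<not> P (set L))" for P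
    by (metis finite_list finite_subset psubset_imp_subset finite_set)
  then show ?thesis
    by (auto simp: answer_sets_iff candidate_def refutes_def sub_iff model_ok psubset_eq)
qed

lemma refutes_cong: "set N = set N' \<Longrightarrow> refutes R D \<Phi> N I \<longleftrightarrow> refutes R D \<Phi> N' I"
  by (simp add: refutes_def sub_def model_ok_def rule_ok_def)

abbreviation "equivalent A E R1 R2 \<equiv> uniformly_cwv_equivalent
  (set A, elit_of ` set E, rule_of ` set R1) (set A, elit_of ` set E, rule_of ` set R2)"

context
  fixes A :: "wd list" and E :: "lit list" and R1 R2 :: "rl list"
begin

text \<open>Two bits in a certificate select the programs: \<open>s\<close> the one with the
  compatible collection, \<open>t\<close> the one that has an answer set the other lacks.\<close>

definition pick_rules :: "bool \<Rightarrow> rl list" where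
  "pick_rules s = (if s then R1 else R2)"

text \<open>Represents a set of atoms by a sublist of \<open>A\<close>, whose code is no longer than
  that of \<open>A\<close>. This keeps the witnesses short.\<close>

definition restr :: "wd set \<Rightarrow> wd list" where
  "restr X = filter (\<lambda>a. a \<in> X) A"

lemma set_restr: "X \<subseteq> set A \<Longrightarrow> set (restr X) = X"
  by (auto simp: restr_def)

abbreviation "sel \<Psi> \<equiv> filter (\<lambda>l. l \<in> \<Psi>) E"

abbreviation "as_sets s D \<Phi> \<equiv> answer_sets (set A)
  (epistemic_reduct (rule_of ` set (pick_rules s) \<union> facts (set D)) (elit_of ` set \<Phi>))"

lemma not_equivalent_iff:
  "\<not> equivalent A E R1 R2 \<longleftrightarrow>
    (\<exists>D \<subseteq> set A. \<exists>\<Psi> \<subseteq> set E. \<exists>s t. compatible (elit_of ` set E) (elit_of ` \<Psi>)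
        (as_sets s (restr D) (sel \<Psi>)) \<and>
      \<not> as_sets t (restr D) (sel \<Psi>) \<subseteq> as_sets (\<not> t) (restr D) (sel \<Psi>))"
proof -
  have E: "set (sel \<Psi>) = \<Psi>" if "\<Psi> \<subseteq> set E" for \<Psi> using that by auto
  have ss: "(\<exists>\<Phi> \<subseteq> elit_of ` set E. Q \<Phi>) \<longleftrightarrow> (\<exists>\<Psi> \<subseteq> set E. Q (elit_of ` \<Psi>))" for Q
    by (metis subset_image_iff)
  show ?thesis
    unfolding uniformly_cwv_equivalent_def fst_conv add_facts_eq not_all not_imp cwvs_neq_iff ss
    by (intro ex_cong1 conj_cong refl)
      (simp_all only: set_restr E pick_rules_def ex_bool_eq if_True if_False not_True_eq_False
        not_False_eq_True, blast)
qed

text \<open>Here \<open>N'\<close> and \<open>I\<close> are arbitrary lists, while the witnesses are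
  built from sublists of \<open>A\<close>; in \<open>witness_imp_not_equivalent\<close> it is the
  other way round. This matches length-bounded quantifiers: witnesses must be short, challenges may
  be any words, and the short challenges suffice for the converse.\<close>

lemma not_equivalent_witness:
  assumes "\<not> equivalent A E R1 R2"
  shows "\<exists>D \<Psi> Is J N s t. set Is \<subseteq> range restr \<and> length Is \<le> Suc (length E) \<and>
    (\<forall>N' I. \<exists>N''. check A E (pick_rules s) (pick_rules t) (pick_rules (\<not> t)) (restr D) (sel \<Psi>)
       Is (restr J) (restr N) N' I (restr N''))"
proof -
  obtain D \<Psi> s t where D: "D \<subseteq> set A" and \<Psi>: "\<Psi> \<subseteq> set E"
    and comp: "compatible (elit_of ` set E) (elit_of ` \<Psi>) (as_sets s (restr D) (sel \<Psi>))"
    and diff: "\<not> as_sets t (restr D) (sel \<Psi>) \<subseteq> as_sets (\<not> t) (restr D) (sel \<Psi>)"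
    using assms unfolding not_equivalent_iff by blast
  let ?\<Phi> = "sel \<Psi>"
  have set\<Phi>: "set ?\<Phi> = \<Psi>" using \<Psi> by auto
  have sub: "M \<subseteq> set A" if "M \<in> as_sets u (restr D) ?\<Phi>" for M u
    using that by (simp add: answer_sets_def)
  have AS: "candidate A (pick_rules u) (restr D) ?\<Phi> (restr M) \<and>
      (\<forall>N. \<not> refutes (pick_rules u) (restr D) ?\<Phi> N (restr M))" if "M \<in> as_sets u (restr D) ?\<Phi>" for M u
    using that in_answer_sets_iff[of "restr M" A "pick_rules u" "restr D" ?\<Phi>] set_restr[OF sub[OF that]] by simp
  have notAS: "\<exists>N. refutes (pick_rules u) (restr D) ?\<Phi> (restr N) I"
    if I: "set I \<notin> as_sets u (restr D) ?\<Phi>" and c: "candidate A (pick_rules u) (restr D) ?\<Phi> I" for u I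
  proof -
    obtain N where N: "refutes (pick_rules u) (restr D) ?\<Phi> N I" using I c in_answer_sets_iff by blast
    then have "set N \<subseteq> set A" using c by (auto simp: refutes_def candidate_def sub_iff)
    then show ?thesis using N refutes_cong[of N "restr (set N)"] set_restr by metis
  qed
  obtain J where J: "J \<in> as_sets t (restr D) ?\<Phi>" "J \<notin> as_sets (\<not> t) (restr D) ?\<Phi>" using diff by blast
  have Jr: "set (restr J) = J" using set_restr sub[OF J(1)] by blast
  have Jc: "candidate A (pick_rules t) (restr D) ?\<Phi> (restr J)" using AS[OF J(1)] by blast
  have "\<exists>N. \<not> model_ok (pick_rules (\<not> t)) (restr D) ?\<Phi> (restr J) (restr J) \<or>
      refutes (pick_rules (\<not> t)) (restr D) ?\<Phi> (restr N) (restr J)"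
    using notAS[of "restr J" "\<not> t"] J(2) Jc unfolding Jr candidate_def by blast
  then obtain N where N: "\<not> model_ok (pick_rules (\<not> t)) (restr D) ?\<Phi> (restr J) (restr J) \<or>
      refutes (pick_rules (\<not> t)) (restr D) ?\<Phi> (restr N) (restr J)" by blast
  obtain I0 where I0: "I0 \<in> as_sets s (restr D) ?\<Phi>" using comp by (auto simp: compatible_def)
  have "\<forall>l \<in> \<Psi>. \<exists>I. I \<in> as_sets s (restr D) ?\<Phi> \<and> \<not> lit_sat I (lit_of l)"
    using comp by (auto simp: compatible_def elit_of_def)
  then obtain W where W: "\<And>l. l \<in> \<Psi> \<Longrightarrow> W l \<in> as_sets s (restr D) ?\<Phi> \<and> \<not> lit_sat (W l) (lit_of l)" by metis
  \<comment> \<open>One answer set for nonemptiness and one for each epistemic literal in the guess,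
    hence at most \<open>Suc (length E)\<close> of them.\<close>
  define Is where "Is = restr I0 # map (\<lambda>l. restr (W l)) ?\<Phi>"
  have Is: "\<exists>K' \<in> as_sets s (restr D) ?\<Phi>. K = restr K'" if "K \<in> set Is" for K
    using that I0 W set\<Phi> by (auto simp: Is_def)
  have ex: "\<exists>K \<in> set Is. \<not> (snd l \<in> set K) = fst l" if "l \<in> \<Psi>" for l
  proof
    show "\<not> (snd l \<in> set (restr (W l))) = fst l"
      using W[OF that] set_restr[OF sub[of "W l" s]] by (simp add: lit_sat_of)
    show "restr (W l) \<in> set Is" using that \<Psi> by (auto simp: Is_def)
  qed
  have "\<exists>N''. check A E (pick_rules s) (pick_rules t) (pick_rules (\<not> t)) (restr D) ?\<Phi> Is (restr J) (restr N) N' I (restr N'')"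
    for N' I
  proof -
    have "\<exists>N''. candidate A (pick_rules s) (restr D) ?\<Phi> I \<longrightarrow>
       (\<forall>l \<in> set E. l \<in> set ?\<Phi> \<or> (snd l \<in> set I) = fst l) \<or>
       refutes (pick_rules s) (restr D) ?\<Phi> (restr N'') I"
    proof (cases "set I \<in> as_sets s (restr D) ?\<Phi>")
      case True
      have "(snd l \<in> set I) = fst l" if "l \<in> set E" "l \<notin> \<Psi>" for l
      proof -
        have "ENot (lit_of l) \<in> elit_of ` set E - elit_of ` \<Psi>"
          using that by (auto simp: elit_of_def)
        then have "lit_sat (set I) (lit_of l)" using comp True unfolding compatible_def by blast
        then show ?thesis by (simp add: lit_sat_of)
      qed
      then show ?thesis using set\<Phi> by blast
    next
      case False
      then show ?thesis using notAS by blast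
    qed
    then obtain N'' where "candidate A (pick_rules s) (restr D) ?\<Phi> I \<longrightarrow>
       (\<forall>l \<in> set E. l \<in> set ?\<Phi> \<or> (snd l \<in> set I) = fst l) \<or>
       refutes (pick_rules s) (restr D) ?\<Phi> (restr N'') I" by blast
    moreover have "candidate A (pick_rules s) (restr D) ?\<Phi> K" "\<not> refutes (pick_rules s) (restr D) ?\<Phi> N' K"
      if "K \<in> set Is" for K
      using Is[OF that] AS by blast+
    moreover have "Is \<noteq> []" by (simp add: Is_def)
    moreover have "\<forall>l \<in> set ?\<Phi>. l \<in> set E" by simp
    moreover have "sub (restr D) A" by (simp add: sub_iff restr_def)
    ultimately show ?thesis unfolding check_def using Jc N ex set\<Phi> AS[OF J(1)] by blast
  qed
  moreover have "set Is \<subseteq> range restr" by (auto simp: Is_def)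
  moreover have "length Is \<le> Suc (length E)" by (simp add: Is_def)
  ultimately show ?thesis by blast
qed

lemma witness_imp_not_equivalent:
  assumes "\<And>N' I. \<exists>N''. check A E (pick_rules s) (pick_rules t) (pick_rules (\<not> t)) D \<Phi> Is J N (restr N') (restr I) N''"
  shows "\<not> equivalent A E R1 R2"
proof -
  \<comment> \<open>Any instance of the universal sets yields the conjuncts of \<open>check\<close>
    that do not mention them.\<close>
  obtain N0 where c: "check A E (pick_rules s) (pick_rules t) (pick_rules (\<not> t)) D \<Phi> Is J N (restr {}) (restr {}) N0"
    using assms by blast
  have D: "set D \<subseteq> set A" and \<Phi>: "set \<Phi> \<subseteq> set E" using c by (auto simp: check_def sub_iff)
  have set\<Phi>: "set (filter (\<lambda>l. l \<in> set \<Phi>) E) = set \<Phi>" using \<Phi> by auto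
  have norm: "refutes R D \<Phi> N1 K \<Longrightarrow> set K \<subseteq> set A \<Longrightarrow> refutes R D \<Phi> (restr (set N1)) K" for R N1 K
  proof -
    assume r: "refutes R D \<Phi> N1 K" and "set K \<subseteq> set A"
    then have "set (restr (set N1)) = set N1" by (intro set_restr) (auto simp: refutes_def sub_iff)
    from refutes_cong[OF this] r show ?thesis by blast
  qed
  have inAS: "set K \<in> as_sets u D \<Phi>" if "candidate A (pick_rules u) D \<Phi> K"
    "\<And>N'. \<not> refutes (pick_rules u) D \<Phi> (restr N') K" for u K
    using that norm[of "pick_rules u" _ K] by (auto simp: in_answer_sets_iff candidate_def sub_iff)
  have Is: "set K \<in> as_sets s D \<Phi>" if "K \<in> set Is" for K
    by (rule inAS) (use that assms in \<open>unfold check_def, blast+\<close>)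
  have J: "set J \<in> as_sets t D \<Phi>"
    by (rule inAS) (use assms in \<open>unfold check_def, blast+\<close>)
  have J': "set J \<notin> as_sets (\<not> t) D \<Phi>"
    using c unfolding in_answer_sets_iff check_def candidate_def by blast
  have "compatible (elit_of ` set E) (elit_of ` set \<Phi>) (as_sets s D \<Phi>)"
    unfolding compatible_def
  proof (intro conjI allI impI ballI)
    have "Is \<noteq> []" using c unfolding check_def by blast
    then show "as_sets s D \<Phi> \<noteq> {}" using Is[OF hd_in_set] by blast
  next
    fix l assume "ENot l \<in> elit_of ` set \<Phi>"
    then obtain l' where l': "l = lit_of l'" "l' \<in> set \<Phi>" by (auto simp: elit_of_def)
    then obtain K where "K \<in> set Is" "\<not> (snd l' \<in> set K) = fst l'" using c unfolding check_def by blast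
    then show "\<exists>I \<in> as_sets s D \<Phi>. \<not> lit_sat I l" using Is l' lit_sat_of by blast
  next
    fix l M assume l: "ENot l \<in> elit_of ` set E - elit_of ` set \<Phi>" and M: "M \<in> as_sets s D \<Phi>"
    obtain l' where l': "l = lit_of l'" "l' \<in> set E" "l' \<notin> set \<Phi>" using l by (auto simp: elit_of_def)
    have "set (restr M) = M" using M by (intro set_restr) (simp add: answer_sets_def)
    then have "candidate A (pick_rules s) D \<Phi> (restr M)" "\<And>N. \<not> refutes (pick_rules s) D \<Phi> N (restr M)"
      using M in_answer_sets_iff[of "restr M" A "pick_rules s" D \<Phi>] by simp_all
    then have "(snd l' \<in> set (restr M)) = fst l'" using assms[of "{}" M] l'(2,3) unfolding check_def by blast
    then show "lit_sat M l" using \<open>set (restr M) = M\<close> l' by (simp add: lit_sat_of)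
  qed
  then show ?thesis unfolding not_equivalent_iff using D \<Phi> J J' set_restr[OF D] set\<Phi>
    by (intro exI[of _ "set D"] conjI exI[of _ "set \<Phi>"] exI[of _ s] exI[of _ t]) auto
qed

end

definition wf_rules :: "wd list \<Rightarrow> lit list \<Rightarrow> rl list \<Rightarrow> bool" where
  "wf_rules A E R \<longleftrightarrow> (\<forall>l \<in> set E. snd l \<in> set A) \<and>
    (\<forall>r \<in> set R. sub (fst r) A \<and> (\<forall>l \<in> set (fst (snd r)). snd l \<in> set A) \<and>
      (\<forall>l \<in> set (fst (snd (snd r))). l \<in> set E) \<and> (\<forall>l \<in> set (snd (snd (snd r))). l \<in> set E))"

lemma lit_atom_of [simp]: "lit_atom (lit_of l) = snd l"
  by (simp add: lit_of_def)

lemma wf_rules_iff: "wf_rules A E R \<longleftrightarrow> is_elp (set A, elit_of ` set E, rule_of ` set R)"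
proof -
  have "lit_atom (elit_lit (elit_of l)) = snd l" for l by (simp add: elit_of_def)
  moreover have "elit_of ` X \<subseteq> elit_of ` Y \<longleftrightarrow> (\<forall>l \<in> X. l \<in> Y)" for X Y
    by (auto simp: image_subset_iff)
  moreover have "lit_atom ` lit_of ` X \<subseteq> set A \<longleftrightarrow> (\<forall>l \<in> X. snd l \<in> set A)" for X
    by (auto simp: image_subset_iff)
  ultimately show ?thesis
    by (simp add: wf_rules_def rule_of_def sub_iff)
qed

section \<open>Certificates and the verifier\<close>

type_synonym cert = "wd list \<times> lit list \<times> wd list list \<times> wd list \<times> wd list \<times> bool \<times> bool"

abbreviation "p_words \<equiv> p_list (p_list p_bit)"

definition p_cert :: "cert parser" where
  "p_cert = p_seq p_words (p_seq (p_list p_lit) (p_seq (p_list p_words) (p_seq p_words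
     (p_seq p_words (p_seq p_bit p_bit)))))"

definition e_cert :: "cert \<Rightarrow> bool list" where
  "e_cert = (\<lambda>c. enc_list enc_word (fst c) @ enc_list e_lit (fst (snd c)) @
     enc_list (enc_list enc_word) (fst (snd (snd c))) @ enc_list enc_word (fst (snd (snd (snd c)))) @
     enc_list enc_word (fst (snd (snd (snd (snd c))))) @ [fst (snd (snd (snd (snd (snd c)))))] @
     [snd (snd (snd (snd (snd (snd c)))))])"

lemma prefix_code_seq:
  "prefix_code e \<Longrightarrow> prefix_code e' \<Longrightarrow> prefix_code (\<lambda>x. e (fst x) @ e' (snd x))"
  unfolding prefix_code_def by (metis append_assoc prod.expand)

lemma prefix_code_bit: "prefix_code (\<lambda>b. [b])"
  by (simp add: prefix_code_def)

lemmas prefix_code_words = prefix_code_enc_list[OF prefix_code_enc_word]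

lemma parses_cert: "parses p_cert e_cert"
  unfolding p_cert_def e_cert_def
  by (intro parses_seq parses_words parses_lits parses_list[OF parses_words prefix_code_words] parses_bit)

lemma PT_p_cert: "PT p_cert"
  unfolding p_cert_def
  by (intro PT_p_seq PT_p_words PT_p_lits PT_p_list[OF PT_p_words parses_words] PT_p_bit)

lemma prefix_code_e_cert: "prefix_code e_cert"
  unfolding e_cert_def
  by (intro prefix_code_seq prefix_code_bit prefix_code_words prefix_code_enc_list prefix_code_e_lit)

lemma prefix_code_e_inst: "prefix_code e_inst"
  unfolding e_inst_def[abs_def]
  by (intro prefix_code_seq prefix_code_words prefix_code_enc_list prefix_code_e_lit prefix_code_e_rule)

abbreviation "check_cert i c c' \<equiv>
  check (fst i) (fst (snd i)) (pick_rules (fst (snd (snd i))) (snd (snd (snd i))) (fst (snd (snd (snd (snd (snd c)))))))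
    (pick_rules (fst (snd (snd i))) (snd (snd (snd i))) (snd (snd (snd (snd (snd (snd c)))))))
    (pick_rules (fst (snd (snd i))) (snd (snd (snd i))) (\<not> snd (snd (snd (snd (snd (snd c)))))))
    (fst c) (fst (snd c)) (fst (snd (snd c))) (fst (snd (snd (snd c)))) (fst (snd (snd (snd (snd c)))))
    (fst c') (snd c')"

text \<open>The verifier decides the complement, so it accepts words that are no well-formed
  instance. \<open>p_inst\<close> must consume the whole word, whereas the rest left by the other
  parsers is padding up to the exact lengths that the hierarchy prescribes. The universal word is
  read under a universal quantifier over its parses, so malformed challenges are harmless.\<close>

definition verifier :: "bool list \<times> bool list \<times> bool list \<times> bool list \<Rightarrow> bool" where
  "verifier v \<longleftrightarrow> (\<forall>i \<in> set (p_inst (fst v)).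
     snd i = [] \<and> wf_rules (fst (fst i)) (fst (snd (fst i))) (fst (snd (snd (fst i)))) \<and>
       wf_rules (fst (fst i)) (fst (snd (fst i))) (snd (snd (snd (fst i)))) \<longrightarrow>
     (\<exists>c \<in> set (p_cert (fst (snd v))). \<forall>c' \<in> set (p_seq p_words p_words (fst (snd (snd v)))).
        \<exists>c'' \<in> set (p_words (snd (snd (snd v)))). check_cert (fst i) (fst c) (fst c') (fst c'')))"

lemma PT_wf_rules:
  assumes "PT A" "PT E" "PT R"
  shows "PT (\<lambda>x. wf_rules (A x) (E x) (R x))"
  unfolding wf_rules_def by (intro PT_intros PT_sub assms assms[THEN PT_comp])

lemma PT_verifier: "PT verifier"
  unfolding verifier_def[abs_def] pick_rules_def
  by (intro PT_ball PT_bex PT_imp PT_conj PT_null PT_wf_rules PT_check PT_if PT_not PT_fst PT_snd PT_id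
      PT_comp[OF PT_p_inst] PT_comp[OF PT_p_cert] PT_comp[OF PT_p_words]
      PT_comp[OF PT_p_seq[OF PT_p_words PT_p_words]])

lemma length_enc_list_filter: "length (enc_list e (filter P xs)) \<le> length (enc_list e xs)"
  by (induction xs) (auto simp: enc_list_def)

lemma length_enc_list_le:
  "(\<And>x. x \<in> set xs \<Longrightarrow> length (e x) \<le> m) \<Longrightarrow> length (enc_list e xs) \<le> length xs * Suc m + 1"
proof (induction xs)
  case (Cons x xs)
  have "length (enc_list e xs) \<le> length xs * Suc m + 1" using Cons by simp
  moreover have "length (e x) \<le> m" using Cons.prems by simp
  ultimately show ?case by (simp add: enc_list_def)
qed (simp add: enc_list_def)

lemma length_le_enc_list: "length xs \<le> length (enc_list e xs)"
  by (induction xs) (auto simp: enc_list_def)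

lemma ex_padding: "length (w :: bool list) \<le> n \<Longrightarrow> \<exists>u. length (w @ u) = n"
  by (rule exI[of _ "replicate (n - length w) False"]) simp

lemma not_in_UNIFORM_iff:
  "x \<notin> UNIFORM_CWV_EQUIVALENCE \<longleftrightarrow>
    (\<forall>A E R1 R2. x = e_inst (A, E, R1, R2) \<longrightarrow> wf_rules A E R1 \<longrightarrow> wf_rules A E R2 \<longrightarrow>
      \<not> equivalent A E R1 R2)"
  unfolding UNIFORM_iff wf_rules_iff by blast

theorem UNIFORM_in_Pi_P_3: "UNIFORM_CWV_EQUIVALENCE \<in> Pi_P 3"
proof (rule Pi_P_3_I[OF PT_verifier])
  \<comment> \<open>The quadratic term pays for \<open>Is\<close>, with up to
    \<open>length E + 1\<close> sets of atoms, each with a code no longer than the instance; all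
    other parts of a certificate are linear.\<close>
  define B :: "nat poly" where "B = [:20, 20, 1:]"
  have B: "poly B n = 20 + (20 + n) * n" for n by (simp add: B_def algebra_simps)
  have ver: "verifier (e_inst (A, E, R1, R2), v) \<longleftrightarrow> (wf_rules A E R1 \<and> wf_rules A E R2 \<longrightarrow>
     (\<exists>c \<in> set (p_cert (fst v)). \<forall>c' \<in> set (p_seq p_words p_words (fst (snd v))).
        \<exists>c'' \<in> set (p_words (snd (snd v))). check_cert (A, E, R1, R2) (fst c) (fst c') (fst c'')))" for A E R1 R2 v
  proof -
    have i: "i \<in> set (p_inst (e_inst (A, E, R1, R2))) \<and> snd i = [] \<longleftrightarrow> i = ((A, E, R1, R2), [])" for i
      using parses_inst prefix_codeD[OF prefix_code_e_inst, of "(A, E, R1, R2)" "[]" "fst i" "snd i"]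
      by (cases i) (auto simp: parses_def)
    have "(\<forall>i \<in> set (p_inst (e_inst (A, E, R1, R2))). snd i = [] \<and> P i \<longrightarrow> Q i) \<longleftrightarrow>
        (P ((A, E, R1, R2), []) \<longrightarrow> Q ((A, E, R1, R2), []))" (is "?a P Q \<longleftrightarrow> _") for P Q
    proof -
      have "?a P Q \<longleftrightarrow> (\<forall>i. (i \<in> set (p_inst (e_inst (A, E, R1, R2))) \<and> snd i = []) \<longrightarrow> P i \<longrightarrow> Q i)"
        by blast
      then show ?thesis unfolding i by simp
    qed
    then show ?thesis unfolding verifier_def by simp
  qed
  have novalid: "verifier (x, v)" if "\<nexists>i. x = e_inst i" for x v
  proof -
    have "snd i \<noteq> []" if "i \<in> set (p_inst x)" for i
      using that parses_inst \<open>\<nexists>i. x = e_inst i\<close> unfolding parses_def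
      by (metis append_Nil2 prod.collapse)
    then show ?thesis unfolding verifier_def by auto
  qed
  fix x
  show "x \<notin> UNIFORM_CWV_EQUIVALENCE \<longleftrightarrow> (\<exists>y1. length y1 = poly B (length x) \<and>
      (\<forall>y2. length y2 = poly B (length (enc_pair x y1)) \<longrightarrow>
        (\<exists>y3. length y3 = poly B (length (enc_pair (enc_pair x y1) y2)) \<and> verifier (x, y1, y2, y3))))"
  proof (cases "\<exists>A E R1 R2. x = e_inst (A, E, R1, R2) \<and> wf_rules A E R1 \<and> wf_rules A E R2")
    case False
    then have "verifier (x, v)" for v
      using novalid[of x v] ver by (metis prod_cases4)
    moreover have "x \<notin> UNIFORM_CWV_EQUIVALENCE" using False unfolding not_in_UNIFORM_iff by blast
    ultimately show ?thesis using ex_padding[of "[]"] by (metis append_Nil le0 list.size(3))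
  next
    case True
    then obtain A E R1 R2 where x: "x = e_inst (A, E, R1, R2)" and wf: "wf_rules A E R1" "wf_rules A E R2" by blast
    have "(A', E', R1', R2') = (A, E, R1, R2)" if "x = e_inst (A', E', R1', R2')" for A' E' R1' R2'
      using that prefix_codeD[OF prefix_code_e_inst, of _ "[]" _ "[]"] unfolding x by auto
    then have U: "x \<notin> UNIFORM_CWV_EQUIVALENCE \<longleftrightarrow> \<not> equivalent A E R1 R2"
      unfolding not_in_UNIFORM_iff using x wf by blast
    have ver': "verifier (x, y1, y2, y3) \<longleftrightarrow>
      (\<exists>c \<in> set (p_cert y1). \<forall>c' \<in> set (p_seq p_words p_words y2).
        \<exists>c'' \<in> set (p_words y3). check_cert (A, E, R1, R2) (fst c) (fst c') (fst c''))" for y1 y2 y3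
      unfolding x ver using wf by simp
    have lenA: "length (enc_list enc_word (restr A X)) \<le> length x" for X
      using length_enc_list_filter[of enc_word _ A] unfolding x restr_def e_inst_def
      by (rule order_trans) simp
    have lenE: "length (enc_list e_lit (filter P E)) \<le> length x" for P
      using length_enc_list_filter[of e_lit P E] unfolding x e_inst_def by (rule order_trans) simp
    have lenE': "length E \<le> length x"
      using length_le_enc_list[of E e_lit] unfolding x e_inst_def by (rule order_trans) simp
    have ge: "length x \<le> length (enc_pair x y)" for x y :: "bool list" by (simp add: enc_pair_def)
    have mono: "poly B m \<le> poly B n" if "m \<le> n" for m n using that by (rule poly_nat_mono)
    show ?thesis unfolding U
    proof
      assume "\<not> equivalent A E R1 R2"
      from not_equivalent_witness[OF this] obtain D \<Psi> Is J N s t where Is: "set Is \<subseteq> range (restr A)"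
          "length Is \<le> Suc (length E)" and
        chk: "\<And>N' I. \<exists>N''. check A E (pick_rules R1 R2 s) (pick_rules R1 R2 t) (pick_rules R1 R2 (\<not> t))
          (restr A D) (filter (\<lambda>l. l \<in> \<Psi>) E) Is (restr A J) (restr A N) N' I (restr A N'')" by blast
      define c where "c = (restr A D, filter (\<lambda>l. l \<in> \<Psi>) E, Is, restr A J, restr A N, s, t)"
      have "length (enc_list (enc_list enc_word) Is) \<le> length Is * Suc (length x) + 1"
        by (rule length_enc_list_le) (use Is(1) lenA in auto)
      also have "\<dots> \<le> Suc (length x) * Suc (length x) + 1"
        using Is(2) lenE' by (intro add_mono mult_le_mono1) auto
      finally have "length (e_cert c) \<le> poly B (length x)"
        using lenA[of D] lenA[of J] lenA[of N] lenE[of "\<lambda>l. l \<in> \<Psi>"]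
        by (simp add: e_cert_def c_def B algebra_simps)
      then obtain u where u: "length (e_cert c @ u) = poly B (length x)" using ex_padding by blast
      show "\<exists>y1. length y1 = poly B (length x) \<and>
        (\<forall>y2. length y2 = poly B (length (enc_pair x y1)) \<longrightarrow>
          (\<exists>y3. length y3 = poly B (length (enc_pair (enc_pair x y1) y2)) \<and> verifier (x, y1, y2, y3)))"
      proof (rule exI[of _ "e_cert c @ u"], intro conjI allI impI, rule u)
        fix y2 :: "bool list"
        let ?n = "poly B (length (enc_pair (enc_pair x (e_cert c @ u)) y2))"
        have cin: "(c, u) \<in> set (p_cert (e_cert c @ u))" using parses_cert unfolding parses_def by blast
        have n: "length x \<le> ?n"
          by (rule order_trans[OF order_trans[OF ge[of _ "e_cert c @ u"] ge[of _ y2]]]) (simp add: B algebra_simps)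
        \<comment> \<open>A challenge word has at most one parse, so a single \<open>N''\<close>
          answers all its parses.\<close>
        have uniq: "c' = c''" if "(c', v) \<in> set (p_seq p_words p_words y2)" "(c'', w) \<in> set (p_seq p_words p_words y2)" for c' c'' v w
          using that parses_seq[OF parses_words parses_words] prefix_codeD[OF prefix_code_seq[OF prefix_code_words prefix_code_words]]
          unfolding parses_def by metis
        show "\<exists>y3. length y3 = ?n \<and> verifier (x, e_cert c @ u, y2, y3)"
        proof (cases "p_seq p_words p_words y2 = []")
          case True
          then have "verifier (x, e_cert c @ u, y2, y3)" for y3
            unfolding ver' by (intro bexI[OF _ cin]) simp
          then show ?thesis using ex_padding[of "[]" ?n] by auto
        next
          case False
          then obtain c' v where c': "(c', v) \<in> set (p_seq p_words p_words y2)" by (cases "p_seq p_words p_words y2") auto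
          obtain N'' where N'': "check_cert (A, E, R1, R2) c c' (restr A N'')"
            using chk[of "fst c'" "snd c'"] by (auto simp: c_def)
          obtain w where w: "length (enc_list enc_word (restr A N'') @ w) = ?n"
            using ex_padding[OF order_trans[OF lenA n]] by blast
          have "(restr A N'', w) \<in> set (p_words (enc_list enc_word (restr A N'') @ w))"
            using parses_words by (simp add: parses_def)
          moreover have c'': "fst c'' = c'" if "c'' \<in> set (p_seq p_words p_words y2)" for c''
            using uniq[OF _ c', of "fst c''" "snd c''"] that by simp
          ultimately have "verifier (x, e_cert c @ u, y2, enc_list enc_word (restr A N'') @ w)"
            unfolding ver' using N''
            by (intro bexI[OF _ cin] ballI bexI[of _ "(restr A N'', w)"]) (simp_all only: c'' fst_conv)
          then show ?thesis using w by blast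
        qed
      qed
    next
      assume "\<exists>y1. length y1 = poly B (length x) \<and>
        (\<forall>y2. length y2 = poly B (length (enc_pair x y1)) \<longrightarrow>
          (\<exists>y3. length y3 = poly B (length (enc_pair (enc_pair x y1) y2)) \<and> verifier (x, y1, y2, y3)))"
      then obtain y1 where y1: "\<And>y2. length y2 = poly B (length (enc_pair x y1)) \<Longrightarrow> \<exists>y3. verifier (x, y1, y2, y3)"
        by blast
      \<comment> \<open>Acceptance for an arbitrary challenge already shows that \<open>y1\<close>
        contains a certificate.\<close>
      have "\<exists>y3. verifier (x, y1, replicate (poly B (length (enc_pair x y1))) False, y3)" by (rule y1) simp
      then obtain c u where cu: "(c, u) \<in> set (p_cert y1)" unfolding ver' by fastforce
      obtain D \<Phi> Is J N s t where c: "c = (D, \<Phi>, Is, J, N, s, t)" by (cases c)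
      have uniq: "c' = c" if "(c', v) \<in> set (p_cert y1)" for c' v
        using that cu parses_cert prefix_codeD[OF prefix_code_e_cert] unfolding parses_def by metis
      show "\<not> equivalent A E R1 R2"
      proof (rule witness_imp_not_equivalent)
        fix N' I
        let ?c' = "(restr A N', restr A I)"
        let ?e = "enc_list enc_word (restr A N') @ enc_list enc_word (restr A I)"
        have "2 * length x \<le> poly B (length x)" by (simp add: B algebra_simps)
        then have "length ?e \<le> poly B (length (enc_pair x y1))"
          using lenA[of N'] lenA[of I] mono[OF ge, of x y1] by simp
        then obtain v where v: "length (?e @ v) = poly B (length (enc_pair x y1))" using ex_padding by blast
        have "(?c', v) \<in> set (p_seq p_words p_words (?e @ v))"
          using parses_seq[OF parses_words parses_words] by (simp add: parses_def)
        moreover obtain y3 where "verifier (x, y1, ?e @ v, y3)" using y1[OF v] by blast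
        ultimately obtain c1 c'' where "c1 \<in> set (p_cert y1)" "check_cert (A, E, R1, R2) (fst c1) ?c' c''"
          unfolding ver' by fastforce
        then have "check_cert (A, E, R1, R2) c ?c' c''" using uniq by (metis prod.collapse)
        then show "\<exists>N''. check A E (pick_rules R1 R2 s) (pick_rules R1 R2 t) (pick_rules R1 R2 (\<not> t)) D \<Phi> Is J N
            (restr A N') (restr A I) N''" by (auto simp: c)
      qed
    qed
  qed
qed


section \<open>Hardness: from quantified Horn derivations to programs\<close>

text \<open>\<open>Aa i\<close>, \<open>Ba i\<close>, \<open>Ca i\<close> stand for the bits of the three quantified words, \<open>NB i\<close> and \<open>NC i\<close> for
  the complements of the latter two. \<open>St t q\<close>: the machine is in state \<open>q\<close> at time \<open>t\<close>. \<open>Ce t k j s\<close>: at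
  time \<open>t\<close>, tape \<open>k\<close> carries \<open>s\<close> in cell \<open>j\<close>, counted from a fixed distance left of the head.\<close>

datatype hatom = TT | WW | QQ | Aa nat | Ba nat | NB nat | Ca nat | NC nat
  | St nat nat | Ce nat nat nat nat

fun derivable_atom :: "hatom \<Rightarrow> bool" where
  "derivable_atom WW = True"
| "derivable_atom (St _ _) = True"
| "derivable_atom (Ce _ _ _ _) = True"
| "derivable_atom _ = False"

type_synonym 'a horn = "'a \<times> 'a literal list"

text \<open>The least model of the Horn rules over the facts \<open>F\<close>. Negative literals are
  read off a fixed set \<open>Y\<close>, as in a GL-reduct.\<close>

inductive_set der :: "'a horn set \<Rightarrow> 'a set \<Rightarrow> 'a set \<Rightarrow> 'a set" for H Y F where
  der_base: "x \<in> F \<Longrightarrow> x \<in> der H Y F"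
| der_rule: "(h, bd) \<in> H \<Longrightarrow> (\<And>x. Pos x \<in> set bd \<Longrightarrow> x \<in> der H Y F) \<Longrightarrow>
    (\<And>x. Neg x \<in> set bd \<Longrightarrow> x \<notin> Y) \<Longrightarrow> h \<in> der H Y F"

lemma der_least:
  assumes "F \<subseteq> N" "\<And>h bd. (h, bd) \<in> H \<Longrightarrow> (\<And>x. Pos x \<in> set bd \<Longrightarrow> x \<in> N) \<Longrightarrow>
    (\<And>x. Neg x \<in> set bd \<Longrightarrow> x \<notin> Y) \<Longrightarrow> h \<in> N"
  shows "der H Y F \<subseteq> N"
proof
  fix x assume "x \<in> der H Y F"
  then show "x \<in> N" by induction (use assms in auto)
qed

lemma der_cases: "x \<in> der H Y F \<Longrightarrow> x \<in> F \<or> x \<in> fst ` H"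
  by (induction rule: der.induct) force+

text \<open>Negation is limited to atoms that no Horn rule derives and that saturation leaves alone.
  The saturated answer sets and the plain runs below therefore agree with the assignment
  \<open>YY\<close> on all negative literals.\<close>

locale horn_program =
  fixes nm :: "hatom \<Rightarrow> 'a" and H :: "'a horn set" and n1 n2 n3 :: nat and A :: "'a set"
  assumes nm: "inj nm"
    and heads: "\<And>h bd. (h, bd) \<in> H \<Longrightarrow> \<exists>t. h = nm t \<and> derivable_atom t"
    and negs: "\<And>h bd x. (h, bd) \<in> H \<Longrightarrow> Neg x \<in> set bd \<Longrightarrow> x = nm TT \<or> (\<exists>i<n1. x = nm (Aa i))"
begin

definition choice_lits :: "'a set" where
  "choice_lits = (\<lambda>i. nm (Ba i)) ` {..<n2} \<union> (\<lambda>i. nm (NB i)) ` {..<n2}"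

definition saturated :: "'a set" where
  "saturated = fst ` H \<union> (\<lambda>i. nm (Ca i)) ` {..<n3} \<union> (\<lambda>i. nm (NC i)) ` {..<n3}"

definition R1 :: "'a elp_rule set" where
  "R1 = {ERule [nm TT] [] [] []}
    \<union> (\<lambda>i. ERule [nm (Ba i), nm (NB i)] [] [] []) ` {..<n2}
    \<union> (\<lambda>i. ERule [nm (Ca i), nm (NC i)] [] [] []) ` {..<n3}
    \<union> (\<lambda>(h, bd). ERule [h] bd [] []) ` H
    \<union> (\<lambda>z. ERule [z] [Pos (nm WW)] [] []) ` saturated
    \<union> (\<lambda>x. ERule [nm QQ] [] [] [ENot (Pos x)]) ` choice_lits"

definition R2 :: "'a elp_rule set" where
  "R2 = insert (ERule [nm QQ] [] [] [ENot (Neg (nm WW))]) R1"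

definition E0 :: "'a elit set" where
  "E0 = insert (ENot (Neg (nm WW))) ((\<lambda>x. ENot (Pos x)) ` choice_lits)"

definition YY :: "nat set \<Rightarrow> 'a set" where
  "YY y = insert (nm TT) ((\<lambda>i. nm (Aa i)) ` (y \<inter> {..<n1}))"

definition BB :: "nat set \<Rightarrow> 'a set" where
  "BB y = (\<lambda>i. nm (Ba i)) ` (y \<inter> {..<n2}) \<union> (\<lambda>i. nm (NB i)) ` ({..<n2} - y)"

definition CC :: "nat set \<Rightarrow> 'a set" where
  "CC y = (\<lambda>i. nm (Ca i)) ` (y \<inter> {..<n3}) \<union> (\<lambda>i. nm (NC i)) ` ({..<n3} - y)"

definition accepts :: "nat set \<Rightarrow> nat set \<Rightarrow> nat set \<Rightarrow> bool" where
  "accepts y1 y2 y3 \<longleftrightarrow> nm WW \<in> der H (YY y1) (YY y1 \<union> BB y2 \<union> CC y3)"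

text \<open>\<open>N\<close> as a model of the GL-reduct with respect to \<open>I\<close> of the
  epistemic reduct of \<open>R1\<close> with facts \<open>D\<close>, one conjunct for each group of
  rules.\<close>

definition mod1 :: "'a elit set \<Rightarrow> 'a set \<Rightarrow> 'a set \<Rightarrow> 'a set \<Rightarrow> bool" where
  "mod1 \<Phi> D I N \<longleftrightarrow> D \<subseteq> N \<and> nm TT \<in> N \<and> (\<forall>i<n2. nm (Ba i) \<in> N \<or> nm (NB i) \<in> N) \<and>
    (\<forall>i<n3. nm (Ca i) \<in> N \<or> nm (NC i) \<in> N) \<and>
    (\<forall>h bd. (h, bd) \<in> H \<longrightarrow> (\<forall>x. Pos x \<in> set bd \<longrightarrow> x \<in> N) \<longrightarrow> (\<forall>x. Neg x \<in> set bd \<longrightarrow> x \<notin> I) \<longrightarrow> h \<in> N) \<and>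
    (nm WW \<in> N \<longrightarrow> saturated \<subseteq> N) \<and>
    (\<forall>x \<in> choice_lits. ENot (Pos x) \<notin> \<Phi> \<longrightarrow> x \<in> I \<longrightarrow> nm QQ \<in> N)"

definition mod2 :: "'a elit set \<Rightarrow> 'a set \<Rightarrow> 'a set \<Rightarrow> 'a set \<Rightarrow> bool" where
  "mod2 \<Phi> D I N \<longleftrightarrow> mod1 \<Phi> D I N \<and>
    (ENot (Neg (nm WW)) \<notin> \<Phi> \<longrightarrow> nm WW \<notin> I \<longrightarrow> nm QQ \<in> N)"

lemma lits_iff:
  "(\<forall>e \<in> set (map lit_nexp bd). if is_neg e then nsat I e else nsat N e) \<longleftrightarrow>
    (\<forall>x. Pos x \<in> set bd \<longrightarrow> x \<in> N) \<and> (\<forall>x. Neg x \<in> set bd \<longrightarrow> x \<notin> I)"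
proof (induction bd)
  case (Cons l bd)
  then show ?case by (cases l) auto
qed simp

abbreviation "rule_sat \<Phi> I N r \<equiv>
  ((\<forall>e \<in> set (lp_body (rule_reduct \<Phi> r)). if is_neg e then nsat I e else nsat N e) \<longrightarrow>
     (\<exists>a \<in> set (lp_head (rule_reduct \<Phi> r)). a \<in> N))"

lemma rule_sat_simps:
  "rule_sat \<Phi> I N (ERule hs [] [] []) \<longleftrightarrow> (\<exists>a \<in> set hs. a \<in> N)"
  "rule_sat \<Phi> I N (ERule [h] bd [] []) \<longleftrightarrow>
    ((\<forall>x. Pos x \<in> set bd \<longrightarrow> x \<in> N) \<longrightarrow> (\<forall>x. Neg x \<in> set bd \<longrightarrow> x \<notin> I) \<longrightarrow> h \<in> N)"
  "rule_sat \<Phi> I N (ERule [q] [] [] [ENot (Pos x)]) \<longleftrightarrow> (ENot (Pos x) \<notin> \<Phi> \<longrightarrow> x \<in> I \<longrightarrow> q \<in> N)"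
  "rule_sat \<Phi> I N (ERule [q] [] [] [ENot (Neg x)]) \<longleftrightarrow> (ENot (Neg x) \<notin> \<Phi> \<longrightarrow> x \<notin> I \<longrightarrow> q \<in> N)"
proof -
  show "rule_sat \<Phi> I N (ERule [h] bd [] []) \<longleftrightarrow>
    ((\<forall>x. Pos x \<in> set bd \<longrightarrow> x \<in> N) \<longrightarrow> (\<forall>x. Neg x \<in> set bd \<longrightarrow> x \<notin> I) \<longrightarrow> h \<in> N)"
    using lits_iff[of bd I N] by (auto simp: rule_reduct_def)
qed (auto simp: rule_reduct_def elit_reduct_def)

lemma model_iff:
  "lp_model N (gl_reduct (epistemic_reduct R \<Phi>) I) \<longleftrightarrow> (\<forall>r \<in> R. rule_sat \<Phi> I N r)"
  by (simp add: lp_model_gl_reduct epistemic_reduct_def)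

lemma model_R1: "lp_model N (gl_reduct (epistemic_reduct (R1 \<union> facts D) \<Phi>) I) \<longleftrightarrow> mod1 \<Phi> D I N"
proof -
  have "(\<forall>r \<in> R1 \<union> facts D. rule_sat \<Phi> I N r) \<longleftrightarrow> mod1 \<Phi> D I N"
    unfolding R1_def facts_def ball_Un ball_simps rule_sat_simps mod1_def split_paired_Ball_Sigma
    by (auto simp: rule_sat_simps split_beta)
  then show ?thesis unfolding model_iff .
qed

lemma model_R2: "lp_model N (gl_reduct (epistemic_reduct (R2 \<union> facts D) \<Phi>) I) \<longleftrightarrow> mod2 \<Phi> D I N"
  unfolding mod2_def model_R1[symmetric] unfolding model_iff R2_def
  by (simp only: Un_insert_left ball_simps rule_sat_simps) blast

abbreviation "AS1 D \<Phi> \<equiv> answer_sets A (epistemic_reduct (R1 \<union> facts D) \<Phi>)"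
abbreviation "AS2 D \<Phi> \<equiv> answer_sets A (epistemic_reduct (R2 \<union> facts D) \<Phi>)"

lemma answer_sets_R1: "M \<in> AS1 D \<Phi> \<longleftrightarrow>
    M \<subseteq> A \<and> mod1 \<Phi> D M M \<and> (\<forall>N. N \<subset> M \<longrightarrow> \<not> mod1 \<Phi> D M N)"
  by (simp add: answer_sets_iff model_R1)

lemma answer_sets_R2: "M \<in> AS2 D \<Phi> \<longleftrightarrow>
    M \<subseteq> A \<and> mod2 \<Phi> D M M \<and> (\<forall>N. N \<subset> M \<longrightarrow> \<not> mod2 \<Phi> D M N)"
  by (simp add: answer_sets_iff model_R2)

lemma nm_eq [simp]: "nm x = nm y \<longleftrightarrow> x = y"
  using nm by (auto dest: injD)

lemma heads_not [simp]: "\<not> derivable_atom t \<Longrightarrow> nm t \<notin> fst ` H"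
  using heads by force

lemma der_not_head:
  assumes "\<not> derivable_atom t"
  shows "nm t \<in> der H Y F \<longleftrightarrow> nm t \<in> F"
  using der_cases[of "nm t" H Y F] heads_not[OF assms] der_base by metis

lemma saturated_iff:
  "nm t \<in> saturated \<longleftrightarrow> nm t \<in> fst ` H \<or> (\<exists>i<n3. t = Ca i \<or> t = NC i)"
  by (auto simp: saturated_def)

lemma BB_subset: "BB y \<subseteq> choice_lits"
  by (auto simp: BB_def choice_lits_def)

lemma choice_lits_iff: "nm t \<in> choice_lits \<longleftrightarrow> (\<exists>i<n2. t = Ba i \<or> t = NB i)"
  by (auto simp: choice_lits_def)

lemma saturated_not_choice: "x \<in> saturated \<Longrightarrow> x \<notin> choice_lits"
  by (auto simp: saturated_iff choice_lits_def)

lemma CC_subset: "CC y \<subseteq> saturated"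
  by (auto simp: CC_def saturated_def)

text \<open>\<open>M\<close> contains exactly one literal of each pair \<open>Ba i\<close>,
  \<open>NB i\<close>, so a smaller model has no freedom left in choosing
  \<open>y\<^sub>2\<close>.\<close>

lemma choice_subset:
  assumes "N \<subseteq> M" "\<forall>i<n2. nm (Ba i) \<in> N \<or> nm (NB i) \<in> N" "M \<inter> choice_lits = BB y"
  shows "BB y \<subseteq> N"
proof
  fix x assume x: "x \<in> BB y"
  then obtain i where i: "i < n2" "x = nm (Ba i) \<and> i \<in> y \<or> x = nm (NB i) \<and> i \<notin> y" by (auto simp: BB_def)
  then have "(if i \<in> y then nm (NB i) else nm (Ba i)) \<notin> BB y" by (auto simp: BB_def)
  moreover have "(if i \<in> y then nm (NB i) else nm (Ba i)) \<in> choice_lits" using i(1) by (simp add: choice_lits_iff)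
  ultimately have "(if i \<in> y then nm (NB i) else nm (Ba i)) \<notin> M" using assms(3) by blast
  then show "x \<in> N" using assms(1,2) i by (auto split: if_splits)
qed

text \<open>Facts can only make more of the Horn part derivable, so a set \<open>D\<close> without choice atoms behaves
  at least as well as the assignment it encodes.\<close>

lemma saturated_answer_set:
  assumes D: "D \<subseteq> A" "D \<inter> choice_lits = {}"
    and A: "nm TT \<in> A" "nm QQ \<in> A" "nm WW \<in> A" "choice_lits \<subseteq> A" "saturated \<subseteq> A"
    and acc: "\<And>y3. accepts {i. nm (Aa i) \<in> D} y2 y3"
  shows "\<exists>M. nm WW \<in> M \<and> M \<in> AS1 D \<Phi> \<and>
    M \<in> AS2 D \<Phi>"
proof -
  define M0 where "M0 = D \<union> {nm TT, nm WW} \<union> BB y2 \<union> saturated"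
  \<comment> \<open>\<open>q\<close> is added if one of the rules for a choice literal fires on
    \<open>M0\<close>. Since \<open>q\<close> is no choice literal itself, no further such rule is
    triggered.\<close>
  define M where "M = M0 \<union> (if \<exists>x \<in> choice_lits. ENot (Pos x) \<notin> \<Phi> \<and> x \<in> M0 then {nm QQ} else {})"
  let ?Y = "YY {i. nm (Aa i) \<in> D}"
  have x_M: "x \<in> M \<longleftrightarrow> x \<in> M0" if "x \<in> choice_lits" for x
    using that by (auto simp: M_def choice_lits_iff split: if_splits)
  have "nm TT \<notin> choice_lits" "nm WW \<notin> choice_lits" by (simp_all add: choice_lits_iff)
  then have "M0 \<inter> choice_lits = BB y2" using D(2) BB_subset saturated_not_choice unfolding M0_def by blast
  then have choice: "M \<inter> choice_lits = BB y2" using x_M by blast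
  have "M0 \<subseteq> A" using D(1) A BB_subset unfolding M0_def by blast
  then have MA: "M \<subseteq> A" using A(2) by (simp add: M_def)
  have satM: "saturated \<subseteq> M" and WM: "nm WW \<in> M" by (auto simp: M_def M0_def)
  have Neg: "x \<in> M \<longleftrightarrow> x \<in> ?Y" if "(h, bd) \<in> H" "Neg x \<in> set bd" for h bd x
    using negs[OF that] by (auto simp: M_def M0_def YY_def BB_def saturated_iff)
  have mod: "mod1 \<Phi> D M M"
    unfolding mod1_def
  proof (intro conjI allI impI ballI)
    show "D \<subseteq> M" "nm TT \<in> M" by (auto simp: M_def M0_def)
    show "nm (Ba i) \<in> M \<or> nm (NB i) \<in> M" if "i < n2" for i
      using that by (auto simp: M_def M0_def BB_def)
    show "nm (Ca i) \<in> M \<or> nm (NC i) \<in> M" if "i < n3" for i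
      using that satM by (auto simp: saturated_def)
    show "h \<in> M" if "(h, bd) \<in> H" for h bd
      using that satM by (force simp: saturated_def)
    show "nm QQ \<in> M" if "x \<in> choice_lits" "ENot (Pos x) \<notin> \<Phi>" "x \<in> M" for x
      using that x_M unfolding M_def by auto
  qed (use satM in auto)
  have min: "\<not> mod1 \<Phi> D M N" if "N \<subset> M" for N
  proof
    assume m: "mod1 \<Phi> D M N"
    have BN: "BB y2 \<subseteq> N" using choice_subset[OF _ _ choice] m that by (auto simp: mod1_def)
    have QN: "nm QQ \<in> N" if "x \<in> choice_lits" "ENot (Pos x) \<notin> \<Phi>" "x \<in> M0" for x
      using m that x_M unfolding mod1_def by blast
    have "M \<subseteq> N" if "nm WW \<in> N"
      using that m BN QN by (auto simp: mod1_def M_def M0_def split: if_splits)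
    then have W: "nm WW \<notin> N" using that by blast
    \<comment> \<open>Without \<open>w\<close>, the submodel still contains a literal for every bit
      of the third word. The derivation that accepts \<open>y2\<close> together with these bits
      stays inside it and produces \<open>w\<close> after all.\<close>
    let ?y3 = "{i. nm (Ca i) \<in> N}"
    have "der H ?Y (?Y \<union> BB y2 \<union> CC ?y3) \<subseteq> N"
    proof (rule der_least)
      show "?Y \<union> BB y2 \<union> CC ?y3 \<subseteq> N" using m BN by (auto simp: mod1_def YY_def CC_def)
      show "h \<in> N" if "(h, bd) \<in> H" "\<And>x. Pos x \<in> set bd \<Longrightarrow> x \<in> N" "\<And>x. Neg x \<in> set bd \<Longrightarrow> x \<notin> ?Y" for h bd
        using m that Neg[OF that(1)] unfolding mod1_def by blast
    qed
    then show False using acc[of ?y3] W unfolding accepts_def by blast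
  qed
  have "mod2 \<Phi> D M N \<longleftrightarrow> mod1 \<Phi> D M N" for N using WM by (simp add: mod2_def)
  then show ?thesis using mod min MA WM by (auto simp: answer_sets_R1 answer_sets_R2)
qed

text \<open>A rejecting \<open>y3\<close> leaves saturation idle: the Horn closure of the three
  words is then a model, and minimal because it has exactly one literal per guessed bit. As \<Phi>
  contains all \<open>not b\<close>, no rule for \<open>q\<close> fires.\<close>

lemma run_answer_set:
  assumes A: "nm TT \<in> A" "choice_lits \<subseteq> A" "saturated \<subseteq> A" "\<And>i. i < n1 \<Longrightarrow> nm (Aa i) \<in> A"
    and \<Phi>: "(\<lambda>x. ENot (Pos x)) ` choice_lits \<subseteq> \<Phi>" and rej: "\<not> accepts y1 y2 y3"
  shows "der H (YY y1) (YY y1 \<union> BB y2 \<union> CC y3) \<in> AS1 (YY y1) \<Phi>"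
proof -
  let ?F = "YY y1 \<union> BB y2 \<union> CC y3"
  define M where "M = der H (YY y1) ?F"
  have FM: "?F \<subseteq> M" unfolding M_def by (auto intro: der_base)
  have WM: "nm WW \<notin> M" using rej by (simp add: accepts_def M_def)
  have "M \<subseteq> ?F \<union> fst ` H" unfolding M_def by (auto dest: der_cases)
  moreover have "YY y1 \<subseteq> A" using A(1,4) by (auto simp: YY_def)
  moreover have "fst ` H \<subseteq> A" using A(3) by (simp add: saturated_def)
  moreover note subset_trans[OF BB_subset[of y2] A(2)] subset_trans[OF CC_subset[of y3] A(3)]
  ultimately have MA: "M \<subseteq> A" by blast
  have Neg: "x \<in> M \<longleftrightarrow> x \<in> YY y1" if "(h, bd) \<in> H" "Neg x \<in> set bd" for h bd x
    using negs[OF that] by (auto simp: M_def der_not_head YY_def BB_def CC_def)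
  have choice: "M \<inter> choice_lits = BB y2"
    by (auto simp: M_def der_not_head YY_def BB_def CC_def choice_lits_def)
  have "mod1 \<Phi> (YY y1) M M"
    unfolding mod1_def
  proof (intro conjI allI impI ballI)
    show "YY y1 \<subseteq> M" "nm TT \<in> M" using FM by (auto simp: YY_def)
    show "nm (Ba i) \<in> M \<or> nm (NB i) \<in> M" if "i < n2" for i
      using that FM by (cases "i \<in> y2") (auto simp: BB_def)
    show "nm (Ca i) \<in> M \<or> nm (NC i) \<in> M" if "i < n3" for i
      using that FM by (cases "i \<in> y3") (auto simp: CC_def)
    show "h \<in> M" if "(h, bd) \<in> H" "\<forall>x. Pos x \<in> set bd \<longrightarrow> x \<in> M" "\<forall>x. Neg x \<in> set bd \<longrightarrow> x \<notin> M" for h bd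
      unfolding M_def using that Neg[OF that(1)] by (intro der_rule[OF that(1)]) (auto simp: M_def)
    show "saturated \<subseteq> M" if "nm WW \<in> M" using that WM by blast
    show "nm QQ \<in> M" if "x \<in> choice_lits" "ENot (Pos x) \<notin> \<Phi>" for x using that \<Phi> by blast
  qed
  moreover have "\<not> mod1 \<Phi> (YY y1) M N" if "N \<subset> M" for N
  proof
    assume m: "mod1 \<Phi> (YY y1) M N"
    have BN: "BB y2 \<subseteq> N" using choice_subset[OF _ _ choice] m that by (auto simp: mod1_def)
    have "CC y3 \<subseteq> N"
    proof
      fix x assume "x \<in> CC y3"
      then obtain i where i: "i < n3" "x = nm (Ca i) \<and> i \<in> y3 \<or> x = nm (NC i) \<and> i \<notin> y3" by (auto simp: CC_def)
      then have "(if i \<in> y3 then nm (NC i) else nm (Ca i)) \<notin> M"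
        by (auto simp: M_def der_not_head YY_def BB_def CC_def)
      then show "x \<in> N" using m that i by (auto simp: mod1_def split: if_splits)
    qed
    then have "M \<subseteq> N"
      unfolding M_def
    proof (intro der_least)
      show "h \<in> N" if "(h, bd) \<in> H" "\<And>x. Pos x \<in> set bd \<Longrightarrow> x \<in> N" "\<And>x. Neg x \<in> set bd \<Longrightarrow> x \<notin> YY y1" for h bd
        using m that Neg[OF that(1)] unfolding mod1_def by blast
    qed (use m BN in \<open>auto simp: mod1_def\<close>)
    then show False using that by blast
  qed
  ultimately show ?thesis using MA unfolding answer_sets_R1 M_def[symmetric] by blast
qed

theorem uniform_iff_quantified:
  assumes A: "nm TT \<in> A" "nm QQ \<in> A" "nm WW \<in> A" "choice_lits \<subseteq> A" "saturated \<subseteq> A"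
    "\<And>i. i < n1 \<Longrightarrow> nm (Aa i) \<in> A"
  shows "uniformly_cwv_equivalent (A, E0, R1) (A, E0, R2) \<longleftrightarrow> (\<forall>y1. \<exists>y2. \<forall>y3. accepts y1 y2 y3)"
proof
  assume ev: "\<forall>y1. \<exists>y2. \<forall>y3. accepts y1 y2 y3"
  show "uniformly_cwv_equivalent (A, E0, R1) (A, E0, R2)"
    unfolding uniformly_cwv_equivalent_def fst_conv add_facts_eq
  proof (intro allI impI, rule ccontr)
    fix D assume D: "D \<subseteq> A" and "cwvs (A, E0, R1 \<union> facts D) \<noteq> cwvs (A, E0, R2 \<union> facts D)"
    then obtain \<Phi> R where \<Phi>: "\<Phi> \<subseteq> E0" and R: "R = R1 \<or> R = R2"
      and comp: "compatible E0 \<Phi> (answer_sets A (epistemic_reduct (R \<union> facts D) \<Phi>))"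
      and neq: "AS1 D \<Phi> \<noteq> AS2 D \<Phi>"
      unfolding cwvs_neq_iff by blast
    have DM: "D \<subseteq> M" if "M \<in> answer_sets A (epistemic_reduct (R \<union> facts D) \<Phi>)" for M
      using that R unfolding answer_sets_R1 answer_sets_R2 mod1_def mod2_def
      by (auto simp: answer_sets_R1 answer_sets_R2 mod1_def mod2_def)
    \<comment> \<open>Without choice literals in \<open>D\<close>, a saturated answer set forces
      \<open>not \<not>w\<close> into \<Phi> and disables the extra rule. Otherwise a choice literal
      in \<open>D\<close> makes \<open>q\<close> true anyway.\<close>
    have "mod2 \<Phi> D M N \<longleftrightarrow> mod1 \<Phi> D M N" if "D \<subseteq> M" for M N
    proof (cases "D \<inter> choice_lits = {}")
      case True
      obtain y2 where "\<And>y3. accepts {i. nm (Aa i) \<in> D} y2 y3" using ev by blast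
      from saturated_answer_set[OF D True A(1-5) this] obtain M' where
        "nm WW \<in> M'" "M' \<in> answer_sets A (epistemic_reduct (R \<union> facts D) \<Phi>)" using R by blast
      then have "ENot (Neg (nm WW)) \<in> \<Phi>"
        using comp by (auto simp: compatible_def E0_def lit_sat_def)
      then show ?thesis by (simp add: mod2_def)
    next
      case False
      then obtain x where x: "x \<in> D" "x \<in> choice_lits" by blast
      then have "ENot (Pos x) \<notin> \<Phi>"
        using comp DM unfolding compatible_def by (fastforce simp: lit_sat_def)
      then have "nm QQ \<in> N" if "mod1 \<Phi> D M N" using that x \<open>D \<subseteq> M\<close> unfolding mod1_def by blast
      then show ?thesis by (auto simp: mod2_def)
    qed
    moreover have "D \<subseteq> M" if "mod1 \<Phi> D M M \<or> mod2 \<Phi> D M M" for M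
      using that by (auto simp: mod1_def mod2_def)
    ultimately have "M \<in> AS1 D \<Phi> \<longleftrightarrow>
        M \<in> AS2 D \<Phi>" for M
      unfolding answer_sets_R1 answer_sets_R2 by metis
    then show False using neq by blast
  qed
next
  assume ueq: "uniformly_cwv_equivalent (A, E0, R1) (A, E0, R2)"
  show "\<forall>y1. \<exists>y2. \<forall>y3. accepts y1 y2 y3"
  proof (rule ccontr)
    assume "\<not> ?thesis"
    then obtain y1 f where rej: "\<And>y2. \<not> accepts y1 y2 (f y2)" by metis
    \<comment> \<open>The guess that leaves all choice literals open and declares \<open>w\<close>
      false in every answer set.\<close>
    let ?\<Phi> = "(\<lambda>x. ENot (Pos x)) ` choice_lits"
    let ?AS = "AS1 (YY y1) ?\<Phi>"
    let ?M = "\<lambda>y2. der H (YY y1) (YY y1 \<union> BB y2 \<union> CC (f y2))"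
    have M: "?M y2 \<in> ?AS" for y2
      by (rule run_answer_set[OF A(1,4,5,6) _ rej]) auto
    \<comment> \<open>An answer set with \<open>w\<close> is saturated and fixes some word
      \<open>?y2\<close>, but the run of \<open>?y2\<close> with its rejecting third word is a
      smaller model.\<close>
    have noW: "nm WW \<notin> M" if "M \<in> ?AS" for M
    proof
      assume W: "nm WW \<in> M"
      have m: "mod1 ?\<Phi> (YY y1) M M" and min: "\<And>N. N \<subset> M \<Longrightarrow> \<not> mod1 ?\<Phi> (YY y1) M N"
        using that by (auto simp: answer_sets_R1)
      let ?y2 = "{i. nm (Ba i) \<in> M}"
      let ?N = "?M ?y2"
      have "YY y1 \<union> BB ?y2 \<subseteq> M" using m by (auto simp: mod1_def BB_def)
      moreover have "saturated \<subseteq> M" using m W by (simp add: mod1_def)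
      moreover have "fst ` H \<subseteq> saturated" by (auto simp: saturated_def)
      ultimately have "?N \<subseteq> M" using CC_subset[of "f ?y2"]
        by (intro subsetI) (drule der_cases, blast)
      moreover have WN: "nm WW \<notin> ?N" using rej by (simp add: accepts_def)
      ultimately have "?N \<subset> M" using W by blast
      moreover have "mod1 ?\<Phi> (YY y1) M ?N"
        unfolding mod1_def
      proof (intro conjI allI impI ballI)
        show "YY y1 \<subseteq> ?N" by (auto intro: der_base)
        show "nm TT \<in> ?N" by (rule der_base) (simp add: YY_def)
        show "nm (Ba i) \<in> ?N \<or> nm (NB i) \<in> ?N" if "i < n2" for i
          using that by (cases "i \<in> ?y2") (auto simp: BB_def intro!: der_base)
        show "nm (Ca i) \<in> ?N \<or> nm (NC i) \<in> ?N" if "i < n3" for i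
          using that by (cases "i \<in> f ?y2") (auto simp: CC_def intro!: der_base)
        show "h \<in> ?N" if "(h, bd) \<in> H" "\<forall>x. Pos x \<in> set bd \<longrightarrow> x \<in> ?N" "\<forall>x. Neg x \<in> set bd \<longrightarrow> x \<notin> M" for h bd
          using that \<open>YY y1 \<union> BB ?y2 \<subseteq> M\<close> by (intro der_rule[OF that(1)]) auto
        show "saturated \<subseteq> ?N" if "nm WW \<in> ?N" using that WN by blast
      qed auto
      ultimately show False using min by blast
    qed
    have "compatible E0 ?\<Phi> ?AS"
      unfolding compatible_def
    proof (intro conjI allI impI ballI)
      show "?AS \<noteq> {}" using M by blast
    next
      fix l assume "ENot l \<in> ?\<Phi>"
      then obtain i where i: "i < n2" "l = Pos (nm (Ba i)) \<or> l = Pos (nm (NB i))"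
        by (auto simp: choice_lits_def)
      \<comment> \<open>Every second word yields an answer set; the all-zero word lacks
        \<open>Ba i\<close> and the all-one word lacks \<open>NB i\<close>.\<close>
      have "nm (Ba i) \<notin> ?M {}" "nm (NB i) \<notin> ?M {..<n2}"
        by (auto simp: der_not_head YY_def BB_def CC_def)
      then show "\<exists>I \<in> ?AS. \<not> lit_sat I l" using i M by (auto simp: lit_sat_def)
    next
      fix l M assume "ENot l \<in> E0 - ?\<Phi>" "M \<in> ?AS"
      then show "lit_sat M l" using noW by (auto simp: E0_def lit_sat_def)
    qed
    moreover have "?\<Phi> \<subseteq> E0" by (auto simp: E0_def)
    moreover have "?M {} \<notin> AS2 (YY y1) ?\<Phi>"
    proof
      assume "?M {} \<in> AS2 (YY y1) ?\<Phi>"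
      then have "nm WW \<in> ?M {} \<or> nm QQ \<in> ?M {}" by (auto simp: answer_sets_R2 mod2_def)
      moreover have "nm QQ \<notin> ?M {}" by (auto simp: der_not_head YY_def BB_def CC_def)
      ultimately show False using noW[OF M[of "{}"]] by blast
    qed
    ultimately have "cwvs (A, E0, R1 \<union> facts (YY y1)) \<noteq> cwvs (A, E0, R2 \<union> facts (YY y1))"
      unfolding cwvs_neq_iff using M by blast
    moreover have "YY y1 \<subseteq> A" using A(1,6) by (auto simp: YY_def)
    ultimately show False
      using ueq unfolding uniformly_cwv_equivalent_def fst_conv add_facts_eq by blast
  qed
qed

end


section \<open>Horn rules for Turing machine computations\<close>

text \<open>A symbolic input bit is given by the literals expressing that it is set and that it is not set.\<close>

type_synonym hlit = "bool \<times> hatom"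
type_synonym hrule = "hatom \<times> hlit list"
type_synonym sbit = "hlit \<times> hlit"

text \<open>\<open>TT\<close> is a fact, so the literal \<open>(True, TT)\<close> always holds and
  \<open>(False, TT)\<close> never does. Constant bits thus need no separate treatment.\<close>

definition cbit :: "bool \<Rightarrow> sbit" where
  "cbit b = ((b, TT), (\<not> b, TT))"

text \<open>Mirrors \<open>enc_pair\<close>. The layout of this code depends only on the lengths of
  the words, so it can be produced before the bits are known.\<close>

definition spair :: "sbit list \<Rightarrow> sbit list \<Rightarrow> sbit list" where
  "spair xs ys = concat (map (\<lambda>b. [cbit True, b]) xs) @ [cbit False] @ ys"

definition sinput :: "bool list \<Rightarrow> nat \<Rightarrow> nat \<Rightarrow> nat \<Rightarrow> sbit list" where
  "sinput x n1 n2 n3 = spair (spair (spair (map cbit x)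
     (map (\<lambda>i. ((True, Aa i), (False, Aa i))) [0..<n1]))
     (map (\<lambda>i. ((True, Ba i), (True, NB i))) [0..<n2]))
     (map (\<lambda>i. ((True, Ca i), (True, NC i))) [0..<n3])"

text \<open>Cells are addressed relative to the head, so a move to the left shifts all cells to the right.\<close>

definition dirs :: "move \<Rightarrow> bool \<times> bool" where
  "dirs m = (m = MLeft, m = MRight)"

definition sh :: "bool \<times> bool \<Rightarrow> nat \<Rightarrow> nat" where
  "sh d j = (if fst d then Suc j else if snd d then j - 1 else j)"

text \<open>A halted machine goes on rewriting the symbols it reads, so a run can be continued to
  exactly \<open>T\<close> steps.\<close>

definition eff :: "tm \<Rightarrow> nat \<Rightarrow> nat list \<Rightarrow> nat \<times> (nat \<times> move) list" where
  "eff M q ss = (if q = 1 then (1, stay ss) else tm_trans M q ss)"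

text \<open>A template consists of the precondition (state and symbols read), the next state, the symbols
  written, and the cell contents that are carried over. The extra tape \<open>tm_tapes M\<close> marks the origin
  of the output tape; its symbol also survives under the head.\<close>

type_synonym template = "(nat \<times> (nat \<times> nat) list) \<times> nat \<times> (nat \<times> (bool \<times> bool) \<times> nat) list \<times>
  (nat \<times> (bool \<times> bool) \<times> bool \<times> nat) list"

definition template :: "tm \<Rightarrow> nat \<Rightarrow> nat list \<Rightarrow> template" where
  "template M q ss = (let (q', acts) = eff M q ss; K = tm_tapes M in
     ((q, List.enumerate 0 ss), q', map (\<lambda>k. (k, dirs (snd (acts ! k)), fst (acts ! k))) [0..<K],
      concat (map (\<lambda>k. map (\<lambda>s. (k, dirs (snd (acts ! k)), True, s)) [0..<tm_syms M]) [0..<K])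
        @ [(K, dirs (snd (acts ! (K - 1))), False, 1)]))"

definition templates :: "tm \<Rightarrow> template list" where
  "templates M = concat (map (\<lambda>q. map (template M q) (List.n_lists (tm_tapes M) [0..<tm_syms M]))
     [0..<tm_states M])"

definition body :: "nat \<Rightarrow> nat \<Rightarrow> nat \<times> (nat \<times> nat) list \<Rightarrow> hlit list" where
  "body c t pre = (True, St t (fst pre)) # map (\<lambda>p. (True, Ce t (fst p) c (snd p))) (snd pre)"

text \<open>The cell under the head (\<open>Suc i = c\<close>) is overwritten and hence not carried
  over. The flag is off for the marker tape, on which nothing is written.\<close>

definition rule_block :: "nat \<Rightarrow> nat \<Rightarrow> nat \<Rightarrow> template \<Rightarrow> hrule list" where
  "rule_block c W t \<tau> =
     (St (Suc t) (fst (snd \<tau>)), body c t (fst \<tau>)) #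
     map (\<lambda>w. (Ce (Suc t) (fst w) (sh (fst (snd w)) c) (snd (snd w)), body c t (fst \<tau>))) (fst (snd (snd \<tau>))) @
     concat (map (\<lambda>w. concat (map (\<lambda>i. if fst (snd (snd w)) \<and> Suc i = c then []
         else [(Ce (Suc t) (fst w) (sh (fst (snd w)) (Suc i)) (snd (snd (snd w))),
                body c t (fst \<tau>) @ [(True, Ce t (fst w) (Suc i) (snd (snd (snd w))))])]) [0..<W]))
       (snd (snd (snd \<tau>))))"

definition step_rules :: "nat \<Rightarrow> nat \<Rightarrow> nat \<Rightarrow> template list \<Rightarrow> hrule list" where
  "step_rules c W T \<tau>s = concat (map (\<lambda>t. concat (map (\<lambda>\<tau>. rule_block c W t \<tau>) \<tau>s)) [0..<T])"

lemma rule_block_iff: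
  "r \<in> set (rule_block c W t (template M q ss)) \<longleftrightarrow>
    r = (St (Suc t) (fst (eff M q ss)), body c t (q, List.enumerate 0 ss)) \<or>
    (\<exists>k < tm_tapes M. r = (Ce (Suc t) k (sh (dirs (snd (snd (eff M q ss) ! k))) c) (fst (snd (eff M q ss) ! k)),
       body c t (q, List.enumerate 0 ss))) \<or>
    (\<exists>k < tm_tapes M. \<exists>s < tm_syms M. \<exists>i < W. Suc i \<noteq> c \<and>
       r = (Ce (Suc t) k (sh (dirs (snd (snd (eff M q ss) ! k))) (Suc i)) s,
            body c t (q, List.enumerate 0 ss) @ [(True, Ce t k (Suc i) s)])) \<or>
    (\<exists>i < W. r = (Ce (Suc t) (tm_tapes M) (sh (dirs (snd (snd (eff M q ss) ! (tm_tapes M - 1)))) (Suc i)) 1,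
       body c t (q, List.enumerate 0 ss) @ [(True, Ce t (tm_tapes M) (Suc i) 1)]))"
proof -
  have 1: "fst (template M q ss) = (q, List.enumerate 0 ss)" "fst (snd (template M q ss)) = fst (eff M q ss)"
    "fst (snd (snd (template M q ss))) =
       map (\<lambda>k. (k, dirs (snd (snd (eff M q ss) ! k)), fst (snd (eff M q ss) ! k))) [0..<tm_tapes M]"
    "snd (snd (snd (template M q ss))) =
       concat (map (\<lambda>k. map (\<lambda>s. (k, dirs (snd (snd (eff M q ss) ! k)), True, s)) [0..<tm_syms M]) [0..<tm_tapes M])
        @ [(tm_tapes M, dirs (snd (snd (eff M q ss) ! (tm_tapes M - 1))), False, 1)]"
    by (simp_all add: template_def Let_def split_beta)
  show ?thesis
    unfolding rule_block_def 1 set_append set_concat set_map list.set(2) Un_iff insert_iff UN_iff image_iff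
      bex_Un bex_simps set_upt
    by (simp only: fst_conv snd_conv split: if_splits) (auto split: if_splits; force)
qed

lemma step_rules_iff:
  "r \<in> set (step_rules c W T (templates M)) \<longleftrightarrow>
    (\<exists>t < T. \<exists>q < tm_states M. \<exists>ss. length ss = tm_tapes M \<and> set ss \<subseteq> {0..<tm_syms M} \<and>
       r \<in> set (rule_block c W t (template M q ss)))"
  unfolding step_rules_def templates_def by (simp add: set_n_lists Bex_def)

text \<open>Address \<open>c\<close> is position 0 at time 0. Each input bit gets one rule per
  value, guarded by the literal for that value. Blanks are listed explicitly: the
  \<open>2 * T\<close> addresses left of \<open>c\<close> and \<open>W\<close> addresses right of
  the input, and \<open>W\<close> addresses on each other tape.\<close>

definition init_rules :: "nat \<Rightarrow> nat \<Rightarrow> nat \<Rightarrow> nat \<Rightarrow> sbit list \<Rightarrow> hrule list" where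
  "init_rules c W T K bs = (St 0 0, []) # (Ce 0 K c 1, []) #
     concat (map (\<lambda>p. [(Ce 0 0 (c + fst p) 2, [fst (snd p)]), (Ce 0 0 (c + fst p) 1, [snd (snd p)])])
       (List.enumerate 0 bs)) @
     map (\<lambda>i. (Ce 0 0 (Suc i) 0, [])) [0..<2 * T] @
     map (\<lambda>i. (Ce 0 0 (c + length bs + i) 0, [])) [0..<W] @
     concat (map (\<lambda>k. map (\<lambda>i. (Ce 0 (Suc k) (Suc i) 0, [])) [0..<W]) [0..<K - 1])"

text \<open>The answer is in position 0 of the last tape, but addresses are relative to a head that
  may have moved away; the marker tells the current address of that position. Symbol 2 is
  \<open>bit_sym True\<close>.\<close>

definition accept_rules :: "nat \<Rightarrow> nat \<Rightarrow> nat \<Rightarrow> hrule list" where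
  "accept_rules W T K = map (\<lambda>i. (WW, [(True, St T 1), (True, Ce T (K - 1) (Suc i) 2), (True, Ce T K (Suc i) 1)])) [0..<W]"

text \<open>The reliable addresses at time \<open>t\<close> are those with \<open>t < j\<close> and
  \<open>j + t < W\<close>. For \<open>c = 2 * T + 1\<close> and \<open>W = 4 * T + 2\<close>, what
  remains at time \<open>T\<close> is \<open>T + 1\<close> up to \<open>3 * T + 1\<close>, the
  addresses to which the origin can have drifted in \<open>T\<close> steps.\<close>

definition horn_rules :: "tm \<Rightarrow> nat \<Rightarrow> sbit list \<Rightarrow> hrule list" where
  "horn_rules M T bs = init_rules (2 * T + 1) (4 * T + 2) T (tm_tapes M) bs @
     step_rules (2 * T + 1) (4 * T + 2) T (templates M) @ accept_rules (4 * T + 2) T (tm_tapes M)"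

definition word_rule :: "(hatom \<Rightarrow> wd) \<Rightarrow> hrule \<Rightarrow> wd horn" where
  "word_rule nm r = (nm (fst r), map (\<lambda>l. lit_of (fst l, nm (snd l))) (snd r))"

lemma der_hrule:
  assumes "(h, bd) \<in> set R" "\<And>a. (True, a) \<in> set bd \<Longrightarrow> nm a \<in> der (word_rule nm ` set R) Y F"
    "\<And>a. (False, a) \<in> set bd \<Longrightarrow> nm a \<notin> Y"
  shows "nm h \<in> der (word_rule nm ` set R) Y F"
proof (rule der_rule)
  show "(nm h, map (\<lambda>l. lit_of (fst l, nm (snd l))) bd) \<in> word_rule nm ` set R"
    using assms(1) by (force simp: word_rule_def)
qed (use assms(2,3) in \<open>auto simp: lit_of_def split: if_splits\<close>)

lemma der_hrule_sound:
  assumes F: "\<And>y. y \<in> F \<Longrightarrow> \<exists>a. y = nm a \<and> tr a"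
    and R: "\<And>h bd. (h, bd) \<in> set R \<Longrightarrow> (\<And>a. (True, a) \<in> set bd \<Longrightarrow> tr a) \<Longrightarrow>
      (\<And>a. (False, a) \<in> set bd \<Longrightarrow> nm a \<notin> Y) \<Longrightarrow> tr h"
    and nm: "inj nm" and a: "nm a \<in> der (word_rule nm ` set R) Y F"
  shows "tr a"
proof -
  have "der (word_rule nm ` set R) Y F \<subseteq> {nm a | a. tr a}"
  proof (rule der_least)
    fix h bd assume r: "(h, bd) \<in> word_rule nm ` set R" and pos: "\<And>x. Pos x \<in> set bd \<Longrightarrow> x \<in> {nm a | a. tr a}"
      and neg: "\<And>x. Neg x \<in> set bd \<Longrightarrow> x \<notin> Y"
    obtain h' bd' where r': "(h', bd') \<in> set R" "h = nm h'" "bd = map (\<lambda>l. lit_of (fst l, nm (snd l))) bd'"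
      using r by (auto simp: word_rule_def)
    have "tr h'"
    proof (rule R[OF r'(1)])
      fix a assume "(True, a) \<in> set bd'"
      then have "Pos (nm a) \<in> set bd" unfolding r'(3) by (force simp: lit_of_def)
      then show "tr a" using pos nm by (auto dest: injD)
    next
      fix a assume "(False, a) \<in> set bd'"
      then have "Neg (nm a) \<in> set bd" unfolding r'(3) by (force simp: lit_of_def)
      then show "nm a \<notin> Y" using neg by blast
    qed
    then show "h \<in> {nm a | a. tr a}" using r'(2) by blast
  qed (use F in blast)
  then show ?thesis using a nm by (auto dest: injD)
qed

section \<open>Correctness of the tableau\<close>

definition tm_run :: "tm \<Rightarrow> bool list \<Rightarrow> nat \<Rightarrow> tm_config" where
  "tm_run M z t = (tm_step M ^^ t) (tm_init M z)"

lemma tm_run_Suc: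
  assumes "length (snd (tm_run M z t)) = tm_tapes M"
  shows "tm_run M z (Suc t) = (let (q', acts) = eff M (fst (tm_run M z t)) (map tape_read (snd (tm_run M z t)))
    in (q', map2 tape_act acts (snd (tm_run M z t))))"
proof -
  obtain q ts where r: "tm_run M z t = (q, ts)" by fastforce
  have "tm_run M z (Suc t) = tm_step M (q, ts)" using r by (simp add: tm_run_def)
  then show ?thesis using map2_stay[of "map tape_read ts" ts] by (simp add: r eff_def split: prod.split)
qed

lemma tm_run_inv:
  assumes "tm_wf M"
  shows "fst (tm_run M z t) < tm_states M \<and> length (snd (tm_run M z t)) = tm_tapes M \<and>
    (\<forall>tp \<in> set (snd (tm_run M z t)). \<bar>snd tp\<bar> \<le> int t \<and> (\<forall>i. fst tp i < tm_syms M))"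
proof (induction t)
  case 0
  have "0 < tm_states M" "1 \<le> tm_tapes M" "2 < tm_syms M" using assms by (auto simp: tm_wf_def)
  then show ?case
    by (auto simp: tm_run_def tm_init_def input_tape_def blank_tape_def bit_sym_def)
next
  case (Suc t)
  obtain q ts where r: "tm_run M z t = (q, ts)" by fastforce
  let ?ss = "map tape_read ts"
  obtain q' acts where e: "eff M q ?ss = (q', acts)" by fastforce
  have ts: "length ts = tm_tapes M" and q: "q < tm_states M" using Suc r by auto
  have tp: "\<bar>snd tp\<bar> \<le> int t" "\<And>i. fst tp i < tm_syms M" if "tp \<in> set ts" for tp
    using Suc r that by auto
  have ss: "\<forall>s \<in> set ?ss. s < tm_syms M" using tp(2) by (auto simp: tape_read.simps)
  have acts: "q' < tm_states M \<and> length acts = tm_tapes M \<and> (\<forall>(s, m) \<in> set acts. s < tm_syms M)"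
  proof (cases "q = 1")
    case True
    then show ?thesis using e q ts ss by (auto simp: eff_def stay_def)
  next
    case False
    then have "tm_trans M q ?ss = (q', acts)" using e by (simp add: eff_def)
    then show ?thesis using assms q ts ss unfolding tm_wf_def
      by (metis fst_conv length_map snd_conv)
  qed
  have R: "tm_run M z (Suc t) = (q', map2 tape_act acts ts)"
    using tm_run_Suc[of M z t] ts r e by simp
  have "\<bar>snd tp'\<bar> \<le> int (Suc t) \<and> (\<forall>i. fst tp' i < tm_syms M)" if new: "tp' \<in> set (map2 tape_act acts ts)" for tp'
  proof -
    obtain s m f h where z: "tp' = tape_act (s, m) (f, h)" "((s, m), (f, h)) \<in> set (zip acts ts)"
      using new by (auto simp del: tape_act.simps)
    note tp' = z(1) set_zip_leftD[OF z(2)] set_zip_rightD[OF z(2)]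
    have "\<bar>h\<bar> \<le> int t" "\<And>i. f i < tm_syms M" "s < tm_syms M" using tp[OF tp'(3)] acts tp'(2) by auto
    then show ?thesis unfolding tp'(1) by (cases m) auto
  qed
  then show ?case unfolding R using acts ts by auto
qed

lemma tm_run_halted:
  assumes "tm_run M z t = (1, ts)" "t \<le> T"
  shows "tm_run M z T = (1, ts)"
proof -
  have "(tm_step M ^^ n) (1, ts) = (1, ts)" for n by (induction n) simp_all
  then have "(tm_step M ^^ (t + (T - t))) (tm_init M z) = (1, ts)"
    using assms(1) unfolding tm_run_def by (intro funpow_add_eq)
  then show ?thesis using assms(2) by (simp add: tm_run_def)
qed

text \<open>One fixed assignment: \<open>F\<close> supplies positive literals and \<open>Y\<close>
  decides negative ones. The assumptions on \<open>bs\<close> say that at each position the literal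
  for the actual bit of \<open>z\<close> holds and the opposite one fails. The output is a single
  bit, read in position 0.\<close>

locale tableau =
  fixes M :: tm and nm :: "hatom \<Rightarrow> wd" and T :: nat and bs :: "sbit list"
    and Y F :: "wd set" and z :: "bool list" and acc :: bool
  assumes wf: "tm_wf M" and nm: "inj nm"
    and F: "\<And>y. y \<in> F \<Longrightarrow> \<exists>a. y = nm a \<and> \<not> derivable_atom a"
    and bits: "length z = length bs"
      "\<And>i b a. i < length bs \<Longrightarrow> (b, a) = (if z ! i then fst (bs ! i) else snd (bs ! i)) \<Longrightarrow>
        if b then nm a \<in> F else nm a \<notin> Y"
      "\<And>i b a. i < length bs \<Longrightarrow> (b, a) = (if z ! i then snd (bs ! i) else fst (bs ! i)) \<Longrightarrow>
        \<not> derivable_atom a \<and> (if b then nm a \<notin> F else nm a \<in> Y)"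
    and out: "fst (tm_run M z T) = 1" "fst (last (snd (tm_run M z T))) 0 = bit_sym acc"
begin

definition "c = 2 * T + 1"
definition "W = 4 * T + 2"
abbreviation "K \<equiv> tm_tapes M"
abbreviation "state t \<equiv> fst (tm_run M z t)"
abbreviation "tp t k \<equiv> snd (tm_run M z t) ! k"
abbreviation "derived \<equiv> der (word_rule nm ` set (horn_rules M T bs)) Y F"

definition cell :: "tape \<Rightarrow> nat \<Rightarrow> nat" where
  "cell p j = fst p (snd p + int j - int c)"

text \<open>The intended meaning of the atoms in the actual run. On the marker tape
  \<open>K\<close>, the true address \<open>j\<close> is that of position 0 of the output tape,
  which is \<open>c\<close> minus the head position.\<close>

fun tr :: "hatom \<Rightarrow> bool" where
  "tr (St t q) = (q = state t)"
| "tr (Ce t k j s) = (if k < K then s = cell (tp t k) j else k = K \<and> int c - int j = snd (tp t (K - 1)))"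
| "tr WW = acc"
| "tr a = (nm a \<in> F)"

lemma K_pos: "0 < K"
  using wf by (simp add: tm_wf_def)

lemma len [simp]: "length (snd (tm_run M z t)) = K"
  using tm_run_inv[OF wf] by blast

lemma last_tape: "last (snd (tm_run M z t)) = tp t (K - 1)"
  using len[of t] K_pos last_conv_nth[of "snd (tm_run M z t)"] by (cases "snd (tm_run M z t) = []") simp_all

lemma tr_base: "\<not> derivable_atom a \<Longrightarrow> tr a \<longleftrightarrow> nm a \<in> F"
  by (cases a) auto

lemma head_bound: "k < K \<Longrightarrow> \<bar>snd (tp t k)\<bar> \<le> int t"
  using tm_run_inv[OF wf, of z t] by (metis nth_mem)

lemma cell_bound: "k < K \<Longrightarrow> cell (tp t k) j < tm_syms M"
  using tm_run_inv[OF wf, of z t] unfolding cell_def by (metis nth_mem)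

lemma cell_c: "cell p c = tape_read p"
  by (cases p) (simp add: cell_def)

definition acts :: "nat \<Rightarrow> (nat \<times> move) list" where
  "acts t = snd (eff M (state t) (map tape_read (snd (tm_run M z t))))"

lemma run_step:
  "state (Suc t) = fst (eff M (state t) (map tape_read (snd (tm_run M z t))))"
  "k < K \<Longrightarrow> tp (Suc t) k = tape_act (acts t ! k) (tp t k)"
proof -
  have R: "tm_run M z (Suc t) = (fst (eff M (state t) (map tape_read (snd (tm_run M z t)))),
      map2 tape_act (acts t) (snd (tm_run M z t)))"
    using tm_run_Suc[OF len[of t]] by (simp add: acts_def split_beta)
  then show "state (Suc t) = fst (eff M (state t) (map tape_read (snd (tm_run M z t))))" by simp
  have "length (map2 tape_act (acts t) (snd (tm_run M z t))) = K" using len[of "Suc t"] R by simp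
  then show "k < K \<Longrightarrow> tp (Suc t) k = tape_act (acts t ! k) (tp t k)" unfolding R by simp
qed

lemma sh_dirs: "1 \<le> j \<Longrightarrow> int (sh (dirs m) j) = int j - move_offset m"
  by (cases m) (auto simp: sh_def dirs_def)

lemma cell_write: "cell (tape_act a p) (sh (dirs (snd a)) c) = fst a"
  using sh_dirs[of c "snd a"] by (cases p; cases a) (simp add: cell_def c_def)

lemma cell_move: "1 \<le> j \<Longrightarrow> j \<noteq> c \<Longrightarrow> cell (tape_act a p) (sh (dirs (snd a)) j) = cell p j"
  using sh_dirs[of j "snd a"] by (cases p; cases a) (simp add: cell_def algebra_simps)

lemma head_move:
  "1 \<le> j \<Longrightarrow> int c - int j = snd p \<Longrightarrow> int c - int (sh (dirs (snd a)) j) = snd (tape_act a p)"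
  using sh_dirs[of j "snd a"] by (cases p; cases a) simp

lemma body_true:
  assumes "\<And>a. (True, a) \<in> set (body c t (q, List.enumerate 0 ss)) \<Longrightarrow> tr a" "length ss = K"
  shows "q = state t" "ss = map tape_read (snd (tm_run M z t))"
proof -
  show "q = state t" using assms(1)[of "St t q"] by (simp add: body_def)
  show "ss = map tape_read (snd (tm_run M z t))"
  proof (rule nth_equalityI)
    fix i assume "i < length ss"
    then have "(i, ss ! i) \<in> set (List.enumerate 0 ss)"
      by (simp add: in_set_enumerate_eq)
    then have "tr (Ce t i c (ss ! i))" by (intro assms(1)) (force simp: body_def)
    then show "ss ! i = map tape_read (snd (tm_run M z t)) ! i"
      using \<open>i < length ss\<close> assms(2) by (simp add: cell_c)
  qed (use assms(2) in simp)
qed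

lemma bit_rule_sound:
  assumes i: "i < length bs" and l: "(b, a) = (if v then fst (bs ! i) else snd (bs ! i))"
    and pos: "b \<Longrightarrow> tr a" and neg: "\<not> b \<Longrightarrow> nm a \<notin> Y"
  shows "z ! i = v"
proof (rule ccontr)
  assume "z ! i \<noteq> v"
  then have "\<not> derivable_atom a \<and> (if b then nm a \<notin> F else nm a \<in> Y)"
    using l by (intro bits(3)[OF i]) (auto split: if_splits)
  then show False using pos neg tr_base by (auto split: if_splits)
qed

lemma input_cell:
  assumes "k < K"
  shows "cell (tp 0 k) j = (if k = 0 \<and> c \<le> j \<and> j < c + length bs then bit_sym (z ! (j - c)) else 0)"
proof -
  have "tp 0 k = (if k = 0 then input_tape z else blank_tape)"
    using assms by (simp add: tm_run_def tm_init_def nth_Cons')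
  moreover have "cell (input_tape z) j = (if c \<le> j \<and> j < c + length bs then bit_sym (z ! (j - c)) else 0)"
    by (auto simp: cell_def input_tape_def bits(1) nat_diff_distrib' of_nat_diff intro!: arg_cong[where f = bit_sym] arg_cong[where f = "\<lambda>n. z ! n"])
  ultimately show ?thesis by (simp add: cell_def blank_tape_def)
qed

text \<open>Each rule preserves truth in the run, at whatever address it applies. The width of the
  window enters only in \<open>derived_complete\<close>.\<close>

lemma derived_sound:
  assumes "nm a \<in> derived"
  shows "tr a"
proof (rule der_hrule_sound[OF _ _ nm assms])
  show "\<exists>a. y = nm a \<and> tr a" if "y \<in> F" for y
    using F[OF that] that tr_base by blast
  fix h bd
  assume r: "(h, bd) \<in> set (horn_rules M T bs)" and pos: "\<And>a. (True, a) \<in> set bd \<Longrightarrow> tr a"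
    and neg: "\<And>a. (False, a) \<in> set bd \<Longrightarrow> nm a \<notin> Y"
  consider (init) "(h, bd) \<in> set (init_rules c W T K bs)" | (step) "(h, bd) \<in> set (step_rules c W T (templates M))"
    | (accept) "(h, bd) \<in> set (accept_rules W T K)"
    using r unfolding horn_rules_def c_def W_def by (simp only: set_append Un_iff) blast
  then show "tr h"
  proof cases
    case accept
    then obtain i where h: "h = WW" and bd: "bd = [(True, St T 1), (True, Ce T (K - 1) (Suc i) 2), (True, Ce T K (Suc i) 1)]"
      unfolding accept_rules_def by auto
    have "tr (Ce T (K - 1) (Suc i) 2)" "tr (Ce T K (Suc i) 1)" by (rule pos, simp add: bd)+
    then have "fst (tp T (K - 1)) 0 = 2" using K_pos by (simp add: cell_def algebra_simps)
    then have "bit_sym acc = 2" using out(2) last_tape by simp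
    then show ?thesis unfolding h by (auto simp: bit_sym_def split: if_splits)
  next
    case step
    then obtain t q ss where ss: "length ss = K" and block: "(h, bd) \<in> set (rule_block c W t (template M q ss))"
      unfolding step_rules_iff by blast
    have "set (body c t (q, List.enumerate 0 ss)) \<subseteq> set bd" using block unfolding rule_block_iff by auto
    then have q: "q = state t" and ss': "ss = map tape_read (snd (tm_run M z t))"
      using body_true[of t q ss] pos ss by blast+
    have e: "fst (eff M q ss) = state (Suc t)" "snd (eff M q ss) = acts t"
      using run_step(1)[of t] unfolding q ss' acts_def by simp_all
    note tpk = run_step(2)[of _ t]
    from block[unfolded rule_block_iff e] show ?thesis
    proof (elim disjE exE conjE)
      fix k assume "k < K" "(h, bd) = (Ce (Suc t) k (sh (dirs (snd (acts t ! k))) c) (fst (acts t ! k)),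
           body c t (q, List.enumerate 0 ss))"
      then show ?thesis using cell_write tpk by simp
    next
      fix k s i assume *: "k < K" "Suc i \<noteq> c" "(h, bd) = (Ce (Suc t) k (sh (dirs (snd (acts t ! k))) (Suc i)) s,
            body c t (q, List.enumerate 0 ss) @ [(True, Ce t k (Suc i) s)])"
      have "tr (Ce t k (Suc i) s)" by (rule pos) (use *(3) in simp)
      then show ?thesis using * cell_move[of "Suc i"] tpk by simp
    next
      fix i assume *: "(h, bd) = (Ce (Suc t) K (sh (dirs (snd (acts t ! (K - 1)))) (Suc i)) 1,
           body c t (q, List.enumerate 0 ss) @ [(True, Ce t K (Suc i) 1)])"
      have "tr (Ce t K (Suc i) 1)" by (rule pos) (use * in simp)
      then have "int c - int (Suc i) = snd (tp t (K - 1))" by simp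
      from head_move[OF _ this] show ?thesis using * tpk[of "K - 1"] K_pos by simp
    qed simp
  next
    case init
    have "snd (tp 0 (K - 1)) = 0"
      using K_pos by (simp add: tm_run_def tm_init_def input_tape_def blank_tape_def nth_Cons')
    moreover have "state 0 = 0" by (simp add: tm_run_def tm_init_def)
    moreover have bit: "tr (Ce 0 0 (c + i) (if v then 2 else 1))"
      if "i < length bs" "bd = [if v then fst (bs ! i) else snd (bs ! i)]" for i v
    proof -
      obtain b a where ba: "(b, a) = (if v then fst (bs ! i) else snd (bs ! i))" by (metis prod.exhaust)
      have "z ! i = v"
        by (rule bit_rule_sound[OF that(1) ba]) (use that(2) ba pos neg in \<open>force+\<close>)
      then show ?thesis using input_cell[of 0 "c + i"] K_pos that(1) by (simp add: bit_sym_def)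
    qed
    ultimately show ?thesis
      using init bit[of _ True] bit[of _ False] K_pos
      by (auto simp: init_rules_def in_set_enumerate_eq input_cell c_def simp del: of_nat_add)
  qed
qed

lemma horn_rules_set:
  "set (horn_rules M T bs) = set (init_rules c W T K bs) \<union> set (step_rules c W T (templates M)) \<union>
    set (accept_rules W T K)"
  by (simp add: horn_rules_def c_def W_def Un_assoc)

lemma derived_fact: "(h, []) \<in> set (init_rules c W T K bs) \<Longrightarrow> nm h \<in> derived"
  by (rule der_hrule[of _ "[]"]) (simp_all add: horn_rules_set)

text \<open>Finds the address that a cell had before the move. The bound \<open>1 < j'\<close>
  leaves room for the move that decreases addresses.\<close>

lemma unshift:
  assumes "1 < j'"
  obtains j where "1 \<le> j" "sh (dirs m) j = j'" "int j = int j' + move_offset m"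
proof -
  define j where "j = nat (int j' + move_offset m)"
  have j: "1 \<le> j" "int j = int j' + move_offset m" using assms by (cases m; simp add: j_def)+
  then have "sh (dirs m) j = j'" using sh_dirs[of j m] by simp
  then show thesis using that j by blast
qed

lemma derived_init:
  "nm (St 0 (state 0)) \<in> derived"
  "k < K \<Longrightarrow> 0 < j \<Longrightarrow> j < W \<Longrightarrow> nm (Ce 0 k j (cell (tp 0 k) j)) \<in> derived"
  "int c - int j = snd (tp 0 (K - 1)) \<Longrightarrow> nm (Ce 0 K j 1) \<in> derived"
proof -
  have "state 0 = 0" by (simp add: tm_run_def tm_init_def)
  then show "nm (St 0 (state 0)) \<in> derived"
    by (intro derived_fact) (simp add: init_rules_def)
  have "snd (tp 0 (K - 1)) = 0"
    using K_pos by (simp add: tm_run_def tm_init_def input_tape_def blank_tape_def nth_Cons')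
  then show "nm (Ce 0 K j 1) \<in> derived" if "int c - int j = snd (tp 0 (K - 1))"
    using that by (intro derived_fact) (simp add: init_rules_def)
  assume k: "k < K" and j: "0 < j" "j < W"
  obtain i where i: "j = Suc i" using j(1) by (cases j) auto
  consider (input) "k = 0" "c \<le> j" "j < c + length bs" | (left) "k = 0" "j < c"
    | (right) "k = 0" "c + length bs \<le> j" | (other) k' where "k = Suc k'"
    by (cases k) force+
  then show "nm (Ce 0 k j (cell (tp 0 k) j)) \<in> derived"
  proof cases
    case input
    define m where "m = j - c"
    have m: "m < length bs" "j = c + m" using input by (auto simp: m_def)
    define l where "l = (if z ! m then fst (bs ! m) else snd (bs ! m))"
    have "cell (tp 0 k) j = (if z ! m then 2 else 1)"
      using input_cell[OF k, of j] input m by (simp add: bit_sym_def)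
    moreover have "(m, bs ! m) \<in> set (List.enumerate 0 bs)" using m by (simp add: in_set_enumerate_eq)
    then have "(Ce 0 0 (c + m) (if z ! m then 2 else 1), [l]) \<in> set (init_rules c W T K bs)"
      by (force simp: init_rules_def l_def)
    ultimately have r: "(Ce 0 k j (cell (tp 0 k) j), [l]) \<in> set (horn_rules M T bs)"
      using input m by (simp add: horn_rules_set)
    obtain b a where l: "l = (b, a)" by fastforce
    have "if b then nm a \<in> F else nm a \<notin> Y" by (rule bits(2)[OF m(1)]) (simp add: l[symmetric] l_def)
    then show ?thesis by (intro der_hrule[OF r]) (auto simp: l intro: der_base split: if_splits)
  next
    case left
    then have "cell (tp 0 k) j = 0" using input_cell[OF k, of j] by simp
    then show ?thesis using left i by (intro derived_fact) (auto simp: init_rules_def c_def)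
  next
    case right
    then have "cell (tp 0 k) j = 0" using input_cell[OF k, of j] by simp
    moreover have "j = c + length bs + (j - c - length bs)" "j - c - length bs < W" using right j by auto
    ultimately show ?thesis using right
      by (intro derived_fact) (force simp: init_rules_def image_iff)
  next
    case other
    then have "cell (tp 0 k) j = 0" using input_cell[OF k, of j] by simp
    moreover have "k' < K - 1" "i < W" using k other i j by auto
    then have "(Ce 0 k j 0, [] :: hlit list) \<in>
        set (concat (map (\<lambda>k. map (\<lambda>i. (Ce 0 (Suc k) (Suc i) 0, [])) [0..<W]) [0..<K - 1]))"
      unfolding other i by force
    ultimately show ?thesis by (intro derived_fact) (simp only: init_rules_def set_append list.set(2) Un_iff insert_iff simp_thms)
  qed
qed

text \<open>A cell is known at time \<open>t + 1\<close> if it was known at time \<open>t\<close>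
  under its former address, which differs by at most one. The known region therefore shrinks by one
  at each end per step.\<close>

lemma derived_complete:
  "t \<le> T \<Longrightarrow> nm (St t (state t)) \<in> derived \<and>
    (\<forall>k<K. \<forall>j. t < j \<longrightarrow> j + t < W \<longrightarrow> nm (Ce t k j (cell (tp t k) j)) \<in> derived) \<and>
    (\<forall>j. int c - int j = snd (tp t (K - 1)) \<longrightarrow> nm (Ce t K j 1) \<in> derived)"
proof (induction t)
  case 0
  then show ?case using derived_init by simp
next
  case (Suc t)
  then have t: "t < T" and St: "nm (St t (state t)) \<in> derived"
    and Ce: "\<And>k j. k < K \<Longrightarrow> t < j \<Longrightarrow> j + t < W \<Longrightarrow> nm (Ce t k j (cell (tp t k) j)) \<in> derived"
    and Or: "\<And>j. int c - int j = snd (tp t (K - 1)) \<Longrightarrow> nm (Ce t K j 1) \<in> derived" by auto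
  let ?q = "state t"
  let ?ss = "map tape_read (snd (tm_run M z t))"
  let ?b = "body c t (?q, List.enumerate 0 ?ss)"
  have tc: "t < c" "c + t < W" using t by (auto simp: c_def W_def)
  have "tape_read p < tm_syms M" if "p \<in> set (snd (tm_run M z t))" for p
    using tm_run_inv[OF wf, of z t] that by (cases p) fastforce
  then have ss: "length ?ss = K" "set ?ss \<subseteq> {0..<tm_syms M}" by auto
  have q: "?q < tm_states M" using tm_run_inv[OF wf] by blast
  have block: "nm h \<in> derived"
    if "(h, bd) \<in> set (rule_block c W t (template M ?q ?ss))" "\<And>a. (True, a) \<in> set bd \<Longrightarrow> nm a \<in> derived"
      "\<And>a. (False, a) \<notin> set bd" for h bd
  proof (rule der_hrule[OF _ that(2)])
    show "(h, bd) \<in> set (horn_rules M T bs)"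
      unfolding horn_rules_set Un_iff using t q ss that(1) step_rules_iff[of "(h, bd)"] by blast
  qed (simp_all add: that(3))
  have bd: "nm a \<in> derived" if "(True, a) \<in> set ?b" for a
  proof -
    have "nm (Ce t i c s) \<in> derived" if "(i, s) \<in> set (List.enumerate 0 ?ss)" for i s
      using that Ce[of i c] tc by (auto simp: in_set_enumerate_eq cell_c)
    then show ?thesis using that St by (auto simp: body_def)
  qed
  have nobd: "(False, a) \<notin> set ?b" for a by (auto simp: body_def)
  have e: "fst (eff M ?q ?ss) = state (Suc t)" "snd (eff M ?q ?ss) = acts t"
    using run_step(1)[of t] unfolding acts_def by simp_all
  note mem = rule_block_iff[of _ c W t M ?q ?ss, unfolded e]
  have "(St (Suc t) (state (Suc t)), ?b) \<in> set (rule_block c W t (template M ?q ?ss))"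
    unfolding mem by (rule disjI1) (rule refl)
  then have "nm (St (Suc t) (state (Suc t))) \<in> derived" using bd nobd by (rule block)
  moreover have "nm (Ce (Suc t) k j' (cell (tp (Suc t) k) j')) \<in> derived"
    if k: "k < K" and j': "Suc t < j'" "j' + Suc t < W" for k j'
  proof -
    obtain j where j: "1 \<le> j" "sh (dirs (snd (acts t ! k))) j = j'" "int j = int j' + move_offset (snd (acts t ! k))"
      using unshift[of j' "snd (acts t ! k)"] j' by auto
    have jt: "t < j" "j + t < W" using j(3) j' by (cases "snd (acts t ! k)"; simp)+
    obtain i where i: "j = Suc i" using j(1) by (cases j) auto
    show ?thesis
    proof (cases "j = c")
      case True
      have "cell (tp (Suc t) k) j' = fst (acts t ! k)"
        using cell_write[of "acts t ! k" "tp t k"] run_step(2)[OF k] j(2) True by simp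
      moreover have "(Ce (Suc t) k j' (fst (acts t ! k)), ?b) \<in> set (rule_block c W t (template M ?q ?ss))"
        unfolding mem using k j(2) True by blast
      then have "nm (Ce (Suc t) k j' (fst (acts t ! k))) \<in> derived" using bd nobd by (rule block)
      ultimately show ?thesis by simp
    next
      case False
      have "cell (tp (Suc t) k) j' = cell (tp t k) j"
        using cell_move[OF j(1) False, of "acts t ! k" "tp t k"] run_step(2)[OF k] j(2) by simp
      moreover have "nm (Ce (Suc t) k j' (cell (tp t k) j)) \<in> derived"
      proof (rule block[of _ "?b @ [(True, Ce t k (Suc i) (cell (tp t k) j))]"])
        have "cell (tp t k) j < tm_syms M" "i < W" "Suc i \<noteq> c" "sh (dirs (snd (acts t ! k))) (Suc i) = j'"
          using cell_bound[OF k] jt i False j(2) by auto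
        then show "(Ce (Suc t) k j' (cell (tp t k) j), ?b @ [(True, Ce t k (Suc i) (cell (tp t k) j))])
            \<in> set (rule_block c W t (template M ?q ?ss))"
          unfolding mem using k by blast
        show "nm a \<in> derived" if "(True, a) \<in> set (?b @ [(True, Ce t k (Suc i) (cell (tp t k) j))])" for a
          using that bd Ce[OF k jt] i by auto
        show "(False, a) \<notin> set (?b @ [(True, Ce t k (Suc i) (cell (tp t k) j))])" for a using nobd by simp
      qed
      ultimately show ?thesis by simp
    qed
  qed
  moreover have "nm (Ce (Suc t) K j' 1) \<in> derived" if h: "int c - int j' = snd (tp (Suc t) (K - 1))" for j'
  proof -
    let ?a = "acts t ! (K - 1)"
    have K1: "K - 1 < K" using K_pos by simp
    have "\<bar>snd (tp (Suc t) (K - 1))\<bar> \<le> int (Suc t)" using head_bound[OF K1] by blast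
    then have "1 < j'" using h t unfolding c_def by linarith
    then obtain j where j: "1 \<le> j" "sh (dirs (snd ?a)) j = j'" "int j = int j' + move_offset (snd ?a)"
      using unshift by blast
    have "snd (tp (Suc t) (K - 1)) = snd (tp t (K - 1)) + move_offset (snd ?a)"
      using run_step(2)[OF K1] by (cases "tp t (K - 1)"; cases ?a) simp
    then have hj: "int c - int j = snd (tp t (K - 1))" using h j(3) by simp
    have "\<bar>snd (tp t (K - 1))\<bar> \<le> int t" using head_bound[OF K1] by blast
    then have "j \<le> W" using hj t unfolding c_def W_def by linarith
    obtain i where i: "j = Suc i" using j(1) by (cases j) auto
    show ?thesis
    proof (rule block[of _ "?b @ [(True, Ce t K (Suc i) 1)]"])
      have "i < W" "sh (dirs (snd ?a)) (Suc i) = j'" using \<open>j \<le> W\<close> i j(2) by auto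
      then show "(Ce (Suc t) K j' 1, ?b @ [(True, Ce t K (Suc i) 1)]) \<in> set (rule_block c W t (template M ?q ?ss))"
        unfolding mem by blast
      show "nm a \<in> derived" if "(True, a) \<in> set (?b @ [(True, Ce t K (Suc i) 1)])" for a
        using that bd Or[OF hj] i by auto
      show "(False, a) \<notin> set (?b @ [(True, Ce t K (Suc i) 1)])" for a using nobd by simp
    qed
  qed
  ultimately show ?case by blast
qed

theorem derived_WW: "nm WW \<in> derived \<longleftrightarrow> acc"
proof
  assume "nm WW \<in> derived"
  then show acc using derived_sound by fastforce
next
  assume a: acc
  let ?h = "snd (tp T (K - 1))"
  have K1: "K - 1 < K" using K_pos by simp
  \<comment> \<open>The address of position 0 of the output tape at time \<open>T\<close>; the bound
    on head movement keeps it in the known region.\<close>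
  define j where "j = nat (int c - ?h)"
  have j: "int c - int j = ?h" "T < j" "j + T < W"
    using head_bound[OF K1, of T] by (auto simp: j_def c_def W_def)
  have "cell (tp T (K - 1)) j = 2"
    using out(2) a j(1) last_tape[of T] by (simp add: cell_def bit_sym_def algebra_simps)
  then have d: "nm (St T 1) \<in> derived" "nm (Ce T (K - 1) j 2) \<in> derived" "nm (Ce T K j 1) \<in> derived"
    using derived_complete[of T] j K1 out(1) by (metis order_refl)+
  obtain i where i: "j = Suc i" using j(2) by (cases j) auto
  have "(WW, [(True, St T 1), (True, Ce T (K - 1) j 2), (True, Ce T K j 1)]) \<in> set (horn_rules M T bs)"
    using i j by (auto simp: horn_rules_set accept_rules_def)
  then show "nm WW \<in> derived" by (rule der_hrule) (use d in auto)
qed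

end


section \<open>The reduction\<close>

subsection \<open>Polynomial-time functions on numbers and atoms\<close>

text \<open>Numbers are coded like unary words, and atoms like their names. Functions with the same codes
  are computed by the same programs.\<close>

lemma PT_same_code: "(\<And>x. penc (f x) = penc (g x)) \<Longrightarrow> PT f \<longleftrightarrow> PT g"
  by (simp add: PT_def)

instantiation nat :: pdata
begin
definition "penc n = penc (un n)"
instance ..
end

lemma PT_nat_iff: "PT f \<longleftrightarrow> PT (\<lambda>x. un (f x))"
  by (rule PT_same_code) (simp add: penc_nat_def)

lemma PT_un: "PT f \<Longrightarrow> PT (\<lambda>x. un (f x))"
  by (simp add: PT_nat_iff)

lemma PT_Suc: "PT f \<Longrightarrow> PT (\<lambda>x. Suc (f x))"
  unfolding PT_nat_iff replicate_Suc by (intro PT_Cons PT_const)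

lemma PT_minus_1: "PT f \<Longrightarrow> PT (\<lambda>x. f x - 1 :: nat)"
proof -
  have *: "un (n - 1) = tl (un n)" for n by (cases n) simp_all
  show "PT f \<Longrightarrow> PT (\<lambda>x. f x - 1 :: nat)" unfolding PT_nat_iff[of "\<lambda>x. f x - 1"] * by (intro PT_tl PT_un)
qed

lemma PT_plus: "PT f \<Longrightarrow> PT g \<Longrightarrow> PT (\<lambda>x. f x + g x :: nat)"
  unfolding PT_nat_iff replicate_add by (intro PT_append)

lemma PT_mult:
  assumes "PT f" "PT g"
  shows "PT (\<lambda>x. f x * g x :: nat)"
proof -
  have *: "un (m * n) = concat (map (\<lambda>_. un n) (un m))" for m n
    by (induction m) (simp_all add: replicate_add)
  show ?thesis
    unfolding PT_nat_iff[of "\<lambda>x. f x * g x"] *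
    by (intro PT_concat_map PT_un assms PT_comp[OF assms(2)] PT_fst PT_id)
qed

lemma PT_length: "PT l \<Longrightarrow> PT (\<lambda>x. length (l x))"
proof -
  assume "PT l"
  then have "PT (\<lambda>x. map (\<lambda>_. True) (l x))" by (intro PT_map PT_const)
  then show ?thesis by (simp add: PT_nat_iff map_replicate_const)
qed

lemma PT_poly: "PT f \<Longrightarrow> PT (\<lambda>x. poly p (f x :: nat))"
  using PT_un_poly[of "\<lambda>x. un (f x)" p] by (simp add: PT_nat_iff)

lemma PT_eq_nat: "PT f \<Longrightarrow> PT g \<Longrightarrow> PT (\<lambda>x. f x = (g x :: nat))"
proof -
  assume "PT f" "PT g"
  then have "PT (\<lambda>x. un (f x) = un (g x))" by (intro PT_eq_word PT_un)
  moreover have "un m = un n \<longleftrightarrow> m = n" for m n by (metis length_replicate)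
  ultimately show ?thesis by simp
qed

lemma PT_upt: "PT f \<Longrightarrow> PT (\<lambda>x. [0..<f x])"
proof -
  have "penc (map un ns) = penc ns" for ns by (induction ns) (simp_all add: penc_nat_def)
  then have "PT (\<lambda>x. [0..<f x]) \<longleftrightarrow> PT (\<lambda>x. idx (un (f x)))"
    by (intro PT_same_code) (simp add: idx_def)
  then show "PT f \<Longrightarrow> PT (\<lambda>x. [0..<f x])" by (simp add: PT_idx PT_un)
qed

lemma PT_enumerate: "PT l \<Longrightarrow> PT (\<lambda>x. List.enumerate 0 (l x))"
proof -
  assume l: "PT l"
  obtain r where r: "\<And>a. sz (l a) \<le> poly r (sz a)" using PT_size[OF l] by metis
  define step :: "'b \<Rightarrow> nat \<times> (nat \<times> 'b) list \<Rightarrow> nat \<times> (nat \<times> 'b) list" where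
    "step b s = (Suc (fst s), (fst s, b) # snd s)" for b s
  have fold: "fold step w (0, []) = (length w, rev (List.enumerate 0 w))" for w
    by (induction w rule: rev_induct) (simp_all add: step_def enumerate_append_eq)
  have szn: "sz n = 3 * n" for n :: nat by (simp add: sz_def penc_nat_def sz_word[unfolded sz_def])
  have "PT (\<lambda>x. fold step (l x) (0, []))"
  proof (rule PT_fold[OF _ l PT_const])
    show "PT (\<lambda>p :: 'a \<times> 'b \<times> nat \<times> (nat \<times> 'b) list. step (fst (snd p)) (snd (snd p)))"
      unfolding step_def by (intro PT_Pair PT_Cons PT_Suc PT_fst PT_snd PT_id)
    show "pb (\<lambda>n. 6 * poly r n + poly r n * (2 * (7 * poly r n + 1) + 1) + 1)" by (intro pb_intros)
    fix x xs ys assume *: "l x = xs @ ys"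
    have len: "length xs \<le> poly r (sz x)" using length_le_sz[of "l x"] r[of x] * by simp
    have "sz (List.enumerate 0 xs) \<le> length (List.enumerate 0 xs) * (2 * (7 * poly r (sz x) + 1) + 1)"
    proof (rule sz_list_bound)
      fix p assume "p \<in> set (List.enumerate 0 xs)"
      then have "fst p < length xs" "snd p \<in> set xs"
        by (auto simp: in_set_enumerate_eq) (metis nth_mem)
      moreover have "sz xs \<le> poly r (sz x)" using r[of x] * by simp
      ultimately show "sz p \<le> 7 * poly r (sz x) + 1"
        using len sz_mem[of "snd p" xs] by (cases p) (simp add: szn)
    qed
    also have "\<dots> \<le> poly r (sz x) * (2 * (7 * poly r (sz x) + 1) + 1)"
      using len by (intro mult_le_mono1) simp
    finally show "sz (fold step xs (0, [])) \<le>
        6 * poly r (sz x) + poly r (sz x) * (2 * (7 * poly r (sz x) + 1) + 1) + 1"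
      using len by (simp add: fold szn)
  qed
  then have "PT (\<lambda>x. rev (snd (fold step (l x) (0, []))))" by (intro PT_rev PT_snd)
  then show ?thesis by (simp add: fold)
qed

fun code :: "hatom \<Rightarrow> nat list" where
  "code TT = [0]"
| "code WW = [1]"
| "code QQ = [2]"
| "code (Aa i) = [3, i]"
| "code (Ba i) = [4, i]"
| "code (NB i) = [5, i]"
| "code (Ca i) = [6, i]"
| "code (NC i) = [7, i]"
| "code (St t q) = [8, t, q]"
| "code (Ce t k j s) = [9, t, k, j, s]"

definition hname :: "hatom \<Rightarrow> wd" where
  "hname a = enc_list enc_word (map un (code a))"

lemma inj_hname: "inj hname"
proof (rule injI)
  fix a b assume "hname a = hname b"
  then have "map un (code a) = map un (code b)"
    using prefix_codeD[OF prefix_code_words, of _ "[]" _ "[]"] by (simp add: hname_def)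
  moreover have "inj un" by (rule injI) (metis length_replicate)
  ultimately have "code a = code b" by (simp add: inj_map_eq_map)
  then show "a = b" by (cases a; cases b) auto
qed

instantiation hatom :: pdata
begin
definition "penc a = penc (hname a)"
instance ..
end

lemma PT_hname: "PT f \<Longrightarrow> PT (\<lambda>x. hname (f x))"
  using PT_same_code[of f "\<lambda>x. hname (f x)"] by (simp add: penc_hatom_def)

lemma PT_hatom:
  assumes "\<And>x. code (f x) = g x" "PT (\<lambda>x. map un (g x))"
  shows "PT f"
proof -
  have "PT (\<lambda>x. enc_list enc_word (map un (g x)))" by (intro PT_enc_list PT_enc_word PT_id assms(2))
  then show ?thesis
    using PT_same_code[of f "\<lambda>x. hname (f x)"] by (simp add: penc_hatom_def hname_def assms(1))
qed

lemma PT_Aa: "PT i \<Longrightarrow> PT (\<lambda>x. Aa (i x))"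
  and PT_Ba: "PT i \<Longrightarrow> PT (\<lambda>x. Ba (i x))"
  and PT_NB: "PT i \<Longrightarrow> PT (\<lambda>x. NB (i x))"
  and PT_Ca: "PT i \<Longrightarrow> PT (\<lambda>x. Ca (i x))"
  and PT_NC: "PT i \<Longrightarrow> PT (\<lambda>x. NC (i x))"
  by (rule PT_hatom, rule code.simps, unfold list.map, intro PT_Cons PT_const PT_un, assumption)+

lemma PT_St: "PT t \<Longrightarrow> PT q \<Longrightarrow> PT (\<lambda>x. St (t x) (q x))"
  by (rule PT_hatom, rule code.simps) (unfold list.map, intro PT_Cons PT_const PT_un)

lemma PT_Ce: "PT t \<Longrightarrow> PT k \<Longrightarrow> PT j \<Longrightarrow> PT s \<Longrightarrow> PT (\<lambda>x. Ce (t x) (k x) (j x) (s x))"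
  by (rule PT_hatom, rule code.simps) (unfold list.map, intro PT_Cons PT_const PT_un)

lemmas PT_atoms = PT_Aa PT_Ba PT_NB PT_Ca PT_NC PT_St PT_Ce PT_hname
lemmas PT_nats = PT_Suc PT_minus_1 PT_plus PT_mult PT_length PT_upt PT_eq_nat PT_poly
lemmas PT_data = PT_id PT_const PT_fst PT_snd PT_Pair PT_Cons PT_if PT_append PT_concat_map PT_map
  PT_not PT_conj PT_atoms PT_nats


subsection \<open>The instance generator\<close>

lemma PT_spair:
  assumes "PT xs" "PT ys"
  shows "PT (\<lambda>x. spair (xs x) (ys x))"
  unfolding spair_def cbit_def by (intro PT_data assms)

lemma PT_sinput:
  assumes "PT w" "PT n1" "PT n2" "PT n3"
  shows "PT (\<lambda>x. sinput (w x) (n1 x) (n2 x) (n3 x))"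
  unfolding sinput_def cbit_def by (intro PT_spair PT_data assms)

lemma PT_horn_rules:
  assumes T: "PT T" and bs: "PT bs"
  shows "PT (\<lambda>x. horn_rules M (T x) (bs x))"
proof -
  have init: "PT (\<lambda>x. init_rules (c x) (W x) (T x) k (bs x))" if "PT c" "PT W" for c W and k :: nat
    unfolding init_rules_def
    by (intro PT_data PT_enumerate assms that assms[THEN PT_comp] that[THEN PT_comp])
  have block: "PT (\<lambda>x. rule_block (c x) (W x) (t x) (\<tau> x))" if "PT c" "PT W" "PT t" "PT \<tau>"
    for c W t :: "'z :: pdata \<Rightarrow> nat" and \<tau>
    unfolding rule_block_def body_def sh_def
    by (intro PT_data that that[THEN PT_comp])
  have step: "PT (\<lambda>x. step_rules (c x) (W x) (T x) \<tau>s)" if "PT c" "PT W" for c W and \<tau>s :: "template list"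
    unfolding step_rules_def
    by (intro PT_concat_map block PT_upt T that[THEN PT_comp] PT_fst PT_snd PT_id PT_const)
  have acc: "PT (\<lambda>x. accept_rules (W x) (T x) k)" if "PT W" for W and k :: nat
    unfolding accept_rules_def by (intro PT_data that assms[THEN PT_comp] that[THEN PT_comp])
  show ?thesis
    unfolding horn_rules_def by (intro PT_append init step acc PT_plus PT_mult PT_const T)
qed

definition choice_words :: "nat \<Rightarrow> wd list" where
  "choice_words n2 = map (\<lambda>i. hname (Ba i)) [0..<n2] @ map (\<lambda>i. hname (NB i)) [0..<n2]"

definition saturated_words :: "hrule list \<Rightarrow> nat \<Rightarrow> wd list" where
  "saturated_words H n3 = map (\<lambda>r. hname (fst r)) H @ map (\<lambda>i. hname (Ca i)) [0..<n3] @
     map (\<lambda>i. hname (NC i)) [0..<n3]"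

definition rule_words :: "hrule list \<Rightarrow> nat \<Rightarrow> nat \<Rightarrow> rl list" where
  "rule_words H n2 n3 = ([hname TT], [], [], []) #
     map (\<lambda>i. ([hname (Ba i), hname (NB i)], [], [], [])) [0..<n2] @
     map (\<lambda>i. ([hname (Ca i), hname (NC i)], [], [], [])) [0..<n3] @
     map (\<lambda>r. ([hname (fst r)], map (\<lambda>l. (fst l, hname (snd l))) (snd r), [], [])) H @
     map (\<lambda>z. ([z], [(True, hname WW)], [], [])) (saturated_words H n3) @
     map (\<lambda>a. ([hname QQ], [], [], [(True, a)])) (choice_words n2)"

text \<open>Atoms of Horn bodies are listed separately, because bodies may mention atoms that are
  heads of no rule, such as cells with symbols absent at time 0, and a program must declare all its
  atoms.\<close>

definition atom_words :: "hrule list \<Rightarrow> nat \<Rightarrow> nat \<Rightarrow> nat \<Rightarrow> wd list" where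
  "atom_words H n1 n2 n3 = hname TT # hname WW # hname QQ # map (\<lambda>i. hname (Aa i)) [0..<n1] @
     choice_words n2 @ saturated_words H n3 @ concat (map (\<lambda>r. map (\<lambda>l. hname (snd l)) (snd r)) H)"

definition elit_words :: "nat \<Rightarrow> lit list" where
  "elit_words n2 = (False, hname WW) # map (\<lambda>a. (True, a)) (choice_words n2)"

definition instance_of :: "hrule list \<Rightarrow> nat \<Rightarrow> nat \<Rightarrow> nat \<Rightarrow> inst" where
  "instance_of H n1 n2 n3 = (atom_words H n1 n2 n3, elit_words n2, rule_words H n2 n3,
     ([hname QQ], [], [], [(False, hname WW)]) # rule_words H n2 n3)"

lemma PT_instance_of:
  assumes "PT H" "PT n1" "PT n2" "PT n3"
  shows "PT (\<lambda>x. instance_of (H x) (n1 x) (n2 x) (n3 x))"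
  unfolding instance_of_def atom_words_def elit_words_def rule_words_def saturated_words_def choice_words_def
  by (intro PT_data assms)

lemma PT_e_lit: "PT f \<Longrightarrow> PT (\<lambda>x. e_lit (f x))"
  unfolding e_lit_def by (intro PT_append PT_Cons PT_const PT_fst PT_snd PT_enc_word)

lemma PT_e_inst: "PT f \<Longrightarrow> PT (\<lambda>x. e_inst (f x))"
proof -
  assume f: "PT f"
  have "PT e_rule" unfolding e_rule_def[abs_def]
    by (intro PT_append PT_enc_list PT_enc_word PT_e_lit PT_fst PT_snd PT_id)
  then show ?thesis unfolding e_inst_def
    by (intro PT_append PT_enc_list PT_enc_word PT_e_lit PT_fst PT_snd PT_id f)
qed

section \<open>Correctness of the generated instance\<close>

lemma horn_rules_head: "(h, bd) \<in> set (horn_rules M T bs) \<Longrightarrow> derivable_atom h"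
  by (auto simp: horn_rules_def init_rules_def step_rules_def rule_block_def accept_rules_def split: if_splits)

lemma enumerate_snd: "p \<in> set (List.enumerate 0 xs) \<Longrightarrow> snd p \<in> set xs"
  by (simp add: in_set_enumerate_eq) (metis nth_mem)

lemma horn_rules_neg:
  assumes "(h, bd) \<in> set (horn_rules M T bs)" "(False, a) \<in> set bd"
  shows "\<exists>sb \<in> set bs. (False, a) = fst sb \<or> (False, a) = snd sb"
proof -
  have "(False, a) \<notin> set (body c t pre)" for c t pre by (auto simp: body_def)
  then have "(h, bd) \<notin> set (step_rules c W T \<tau>s)" for c W \<tau>s
    using assms(2) by (auto simp: step_rules_def rule_block_def split: if_splits)
  moreover have "(h, bd) \<notin> set (accept_rules W T k)" for W k
    using assms(2) by (auto simp: accept_rules_def)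
  ultimately obtain c W k where "(h, bd) \<in> set (init_rules c W T k bs)"
    using assms(1) by (auto simp: horn_rules_def)
  then obtain p where "p \<in> set (List.enumerate 0 bs)" "bd = [fst (snd p)] \<or> bd = [snd (snd p)]"
    using assms(2) unfolding init_rules_def by fastforce
  then show ?thesis using assms(2) enumerate_snd[of p bs] by auto
qed

lemma set_spair: "sb \<in> set (spair xs ys) \<Longrightarrow> sb \<in> set xs \<union> set ys \<or> sb = cbit True \<or> sb = cbit False"
  by (auto simp: spair_def split: if_splits)

lemma sinput_neg:
  "sb \<in> set (sinput x n1 n2 n3) \<Longrightarrow> (False, a) = fst sb \<or> (False, a) = snd sb \<Longrightarrow>
    a = TT \<or> (\<exists>i<n1. a = Aa i)"
  unfolding sinput_def by (auto dest!: set_spair simp: cbit_def; blast)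

text \<open>Words of length \<open>n\<close> are given by sets of positions, so length-bounded
  quantifiers over words turn into plain quantifiers over sets.\<close>

definition bit_word :: "nat \<Rightarrow> nat set \<Rightarrow> bool list" where
  "bit_word n y = map (\<lambda>i. i \<in> y) [0..<n]"

lemma ex_bit_word: "length w = n \<Longrightarrow> \<exists>y. w = bit_word n y"
  by (rule exI[of _ "{i. w ! i}"]) (auto simp: bit_word_def intro: nth_equalityI)

lemma length_bit_word [simp]: "length (bit_word n y) = n"
  by (simp add: bit_word_def)

lemma all_bit_word: "(\<forall>w. length w = n \<longrightarrow> P w) \<longleftrightarrow> (\<forall>y. P (bit_word n y))"
  by (metis ex_bit_word length_bit_word)

lemma ex_bit_word_iff: "(\<exists>w. length w = n \<and> P w) \<longleftrightarrow> (\<exists>y. P (bit_word n y))"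
  by (metis ex_bit_word length_bit_word)

lemma accepts_iff:
  fixes x :: "bool list" and n1 n2 n3 :: nat
  defines "bs \<equiv> sinput x n1 n2 n3"
  assumes wf: "tm_wf M" and comp: "tm_computes_in_time M (\<lambda>z. [z \<in> V]) (poly p)"
    and T: "T = poly p (length bs)"
    and hp: "horn_program hname (word_rule hname ` set (horn_rules M T bs)) n1"
  shows "horn_program.accepts hname (word_rule hname ` set (horn_rules M T bs)) n1 n2 n3 y1 y2 y3 \<longleftrightarrow>
    enc_pair (enc_pair (enc_pair x (bit_word n1 y1)) (bit_word n2 y2)) (bit_word n3 y3) \<in> V"
proof -
  interpret hp: horn_program hname "word_rule hname ` set (horn_rules M T bs)" n1 n2 n3 by (rule hp)
  define z where "z = enc_pair (enc_pair (enc_pair x (bit_word n1 y1)) (bit_word n2 y2)) (bit_word n3 y3)"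
  define Y where "Y = hp.YY y1"
  define F where "F = Y \<union> hp.BB y2 \<union> hp.CC y3"
  \<comment> \<open>The relation between a bit and its symbolic version that \<open>tableau\<close>
    asks for at each position; it is preserved by pairing because \<open>spair\<close> follows
    \<open>enc_pair\<close>.\<close>
  define ok where "ok v sb \<longleftrightarrow> (\<forall>b a. (b, a) = (if v then fst sb else snd sb) \<longrightarrow> (if b then hname a \<in> F else hname a \<notin> Y)) \<and>
    (\<forall>b a. (b, a) = (if v then snd sb else fst sb) \<longrightarrow> \<not> derivable_atom a \<and> (if b then hname a \<notin> F else hname a \<in> Y))"
    for v and sb :: sbit
  note defs = ok_def F_def Y_def hp.YY_def hp.BB_def hp.CC_def
  have cb: "ok b (cbit b)" for b by (auto simp: defs cbit_def)
  have pair: "list_all2 ok (enc_pair v w) (spair sv sw)" if "list_all2 ok v sv" "list_all2 ok w sw" for v w sv sw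
    using that(1)
  proof (induction rule: list_all2_induct)
    case Nil
    then show ?case using that(2) cb[of False] by (simp add: enc_pair_def spair_def)
  next
    case (Cons b v sb sv)
    then show ?case using cb[of True] by (simp add: enc_pair_def spair_def)
  qed
  have "list_all2 ok z bs"
    unfolding z_def bs_def sinput_def
  proof (intro pair)
    show "list_all2 ok x (map cbit x)" by (simp add: list_all2_conv_all_nth cb)
    show "list_all2 ok (bit_word n1 y1) (map (\<lambda>i. ((True, Aa i), (False, Aa i))) [0..<n1])"
      by (auto simp: list_all2_conv_all_nth bit_word_def defs)
    show "list_all2 ok (bit_word n2 y2) (map (\<lambda>i. ((True, Ba i), (True, NB i))) [0..<n2])"
      by (auto simp: list_all2_conv_all_nth bit_word_def defs)
    show "list_all2 ok (bit_word n3 y3) (map (\<lambda>i. ((True, Ca i), (True, NC i))) [0..<n3])"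
      by (auto simp: list_all2_conv_all_nth bit_word_def defs)
  qed
  then have len: "length z = length bs" and ok: "\<And>i. i < length bs \<Longrightarrow> ok (z ! i) (bs ! i)"
    by (auto simp: list_all2_conv_all_nth)
  obtain t ts where t: "t \<le> T" "(tm_step M ^^ t) (tm_init M z) = (1, ts)" "tape_output (last ts) [z \<in> V]"
    using comp len unfolding tm_computes_in_time_def T by metis
  have run: "tm_run M z T = (1, ts)"
    using tm_run_halted[of M z t ts T] t by (simp add: tm_run_def)
  interpret tb: tableau M hname T bs Y F z "z \<in> V"
  proof
    show "\<exists>a. y = hname a \<and> \<not> derivable_atom a" if "y \<in> F" for y
      using that by (auto simp: defs)
    show "fst (tm_run M z T) = 1" "fst (last (snd (tm_run M z T))) 0 = bit_sym (z \<in> V)"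
      using run t(3) by (auto simp: tape_output_def)
    show "if b then hname a \<in> F else hname a \<notin> Y"
      if "i < length bs" "(b, a) = (if z ! i then fst (bs ! i) else snd (bs ! i))" for i b a
      using ok[OF that(1)] that(2) unfolding ok_def by blast
    show "\<not> derivable_atom a \<and> (if b then hname a \<notin> F else hname a \<in> Y)"
      if "i < length bs" "(b, a) = (if z ! i then snd (bs ! i) else fst (bs ! i))" for i b a
      using ok[OF that(1)] that(2) unfolding ok_def by blast
  qed (use wf inj_hname len in auto)
  show ?thesis
    using tb.derived_WW unfolding hp.accepts_def z_def[symmetric] F_def Y_def by blast
qed

lemma instance_correct:
  fixes H :: "hrule list"
  assumes "horn_program hname (word_rule hname ` set H) n1"
  shows "e_inst (instance_of H n1 n2 n3) \<in> UNIFORM_CWV_EQUIVALENCE \<longleftrightarrow>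
    (\<forall>y1. \<exists>y2. \<forall>y3. horn_program.accepts hname (word_rule hname ` set H) n1 n2 n3 y1 y2 y3)"
proof -
  interpret hp: horn_program hname "word_rule hname ` set H" n1 n2 n3 "set (atom_words H n1 n2 n3)" by (rule assms)
  let ?A = "atom_words H n1 n2 n3" and ?E = "elit_words n2" and ?R1 = "rule_words H n2 n3"
  let ?R2 = "([hname QQ], [], [], [(False, hname WW)]) # ?R1"
  have ch: "set (choice_words n2) = hp.choice_lits"
    by (auto simp: choice_words_def hp.choice_lits_def)
  have "fst ` word_rule hname ` set H = (\<lambda>r. hname (fst r)) ` set H"
    by (simp add: image_image word_rule_def)
  then have sat: "set (saturated_words H n3) = hp.saturated"
    unfolding saturated_words_def hp.saturated_def by (simp only: set_append set_map set_upt atLeast0LessThan Un_assoc)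
  have E: "elit_of ` set ?E = hp.E0"
    by (simp add: elit_words_def hp.E0_def ch image_image elit_of_def lit_of_def)
  have "(\<lambda>(h, bd). ERule [h] bd [] []) ` word_rule hname ` set H =
      (\<lambda>r. rule_of ([hname (fst r)], map (\<lambda>l. (fst l, hname (snd l))) (snd r), [], [])) ` set H"
    by (simp add: image_image word_rule_def rule_of_def comp_def)
  then have R1: "rule_of ` set ?R1 = hp.R1"
    unfolding rule_words_def hp.R1_def sat[symmetric] ch[symmetric]
    by (simp add: image_Un image_image rule_of_def elit_of_def lit_of_def atLeast0LessThan Un_assoc)
  have R2: "rule_of ` set ?R2 = hp.R2"
    unfolding hp.R2_def R1[symmetric] by (simp add: rule_of_def elit_of_def lit_of_def)
  have atoms: "hname TT \<in> set ?A" "hname WW \<in> set ?A" "hname QQ \<in> set ?A"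
    "\<And>a. a \<in> set (choice_words n2) \<Longrightarrow> a \<in> set ?A" "\<And>a. a \<in> set (saturated_words H n3) \<Longrightarrow> a \<in> set ?A"
    by (simp_all add: atom_words_def)
  have body_atoms: "hname (snd l) \<in> set ?A" if "r \<in> set H" "l \<in> set (snd r)" for r l
    using that unfolding atom_words_def by force
  have names: "\<And>i. i < n2 \<Longrightarrow> hname (Ba i) \<in> set (choice_words n2) \<and> hname (NB i) \<in> set (choice_words n2)"
    "\<And>i. i < n3 \<Longrightarrow> hname (Ca i) \<in> set (saturated_words H n3) \<and> hname (NC i) \<in> set (saturated_words H n3)"
    "\<And>r. r \<in> set H \<Longrightarrow> hname (fst r) \<in> set (saturated_words H n3)"
    by (simp_all add: choice_words_def saturated_words_def)
  have "wf_rules ?A ?E ?R1"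
    unfolding wf_rules_def rule_words_def sub_def set_append set_map list.set(2) ball_Un ball_simps
    using atoms names body_atoms by (simp add: elit_words_def)
  then have wf: "wf_rules ?A ?E ?R1" "wf_rules ?A ?E ?R2"
    using atoms(3) by (simp_all add: wf_rules_def sub_def elit_words_def)
  have "e_inst (instance_of H n1 n2 n3) \<in> UNIFORM_CWV_EQUIVALENCE \<longleftrightarrow>
      uniformly_cwv_equivalent (set ?A, elit_of ` set ?E, rule_of ` set ?R1) (set ?A, elit_of ` set ?E, rule_of ` set ?R2)"
    unfolding UNIFORM_iff instance_of_def wf_rules_iff[symmetric]
    using wf prefix_codeD[OF prefix_code_e_inst, of _ "[]" _ "[]"] by auto
  also have "\<dots> \<longleftrightarrow> (\<forall>y1. \<exists>y2. \<forall>y3. hp.accepts y1 y2 y3)"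
    unfolding E R1 R2
    by (intro hp.uniform_iff_quantified atoms(1-3))
      (use atoms(4,5) in \<open>simp_all add: ch[symmetric] sat[symmetric] subset_iff\<close>, simp add: atom_words_def)
  finally show ?thesis .
qed

lemma Pi_P_3_E:
  assumes "L \<in> Pi_P 3"
  obtains V and q1 q2 q3 :: "nat poly" where "V \<in> class_P"
    "\<And>x. x \<in> L \<longleftrightarrow> (\<forall>y1. length y1 = poly q1 (length x) \<longrightarrow>
      (\<exists>y2. length y2 = poly q2 (length (enc_pair x y1)) \<and>
        (\<forall>y3. length y3 = poly q3 (length (enc_pair (enc_pair x y1) y2)) \<longrightarrow>
          enc_pair (enc_pair (enc_pair x y1) y2) y3 \<in> V)))"
proof -
  have "- L \<in> Sigma_P (Suc (Suc (Suc 0)))" using assms by (simp add: Pi_P_def co_class_def numeral_3_eq_3)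
  then obtain L1 q1 where 1: "- L1 \<in> Sigma_P (Suc (Suc 0))"
    "\<And>x. x \<in> - L \<longleftrightarrow> (\<exists>y. length y = poly q1 (length x) \<and> enc_pair x y \<in> L1)"
    unfolding Sigma_P.simps(2)[of "Suc (Suc 0)"] co_class_def by blast
  from 1(1) obtain L2 q2 where 2: "- L2 \<in> Sigma_P (Suc 0)"
    "\<And>x. x \<in> - L1 \<longleftrightarrow> (\<exists>y. length y = poly q2 (length x) \<and> enc_pair x y \<in> L2)"
    unfolding Sigma_P.simps(2)[of "Suc 0"] co_class_def by blast
  from 2(1) obtain L3 q3 where 3: "- L3 \<in> class_P"
    "\<And>x. x \<in> - L2 \<longleftrightarrow> (\<exists>y. length y = poly q3 (length x) \<and> enc_pair x y \<in> L3)"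
    unfolding Sigma_P.simps co_class_def by blast
  have a: "x \<in> L \<longleftrightarrow> (\<forall>y. length y = poly q1 (length x) \<longrightarrow> enc_pair x y \<notin> L1)" for x
    using 1(2)[of x] by auto
  have b: "x \<notin> L1 \<longleftrightarrow> (\<exists>y. length y = poly q2 (length x) \<and> enc_pair x y \<in> L2)" for x
    using 2(2)[of x] by auto
  have c: "x \<in> L2 \<longleftrightarrow> (\<forall>y. length y = poly q3 (length x) \<longrightarrow> enc_pair x y \<in> - L3)" for x
    using 3(2)[of x] by auto
  show thesis by (rule that[OF 3(1)]) (simp only: a b c)
qed

theorem UNIFORM_hard:
  assumes "L \<in> Pi_P 3"
  shows "poly_reducible L UNIFORM_CWV_EQUIVALENCE"
proof -
  obtain V q1 q2 q3 where V: "V \<in> class_P" and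
    L: "\<And>x. x \<in> L \<longleftrightarrow> (\<forall>y1. length y1 = poly q1 (length x) \<longrightarrow>
      (\<exists>y2. length y2 = poly q2 (length (enc_pair x y1)) \<and>
        (\<forall>y3. length y3 = poly q3 (length (enc_pair (enc_pair x y1) y2)) \<longrightarrow>
          enc_pair (enc_pair (enc_pair x y1) y2) y3 \<in> V)))"
    using Pi_P_3_E[OF assms] by metis
  obtain M p where M: "tm_wf M" "tm_computes_in_time M (\<lambda>z. [z \<in> V]) (poly p)"
    using V unfolding class_P_def poly_time_computable_def by blast
  define n1 where "n1 x = poly q1 (length x)" for x :: "bool list"
  \<comment> \<open>\<open>m1\<close> and \<open>m2\<close> are the lengths of the pairs at which
    the inner bounds are evaluated. They depend on the length of \<open>x\<close> only, so the
    numbers of bits are known before any word is chosen.\<close>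
  define m1 where "m1 x = 2 * length x + 1 + n1 x" for x
  define n2 where "n2 x = poly q2 (m1 x)" for x
  define m2 where "m2 x = 2 * m1 x + 1 + n2 x" for x
  define n3 where "n3 x = poly q3 (m2 x)" for x
  define bs where "bs x = sinput x (n1 x) (n2 x) (n3 x)" for x
  define T where "T x = poly p (length (bs x))" for x
  define H where "H x = horn_rules M (T x) (bs x)" for x
  define f where "f x = e_inst (instance_of (H x) (n1 x) (n2 x) (n3 x))" for x
  have n1: "PT n1" unfolding n1_def[abs_def] by (intro PT_poly PT_length PT_id)
  have m1: "PT m1" unfolding m1_def[abs_def] by (intro PT_plus PT_mult PT_const PT_length PT_id n1)
  have n2: "PT n2" unfolding n2_def[abs_def] by (intro PT_poly m1)
  have m2: "PT m2" unfolding m2_def[abs_def] by (intro PT_plus PT_mult PT_const m1 n2)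
  have n3: "PT n3" unfolding n3_def[abs_def] by (intro PT_poly m2)
  have bs: "PT bs" unfolding bs_def[abs_def] by (intro PT_sinput PT_id n1 n2 n3)
  have T: "PT T" unfolding T_def[abs_def] by (intro PT_poly PT_length bs)
  have "PT f" unfolding f_def[abs_def] H_def by (intro PT_e_inst PT_instance_of PT_horn_rules T bs n1 n2 n3)
  moreover have "x \<in> L \<longleftrightarrow> f x \<in> UNIFORM_CWV_EQUIVALENCE" for x
  proof -
    have hp: "horn_program hname (word_rule hname ` set (H x)) (n1 x)"
    proof
      show "inj hname" by (rule inj_hname)
    next
      fix h bd assume "(h, bd) \<in> word_rule hname ` set (H x)"
      then show "\<exists>t. h = hname t \<and> derivable_atom t"
        using horn_rules_head by (auto simp: word_rule_def H_def)
    next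
      fix h bd y assume "(h, bd) \<in> word_rule hname ` set (H x)" "Neg y \<in> set bd"
      then obtain h' bd' a where "(h', bd') \<in> set (H x)" "(False, a) \<in> set bd'" "y = hname a"
        by (auto simp: word_rule_def lit_of_def split: if_splits)
      then show "y = hname TT \<or> (\<exists>i<n1 x. y = hname (Aa i))"
        using horn_rules_neg sinput_neg unfolding H_def bs_def by metis
    qed
    have "x \<in> L \<longleftrightarrow> (\<forall>y1. \<exists>y2. \<forall>y3.
        enc_pair (enc_pair (enc_pair x (bit_word (n1 x) y1)) (bit_word (n2 x) y2)) (bit_word (n3 x) y3) \<in> V)"
    proof -
      have "length (enc_pair x (bit_word (n1 x) y1)) = m1 x"
        "length (enc_pair (enc_pair x (bit_word (n1 x) y1)) (bit_word (n2 x) y2)) = m2 x" for y1 y2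
        by (simp_all add: enc_pair_def m1_def m2_def)
      then show ?thesis
        unfolding L n1_def[symmetric] all_bit_word ex_bit_word_iff
        by (simp only: n2_def[symmetric] ex_bit_word_iff n3_def[symmetric] all_bit_word)
    qed
    note quantified = this
    have acc: "horn_program.accepts hname (word_rule hname ` set (H x)) (n1 x) (n2 x) (n3 x) y1 y2 y3 \<longleftrightarrow>
        enc_pair (enc_pair (enc_pair x (bit_word (n1 x) y1)) (bit_word (n2 x) y2)) (bit_word (n3 x) y3) \<in> V"
      for y1 y2 y3
      using hp unfolding H_def bs_def by (intro accepts_iff[OF M]) (simp_all add: T_def bs_def)
    show ?thesis unfolding f_def instance_correct[OF hp] acc by (rule quantified)
  qed
  ultimately show ?thesis unfolding poly_reducible_def using PT_imp_poly_time by blast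
qed

theorem theorem4: "complete_for (Pi_P 3) UNIFORM_CWV_EQUIVALENCE"
  unfolding complete_for_def using UNIFORM_in_Pi_P_3 UNIFORM_hard by blast

end
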